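(* Let $1 \le p,q < \infty$, $s > 0$, and let $n \ge 1$ be an integer. Let $X$ be a Banach space having Fourier type $r \in (1,2]$, and let $A : D(A) \subseteq X \to X$ be a linear closed and bounded operator. Let $r_{2\pi} = 2\pi N$ for some positive integer $N$, let $L : L^p([-r_{2\pi},0];X) \to X$ be a bounded linear operator, and for $k \in \mathbb{Z}$ let $L_k \in B(X)$ be defined by $L_k x = L(e_k x)$, where $e_k(\theta) = e^{ik\theta}$. Suppose that $\{L_k\}_{k\in\mathbb{Z}}$ is M-bounded. Suppose that for every $k \in \mathbb{Z}$ the operator $\sum_{j=1}^{n}(ik)^{j} I - A - L_k : D(A) \to X$ is invertible with bounded inverse, and that $$\sup_{k\in\mathbb{Z}} \left\| (ik)^n \Big(\sum_{j=1}^{n}(ik)^{j} I - A - L_k\Big)^{-1} \right\| < \infty .$$ Then for every $f \in B^{s}_{p,q}(\mathbb{T};X)$ there exists a unique strong $B^{s}_{p,q}$-solution of $$\sum_{j=1}^{n} \frac{d^j}{dt^j} x(t) = A x(t) + L(x_t) + f(t).$$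
   Context: $\mathbb{T} = \mathbb{R}/2\pi\mathbb{Z}$; functions on $\mathbb{T}$ are identified with $2\pi$-periodic functions on $\mathbb{R}$. For Banach spaces $X,Y$, $B(X,Y)$ is the space of bounded linear operators from $X$ to $Y$, and $B(X) = B(X,X)$. For a $2\pi$-periodic function $x$, the history segment $x_t$ is the function on $[-r_{2\pi},0]$ given by $x_t(\theta) = x(t+\theta)$. For $x\in X$, $e_k x$ denotes the function $\theta \mapsto e^{ik\theta}x$. Fourier coefficients: $\hat f(k) = \frac{1}{2\pi}\int_0^{2\pi} e^{-ikt} f(t)\,dt$, $k\in\mathbb{Z}$ (extended to distributions in the usual way). M-bounded: a sequence $\{M_k\}_{k\in\mathbb{Z}} \subseteq B(X,Y)$ is M-bounded if $\sup_{k}\|M_k\| < \infty$ and $\sup_{k}\|k(M_{k+1}-M_k)\| < \infty$. Fourier type: $X$ has Fourier type $r \in (1,2]$ if there is $C_r>0$ such that the Fourier transform $\mathcal{F}$ satisfies $\|\mathcal{F}(f)\|_{L^{r'}(\mathbb{R},X)} \le C_r \|f\|_{L^r(\mathbb{R},X)}$ for all $f \in L^r(\mathbb{R},X)$, where $\frac1r+\frac1{r'}=1$. Periodic Besov spaces: let $D(\mathbb{T})$ be the space of infinitely differentiable functions on $\mathbb{T}$ with the topology given by the seminorms $\|f\|_m = \sup_{x\in\mathbb{T}}|f^{(m)}(x)|$, and let $D'(\mathbb{T};X) = \mathcal{L}(D(\mathbb{T}),X)$ be the continuous linear maps. Let $I_0 = \{t\in\mathbb{R}: |t|\le 2\}$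 and $I_k = \{t\in\mathbb{R} : 2^{k-1} < |t| \le 2^{k+1}\}$ for $k\ge 1$. Fix a system $(\phi_k)_{k\ge 0}$ of Schwartz functions on $\mathbb{R}$ with $\operatorname{supp}\phi_k \subset \overline{I_k}$ for each $k$, $\sum_{k\ge 0}\phi_k(x) = 1$ for all $x\in\mathbb{R}$, and $\sup_{k\ge 0,\,x\in\mathbb{R}} 2^{k\alpha}|\phi_k^{(\alpha)}(x)| < \infty$ for each integer $\alpha\ge 0$. For $s \in\mathbb{R}$ and $1\le p,q<\infty$, $$B^s_{p,q}(\mathbb{T};X) = \Big\{ f\in D'(\mathbb{T};X) : \|f\|_{B^s_{p,q}} = \Big(\sum_{j\ge 0} 2^{sjq}\Big\| \sum_{k\in\mathbb{Z}} e_k\,\phi_j(k)\hat f(k)\Big\|_{L^p(\mathbb{T};X)}^q\Big)^{1/q} < \infty\Big\},$$ where $e_k(t)=e^{ikt}$. Strong solution: for $f\in B^s_{p,q}(\mathbb{T};X)$, a function $x\in B^s_{p,q}(\mathbb{T};X)$ is a strong $B^s_{p,q}$-solution of the equation $\sum_{j=1}^{n} \frac{d^j}{dt^j} x(t) = A x(t) + L(x_t) + f(t)$ if $x(t)\in D(A)$, $x\in B^{s+j}_{p,q}(\mathbb{T};X)$ for all $j\in\{1,\dots,n\}$, and the equation holds for a.e. $t\in\mathbb{T}$. *)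

theory Defs
  imports "HOL-Analysis.Analysis"
begin

section \<open>Complex Banach spaces and operators\<close>

class complex_banach = banach +
  fixes scaleC :: "complex \<Rightarrow> 'a \<Rightarrow> 'a"  (infixr "*\<^sub>C" 75)
  assumes scaleC_add_right: "a *\<^sub>C (x + y) = a *\<^sub>C x + a *\<^sub>C y"
    and scaleC_add_left: "(a + b) *\<^sub>C x = a *\<^sub>C x + b *\<^sub>C x"
    and scaleC_scaleC: "a *\<^sub>C b *\<^sub>C x = (a * b) *\<^sub>C x"
    and scaleR_scaleC: "r *\<^sub>R x = complex_of_real r *\<^sub>C x"
    and norm_scaleC: "norm (a *\<^sub>C x) = cmod a * norm x"

definition bounded_clinear :: "('a::complex_banach \<Rightarrow> 'b::complex_banach) \<Rightarrow> bool" where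
  "bounded_clinear T \<longleftrightarrow> bounded_linear T \<and> (\<forall>c x. T (c *\<^sub>C x) = c *\<^sub>C T x)"

text \<open>An operator with domain \<open>D\<close> is a total function whose values off \<open>D\<close> are irrelevant.\<close>

definition clinear_on :: "'a::complex_banach set \<Rightarrow> ('a \<Rightarrow> 'a) \<Rightarrow> bool" where
  "clinear_on D A \<longleftrightarrow>
     0 \<in> D \<and> (\<forall>x\<in>D. \<forall>y\<in>D. x + y \<in> D \<and> A (x + y) = A x + A y) \<and>
     (\<forall>c. \<forall>x\<in>D. c *\<^sub>C x \<in> D \<and> A (c *\<^sub>C x) = c *\<^sub>C A x)"

definition closed_operator :: "'a::complex_banach set \<Rightarrow> ('a \<Rightarrow> 'a) \<Rightarrow> bool" where
  "closed_operator D A \<longleftrightarrow> closed ((\<lambda>x. (x, A x)) ` D)"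

definition bounded_operator :: "'a::complex_banach set \<Rightarrow> ('a \<Rightarrow> 'a) \<Rightarrow> bool" where
  "bounded_operator D A \<longleftrightarrow> (\<exists>C. \<forall>x\<in>D. norm (A x) \<le> C * norm x)"

definition M_bounded :: "(int \<Rightarrow> 'a::complex_banach \<Rightarrow> 'b::complex_banach) \<Rightarrow> bool" where
  "M_bounded M \<longleftrightarrow>
     (\<forall>k. bounded_clinear (M k)) \<and>
     bdd_above (range (\<lambda>k. onorm (M k))) \<and>
     bdd_above (range (\<lambda>k. onorm (\<lambda>x. of_int k *\<^sub>R (M (k + 1) x - M k x))))"


section \<open>Vector-valued Lebesgue spaces\<close>

text \<open>
  The Bochner integral of the library requires a second countable (hence separable) range. As the
  Banach space is arbitrary here, strong measurability is defined directly. Vector-valued integrals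
  are Henstock--Kurzweil integrals, which agree with the Bochner integral on strongly measurable
  functions of integrable norm.
\<close>

definition strongly_measurable :: "'m measure \<Rightarrow> ('m \<Rightarrow> 'a::real_normed_vector) \<Rightarrow> bool" where
  "strongly_measurable M f \<longleftrightarrow>
     (\<exists>s. (\<forall>i. simple_function M (s i)) \<and> (AE x in M. (\<lambda>i. s i x) \<longlonglongrightarrow> f x))"

definition mem_Lp :: "real \<Rightarrow> 'm measure \<Rightarrow> ('m \<Rightarrow> 'a::real_normed_vector) \<Rightarrow> bool" where
  "mem_Lp p M f \<longleftrightarrow> strongly_measurable M f \<and> integrable M (\<lambda>x. norm (f x) powr p)"

definition Lp_norm :: "real \<Rightarrow> 'm measure \<Rightarrow> ('m \<Rightarrow> 'a::real_normed_vector) \<Rightarrow> real" where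
  "Lp_norm p M f = (LINT x|M. norm (f x) powr p) powr (1 / p)"

text \<open>
  Elements of \<open>L\<^sup>p\<close> are functions rather than equivalence classes; linearity and the norm bound
  together force such an operator to agree on functions that are equal almost everywhere.
\<close>

definition bounded_clinear_Lp ::
    "real \<Rightarrow> 'm measure \<Rightarrow> (('m \<Rightarrow> 'a::complex_banach) \<Rightarrow> 'b::complex_banach) \<Rightarrow> bool" where
  "bounded_clinear_Lp p M L \<longleftrightarrow>
     (\<forall>f g. mem_Lp p M f \<longrightarrow> mem_Lp p M g \<longrightarrow> L (\<lambda>x. f x + g x) = L f + L g) \<and>
     (\<forall>c f. mem_Lp p M f \<longrightarrow> L (\<lambda>x. c *\<^sub>C f x) = c *\<^sub>C L f) \<and>
     (\<exists>C. \<forall>f. mem_Lp p M f \<longrightarrow> norm (L f) \<le> C * Lp_norm p M f)"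


section \<open>Schwartz functions and Fourier type\<close>

definition higher_vderiv :: "nat \<Rightarrow> (real \<Rightarrow> complex) \<Rightarrow> real \<Rightarrow> complex" where
  "higher_vderiv m f = ((\<lambda>g t. vector_derivative g (at t)) ^^ m) f"

definition smooth_fun :: "(real \<Rightarrow> complex) \<Rightarrow> bool" where
  "smooth_fun f \<longleftrightarrow> (\<forall>m t. higher_vderiv m f differentiable at t)"

definition schwartz :: "(real \<Rightarrow> complex) \<Rightarrow> bool" where
  "schwartz f \<longleftrightarrow>
     smooth_fun f \<and> (\<forall>l m. \<exists>C. \<forall>x. \<bar>x\<bar> ^ l * cmod (higher_vderiv m f x) \<le> C)"

definition fourier_integral :: "(real \<Rightarrow> complex) \<Rightarrow> real \<Rightarrow> complex" where
  "fourier_integral f \<xi> = (LINT x|lborel. cis (- (\<xi> * x)) * f x)"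

text \<open>
  For an exponent above 1, an \<open>L\<^sup>r\<close> function need not be integrable, so its Fourier transform is the
  one of tempered distributions: it is \<open>g\<close> if \<open>\<integral> \<psi> g = \<integral> \<F>\<psi> f\<close> for all Schwartz functions \<open>\<psi>\<close>.
\<close>

definition is_fourier_transform ::
    "(real \<Rightarrow> 'a::complex_banach) \<Rightarrow> (real \<Rightarrow> 'a) \<Rightarrow> bool" where
  "is_fourier_transform f g \<longleftrightarrow>
     (\<forall>\<psi>. schwartz \<psi> \<longrightarrow>
        (\<exists>I. ((\<lambda>x. \<psi> x *\<^sub>C g x) has_integral I) UNIV \<and>
             ((\<lambda>x. fourier_integral \<psi> x *\<^sub>C f x) has_integral I) UNIV))"

definition fourier_type :: "'a::complex_banach itself \<Rightarrow> real \<Rightarrow> bool" where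
  "fourier_type TYPE('a) r \<longleftrightarrow>
     (\<exists>C>0. \<forall>f :: real \<Rightarrow> 'a. mem_Lp r lebesgue f \<longrightarrow>
        (\<exists>g. mem_Lp (r / (r - 1)) lebesgue g \<and> is_fourier_transform f g \<and>
             Lp_norm (r / (r - 1)) lebesgue g \<le> C * Lp_norm r lebesgue f))"


section \<open>Periodic distributions\<close>

abbreviation torus :: "real measure" where
  "torus \<equiv> lebesgue_on {0..2*pi}"

definition test_functions :: "(real \<Rightarrow> complex) set" where
  "test_functions = {\<psi>. smooth_fun \<psi> \<and> (\<forall>t. \<psi> (t + 2*pi) = \<psi> t)}"

definition test_seminorm :: "nat \<Rightarrow> (real \<Rightarrow> complex) \<Rightarrow> real" where
  "test_seminorm m \<psi> = (SUP t. cmod (higher_vderiv m \<psi> t))"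

text \<open>
  The last condition is continuity for the topology generated by the seminorms \<open>test_seminorm j\<close>.
  Extensionality makes equality of distributions coincide with equality of functions.
\<close>

definition distributions :: "((real \<Rightarrow> complex) \<Rightarrow> 'a::complex_banach) set" where
  "distributions = {u \<in> extensional test_functions.
     (\<forall>\<psi>\<in>test_functions. \<forall>\<eta>\<in>test_functions. u (\<lambda>t. \<psi> t + \<eta> t) = u \<psi> + u \<eta>) \<and>
     (\<forall>c. \<forall>\<psi>\<in>test_functions. u (\<lambda>t. c * \<psi> t) = c *\<^sub>C u \<psi>) \<and>
     (\<forall>\<psi>\<in>test_functions. \<forall>\<epsilon>>0. \<exists>m. \<exists>\<delta>>0. \<forall>\<eta>\<in>test_functions.
        (\<forall>j\<le>m. test_seminorm j (\<lambda>t. \<eta> t - \<psi> t) < \<delta>) \<longrightarrow> norm (u \<eta> - u \<psi>) < \<epsilon>)}"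

definition fourier_coeff :: "((real \<Rightarrow> complex) \<Rightarrow> 'a::complex_banach) \<Rightarrow> int \<Rightarrow> 'a" where
  "fourier_coeff u k = (1 / (2*pi)) *\<^sub>R u (\<lambda>t. cis (- (of_int k * t)))"

definition distr_deriv ::
    "nat \<Rightarrow> ((real \<Rightarrow> complex) \<Rightarrow> 'a::complex_banach) \<Rightarrow> (real \<Rightarrow> complex) \<Rightarrow> 'a" where
  "distr_deriv j u = restrict (\<lambda>\<psi>. (-1) ^ j *\<^sub>R u (higher_vderiv j \<psi>)) test_functions"

text \<open>\<open>represents g u\<close>: the distribution \<open>u\<close> is the integrable periodic function \<open>g\<close>.\<close>

definition represents ::
    "(real \<Rightarrow> 'a::complex_banach) \<Rightarrow> ((real \<Rightarrow> complex) \<Rightarrow> 'a) \<Rightarrow> bool" where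
  "represents g u \<longleftrightarrow>
     (\<forall>t. g (t + 2*pi) = g t) \<and> mem_Lp 1 torus g \<and>
     (\<forall>\<psi>\<in>test_functions. ((\<lambda>t. \<psi> t *\<^sub>C g t) has_integral u \<psi>) {0..2*pi})"


section \<open>Periodic Besov spaces\<close>

definition dyadic_set :: "nat \<Rightarrow> real set" where
  "dyadic_set k = (if k = 0 then {t. \<bar>t\<bar> \<le> 2} else {t. 2 ^ (k - 1) < \<bar>t\<bar> \<and> \<bar>t\<bar> \<le> 2 ^ (k + 1)})"

definition dyadic_resolution :: "(nat \<Rightarrow> real \<Rightarrow> complex) \<Rightarrow> bool" where
  "dyadic_resolution \<phi> \<longleftrightarrow>
     (\<forall>k. schwartz (\<phi> k)) \<and>
     (\<forall>k. closure {x. \<phi> k x \<noteq> 0} \<subseteq> closure (dyadic_set k)) \<and>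
     (\<forall>x. (\<lambda>k. \<phi> k x) sums 1) \<and>
     (\<forall>\<alpha>. \<exists>C. \<forall>k x. 2 ^ (k * \<alpha>) * cmod (higher_vderiv \<alpha> (\<phi> k) x) \<le> C)"

text \<open>The index set of the sum is finite because \<open>\<phi> j\<close> has compact support.\<close>

definition besov_block ::
    "(nat \<Rightarrow> real \<Rightarrow> complex) \<Rightarrow> ((real \<Rightarrow> complex) \<Rightarrow> 'a::complex_banach) \<Rightarrow> nat \<Rightarrow> real \<Rightarrow> 'a"
  where
  "besov_block \<phi> u j t =
     (\<Sum>k | \<phi> j (of_int k) \<noteq> 0. cis (of_int k * t) *\<^sub>C \<phi> j (of_int k) *\<^sub>C fourier_coeff u k)"

definition besov ::
    "(nat \<Rightarrow> real \<Rightarrow> complex) \<Rightarrow> real \<Rightarrow> real \<Rightarrow> real \<Rightarrow> ((real \<Rightarrow> complex) \<Rightarrow> 'a::complex_banach) set"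
  where
  "besov \<phi> s p q = {u \<in> distributions.
     summable (\<lambda>j. 2 powr (s * real j * q) * Lp_norm p torus (besov_block \<phi> u j) powr q)}"


section \<open>The delay equation\<close>

definition delay_symbol :: "((real \<Rightarrow> 'a::complex_banach) \<Rightarrow> 'a) \<Rightarrow> int \<Rightarrow> 'a \<Rightarrow> 'a" where
  "delay_symbol L k x = L (\<lambda>\<theta>. cis (of_int k * \<theta>) *\<^sub>C x)"

definition char_operator ::
    "nat \<Rightarrow> ('a::complex_banach \<Rightarrow> 'a) \<Rightarrow> ((real \<Rightarrow> 'a) \<Rightarrow> 'a) \<Rightarrow> int \<Rightarrow> 'a \<Rightarrow> 'a" where
  "char_operator n A L k x =
     (\<Sum>j=1..n. (\<i> * of_int k) ^ j) *\<^sub>C x - A x - delay_symbol L k x"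

text \<open>
  For positive smoothness every distribution below is an \<open>L\<^sup>p\<close> function. The functions \<open>y j\<close> and \<open>g\<close>
  represent the derivatives of \<open>x\<close> and the forcing term; they are unique up to null sets.
\<close>

definition strong_solution ::
    "(nat \<Rightarrow> real \<Rightarrow> complex) \<Rightarrow> real \<Rightarrow> real \<Rightarrow> real \<Rightarrow> nat \<Rightarrow> 'a::complex_banach set \<Rightarrow> ('a \<Rightarrow> 'a) \<Rightarrow>
     ((real \<Rightarrow> 'a) \<Rightarrow> 'a) \<Rightarrow> ((real \<Rightarrow> complex) \<Rightarrow> 'a) \<Rightarrow> ((real \<Rightarrow> complex) \<Rightarrow> 'a) \<Rightarrow> bool" where
  "strong_solution \<phi> s p q n D A L f x \<longleftrightarrow>
     x \<in> besov \<phi> s p q \<and>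
     (\<forall>j\<in>{1..n}. x \<in> besov \<phi> (s + real j) p q) \<and>
     (\<exists>y g. (\<forall>j\<le>n. represents (y j) (distr_deriv j x)) \<and> represents g f \<and>
        (AE t in torus. y 0 t \<in> D \<and>
           (\<Sum>j=1..n. y j t) = A (y 0 t) + L (\<lambda>\<theta>. y 0 (t + \<theta>)) + g t))"

end

theory Submission
  imports Defs
begin

text \<open>
  On the Fourier mode \<open>k\<close> the equation reads \<open>char_operator n A L k (x\<^sub>k) = f\<^sub>k\<close>, so the coefficients of a
  solution are forced: \<open>x\<^sub>k = R\<^sub>k f\<^sub>k\<close>, where \<open>R\<^sub>k\<close> is the inverse of \<open>char_operator n A L k\<close>. As a
  periodic distribution is determined by its coefficients, this gives uniqueness, and what remains
  is to show that the distribution with coefficients \<open>R\<^sub>k f\<^sub>k\<close> is \<open>n\<close> times smoother than \<open>f\<close>.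

  Both \<open>A\<close> and the delay are used as bounded operators on functions. The decay of \<open>R\<^sub>k\<close> forces \<open>D\<close> to
  be the whole space, so that \<open>A\<close> is bounded (lemma \<open>D_UNIV\<close>). The delay operator \<open>x \<mapsto> (t \<mapsto> L x\<^sub>t)\<close> slides a bounded functional along \<open>x\<close>; therefore it
  maps \<open>L\<^sup>p\<close> of the circle boundedly into bounded functions and acts on the mode \<open>k\<close> as \<open>L\<^sub>k\<close>
  (lemmas \<open>history_trig_poly\<close> and \<open>history_norm\<close>). Hence the blocks \<open>x\<^sub>j\<close> and \<open>f\<^sub>j\<close> of a dyadic
  decomposition, which are trigonometric polynomials, satisfy
  \<open>x\<^sub>j\<^sup>(\<^sup>n\<^sup>) = A x\<^sub>j + L (x\<^sub>j)\<^sub>t + f\<^sub>j - (x\<^sub>j' + \<dots> + x\<^sub>j\<^sup>(\<^sup>n\<^sup>-\<^sup>1\<^sup>))\<close>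
  with lower order operators whose norms do not depend on \<open>j\<close>.

  On the frequencies \<open>M \<le> \<bar>k\<bar> \<le> 4 M\<close> the scalar multiplier \<open>1 / (i k)\<close> has norm at most \<open>6 / M\<close> on \<open>L\<^sup>p\<close>
  (lemma \<open>torus_norm_antiderivative\<close>). It is obtained from Fejer's kernel: tents are multipliers
  with positive kernels, and a convex decreasing function of \<open>\<bar>k - c\<bar>\<close> is a positive combination of
  tents. With \<open>M = 2\<^sup>j\<^sup>-\<^sup>1\<close> every term containing \<open>x\<^sub>j\<close> on the right is \<open>O(2\<^sup>-\<^sup>j)\<close> times the left hand side and
  is absorbed for large \<open>j\<close>, which gives \<open>\<parallel>x\<^sub>j\<^sup>(\<^sup>l\<^sup>)\<parallel> \<le> 2 (12 / 2\<^sup>j)\<^sup>n\<^sup>-\<^sup>l \<parallel>f\<^sub>j\<parallel>\<close> (lemma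
  \<open>solution_block_estimate\<close>). This is the gain of \<open>n\<close> derivatives. Since \<open>s > 0\<close>, the norms \<open>\<parallel>f\<^sub>j\<parallel>\<close> are
  summable, so the series of the blocks and of their derivatives converge in \<open>L\<^sup>p\<close> and almost
  everywhere, and summing the equations of the blocks gives the equation for \<open>x\<close>.

  For uniqueness one needs the coefficients of \<open>t \<mapsto> L x\<^sub>t\<close> for an arbitrary solution. The function
  that represents \<open>x\<close> agrees almost everywhere with the sum of its blocks, because a function
  with vanishing Fourier coefficients vanishes almost everywhere (lemma
  \<open>zero_fourier_coeffs_imp_zero\<close>), and for a sum of blocks the coefficients are computed termwise.
\<close>

section \<open>Minkowski and Levi in Lebesgue spaces\<close>

lemma powr_convex_nonneg:
  fixes x y p l :: real
  assumes "1 \<le> p" "0 \<le> x" "0 \<le> y" "0 \<le> l" "l \<le> 1"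
  shows "(l * x + (1 - l) * y) powr p \<le> l * x powr p + (1 - l) * y powr p"
proof -
  have mono: "m powr p \<le> m" if "0 \<le> m" "m \<le> 1" for m :: real
    using powr_mono'[of 1 p m] that assms(1) by (cases "m = 0") auto
  consider "x = 0" | "y = 0" | "x > 0" "y > 0" using assms by linarith
  then show ?thesis
  proof cases
    case 1
    then show ?thesis
      using mono[of "1 - l"] assms by (simp add: powr_mult mult_right_mono)
  next
    case 2
    then show ?thesis
      using mono[of l] assms by (simp add: powr_mult mult_right_mono)
  next
    case 3
    then show ?thesis
      using convex_onD[OF powr_convex[OF assms(1)], of l y x] assms
      by (simp add: algebra_simps)
  qed
qed

lemma Lp_norm_nonneg [simp]: "0 \<le> Lp_norm p M f"
  by (simp add: Lp_norm_def)

lemma Lp_norm_powr: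
  assumes "0 < p"
  shows "Lp_norm p M f powr p = (LINT x|M. norm (f x) powr p)"
  using assms by (simp add: Lp_norm_def powr_powr integral_nonneg_AE)

lemma Lp_norm_le_iff:
  assumes "0 < p" "0 \<le> B"
  shows "Lp_norm p M f \<le> B \<longleftrightarrow> (LINT x|M. norm (f x) powr p) \<le> B powr p"
proof
  assume "Lp_norm p M f \<le> B"
  then have "Lp_norm p M f powr p \<le> B powr p" 
    using assms by (intro powr_mono2) auto
  then show "(LINT x|M. norm (f x) powr p) \<le> B powr p" using assms by (simp add: Lp_norm_powr)
next
  assume "(LINT x|M. norm (f x) powr p) \<le> B powr p"
  then have "Lp_norm p M f \<le> (B powr p) powr (1 / p)"
    unfolding Lp_norm_def using assms by (intro powr_mono2) (auto simp: integral_nonneg_AE)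
  then show "Lp_norm p M f \<le> B" using assms by (simp add: powr_powr)
qed

text \<open>
  Minkowski's inequality, stated for a dominated function rather than for a sum, so that it applies to the
  norms of vector-valued functions of different types.
\<close>

lemma Lp_norm_triangle:
  fixes h :: "'m \<Rightarrow> 'b::real_normed_vector" and f :: "'m \<Rightarrow> 'c::real_normed_vector"
    and g :: "'m \<Rightarrow> 'd::real_normed_vector"
  assumes p: "1 \<le> p" and hm: "(\<lambda>x. norm (h x)) \<in> borel_measurable M"
    and fi: "integrable M (\<lambda>x. norm (f x) powr p)" and gi: "integrable M (\<lambda>x. norm (g x) powr p)"
    and le: "AE x in M. norm (h x) \<le> norm (f x) + norm (g x)"
  shows "integrable M (\<lambda>x. norm (h x) powr p)"
    and "Lp_norm p M h \<le> Lp_norm p M f + Lp_norm p M g"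
proof -
  \<comment> \<open>Convexity is used for positive upper bounds \<open>a\<close> and \<open>b\<close> of the two norms, which only in the end
    are let tend to them. This covers the case of a vanishing norm.\<close>
  have key: "norm (h x) powr p \<le> (a + b) powr p *
      (a / (a + b) * (norm (f x) powr p / a powr p) + b / (a + b) * (norm (g x) powr p / b powr p))"
    if ab: "a > 0" "b > 0" and "norm (h x) \<le> norm (f x) + norm (g x)" for a b x
  proof -
    define l where "l = a / (a + b)"
    have l: "0 \<le> l" "l \<le> 1" "1 - l = b / (a + b)" using ab by (auto simp: l_def field_simps)
    have "norm (h x) \<le> (a + b) * (l * (norm (f x) / a) + (1 - l) * (norm (g x) / b))"
    proof -
      have "(a + b) * (l * (norm (f x) / a) + (1 - l) * (norm (g x) / b))
        = ((a + b) * l / a) * norm (f x) + ((a + b) * (1 - l) / b) * norm (g x)"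
        by (simp add: distrib_left)
      moreover have "(a + b) * l / a = 1" "(a + b) * (1 - l) / b = 1"
        unfolding l(3) using ab by (simp_all add: l_def)
      ultimately show ?thesis using that by simp
    qed
    then have "norm (h x) powr p \<le> ((a + b) * (l * (norm (f x) / a) + (1 - l) * (norm (g x) / b))) powr p"
      using p by (intro powr_mono2) auto
    also have "\<dots> = (a + b) powr p * (l * (norm (f x) / a) + (1 - l) * (norm (g x) / b)) powr p"
      using ab l by (intro powr_mult)
    also have "\<dots> \<le> (a + b) powr p * (l * (norm (f x) / a) powr p + (1 - l) * (norm (g x) / b) powr p)"
      using ab l p by (intro mult_left_mono powr_convex_nonneg) auto
    finally show ?thesis using l ab by (simp add: powr_divide l_def)
  qed
  have hm': "(\<lambda>x. norm (h x) powr p) \<in> borel_measurable M" using hm by measurable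
  show hi: "integrable M (\<lambda>x. norm (h x) powr p)"
  proof (rule Bochner_Integration.integrable_bound[OF _ hm'])
    show "integrable M (\<lambda>x. (1 + 1) powr p *
      (1 / (1 + 1) * (norm (f x) powr p / 1 powr p) + 1 / (1 + 1) * (norm (g x) powr p / 1 powr p)))"
      using fi gi by (intro integrable_mult_right integrable_add integrable_divide) auto
    show "AE x in M. norm (norm (h x) powr p) \<le> norm ((1 + 1) powr p *
      (1 / (1 + 1) * (norm (f x) powr p / 1 powr p) + 1 / (1 + 1) * (norm (g x) powr p / 1 powr p)))"
      using le by eventually_elim (use key[of 1 1] in \<open>simp add: abs_of_nonneg\<close>)
  qed
  show "Lp_norm p M h \<le> Lp_norm p M f + Lp_norm p M g"
  proof (rule field_le_epsilon)
    fix e :: real assume e: "e > 0"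
    define a where "a = Lp_norm p M f + e / 2"
    define b where "b = Lp_norm p M g + e / 2"
    have ab: "a > 0" "b > 0" using e by (auto simp: a_def b_def add_nonneg_pos)
    have fa: "(LINT x|M. norm (f x) powr p) \<le> a powr p"
      using p ab e by (subst Lp_norm_le_iff[symmetric]) (auto simp: a_def)
    have gb: "(LINT x|M. norm (g x) powr p) \<le> b powr p"
      using p ab e by (subst Lp_norm_le_iff[symmetric]) (auto simp: b_def)
    have "(LINT x|M. norm (h x) powr p) \<le> (LINT x|M. (a + b) powr p *
      (a / (a + b) * (norm (f x) powr p / a powr p) + b / (a + b) * (norm (g x) powr p / b powr p)))"
      by (rule integral_mono_AE[OF hi])
        (use le key[OF ab] fi gi in \<open>auto intro!: integrable_mult_right integrable_add integrable_divide\<close>)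
    also have "\<dots> = (a + b) powr p * (a / (a + b) * ((LINT x|M. norm (f x) powr p) / a powr p)
        + b / (a + b) * ((LINT x|M. norm (g x) powr p) / b powr p))"
      using fi gi by simp
    also have "\<dots> \<le> (a + b) powr p * (a / (a + b) * 1 + b / (a + b) * 1)"
      using ab fa gb by (intro mult_left_mono add_mono) auto
    also have "\<dots> = (a + b) powr p" using ab by (simp add: add_divide_distrib[symmetric])
    finally have "Lp_norm p M h \<le> a + b" using p ab by (subst Lp_norm_le_iff) auto
    then show "Lp_norm p M h \<le> Lp_norm p M f + Lp_norm p M g + e" by (simp add: a_def b_def)
  qed
qed

lemma Lp_norm_sum:
  fixes g :: "'i \<Rightarrow> 'm \<Rightarrow> 'b::real_normed_vector"
  assumes p: "1 \<le> p" and m: "\<And>i. i \<in> S \<Longrightarrow> (\<lambda>x. norm (g i x)) \<in> borel_measurable M"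
    and i: "\<And>i. i \<in> S \<Longrightarrow> integrable M (\<lambda>x. norm (g i x) powr p)" and "finite S"
  shows "integrable M (\<lambda>x. \<bar>\<Sum>i\<in>S. norm (g i x)\<bar> powr p)
    \<and> Lp_norm p M (\<lambda>x. \<Sum>i\<in>S. norm (g i x)) \<le> (\<Sum>i\<in>S. Lp_norm p M (g i))"
  using \<open>finite S\<close> m i
proof (induction S)
  case empty
  then show ?case using p by (simp add: Lp_norm_def)
next
  case (insert a S)
  have m: "(\<lambda>x. norm (\<Sum>i\<in>insert a S. norm (g i x))) \<in> borel_measurable M"
    using insert.prems by measurable
  have "integrable M (\<lambda>x. norm (\<Sum>i\<in>insert a S. norm (g i x)) powr p)"
    "Lp_norm p M (\<lambda>x. \<Sum>i\<in>insert a S. norm (g i x)) \<le> Lp_norm p M (g a) + Lp_norm p M (\<lambda>x. \<Sum>i\<in>S. norm (g i x))"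
    by (rule Lp_norm_triangle[OF p m, of "g a" "\<lambda>x. \<Sum>i\<in>S. norm (g i x)"]; 
      use insert in \<open>auto intro!: AE_I2 simp: abs_of_nonneg sum_nonneg\<close>)+
  then show ?case using insert by (auto simp: abs_of_nonneg sum_nonneg)
qed

text \<open>
  Levi's theorem in \<open>L\<^sup>p\<close>: by Minkowski, the \<open>p\<close>-th powers of the partial sums increase and have bounded
  integrals.
\<close>

lemma Lp_norm_suminf:
  fixes g :: "nat \<Rightarrow> 'm \<Rightarrow> 'b::real_normed_vector"
  assumes p: "1 \<le> p" and m: "\<And>i. (\<lambda>x. norm (g i x)) \<in> borel_measurable M"
    and i: "\<And>i. integrable M (\<lambda>x. norm (g i x) powr p)"
    and s: "summable (\<lambda>i. Lp_norm p M (g i))"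
  shows "AE x in M. summable (\<lambda>i. norm (g i x))"
    and "integrable M (\<lambda>x. \<bar>\<Sum>i. norm (g i x)\<bar> powr p)"
    and "Lp_norm p M (\<lambda>x. \<Sum>i. norm (g i x)) \<le> (\<Sum>i. Lp_norm p M (g i))"
proof -
  define B where "B = (\<Sum>i. Lp_norm p M (g i))"
  have B: "0 \<le> B" unfolding B_def by (intro suminf_nonneg s) auto
  define G where "G n x = (\<Sum>i<n. norm (g i x)) powr p" for n x
  have Gm [measurable]: "G n \<in> borel_measurable M" for n
    unfolding G_def using m by measurable
  have Gn: "0 \<le> G n x" for n x by (simp add: G_def)
  have inc: "incseq (\<lambda>n. G n x)" for x
    unfolding G_def using p by (intro incseq_SucI powr_mono2) (auto simp: sum_nonneg)
  have GB: "(\<integral>\<^sup>+ x. ennreal (G n x) \<partial>M) \<le> ennreal (B powr p)" for n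
  proof -
    have *: "integrable M (\<lambda>x. \<bar>\<Sum>i<n. norm (g i x)\<bar> powr p)"
      "Lp_norm p M (\<lambda>x. \<Sum>i<n. norm (g i x)) \<le> (\<Sum>i<n. Lp_norm p M (g i))"
      using Lp_norm_sum[OF p, of "{..<n}" g M] m i by auto
    have "(\<Sum>i<n. Lp_norm p M (g i)) \<le> B" unfolding B_def by (rule sum_le_suminf[OF s]) auto
    with *(2) have "Lp_norm p M (\<lambda>x. \<Sum>i<n. norm (g i x)) \<le> B" by linarith
    then have "(LINT x|M. G n x) \<le> B powr p"
      using p B by (subst (asm) Lp_norm_le_iff) (auto simp: G_def sum_nonneg)
    moreover have "integrable M (G n)" using *(1) by (simp add: G_def[abs_def] sum_nonneg)
    ultimately show ?thesis
      using Gn by (subst nn_integral_eq_integral) (auto intro: ennreal_leI)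
  qed
  have sup: "(\<integral>\<^sup>+ x. (SUP n. ennreal (G n x)) \<partial>M) \<le> ennreal (B powr p)"
    using inc GB
    by (subst nn_integral_monotone_convergence_SUP)
      (auto intro!: SUP_least simp: incseq_def le_fun_def ennreal_leI)
  then have "(\<integral>\<^sup>+ x. (SUP n. ennreal (G n x)) \<partial>M) \<noteq> \<infinity>" by (auto simp: top_unique)
  then have "AE x in M. (SUP n. ennreal (G n x)) \<noteq> \<infinity>"
    by (intro nn_integral_noteq_infinite) auto
  then show ae: "AE x in M. summable (\<lambda>i. norm (g i x))"
  proof eventually_elim
    case (elim x)
    then obtain C where C: "(SUP n. ennreal (G n x)) = ennreal C" "C \<ge> 0"
      by (cases "SUP n. ennreal (G n x)") auto
    have "(\<Sum>i<n. norm (g i x)) \<le> C powr (1 / p)" for n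
    proof -
      have "ennreal (G n x) \<le> ennreal C" unfolding C(1)[symmetric] by (rule SUP_upper) auto
      then have "G n x \<le> C" using C by simp
      then have "G n x powr (1 / p) \<le> C powr (1 / p)" using p Gn by (intro powr_mono2) auto
      then show ?thesis using p by (simp add: G_def powr_powr sum_nonneg)
    qed
    then show ?case by (intro summableI_nonneg_bounded) auto
  qed
  have lim: "AE x in M. ennreal (\<bar>\<Sum>i. norm (g i x)\<bar> powr p) = (SUP n. ennreal (G n x))"
    using ae
  proof eventually_elim
    case (elim x)
    have "(\<lambda>n. G n x) \<longlonglongrightarrow> (\<Sum>i. norm (g i x)) powr p"
      unfolding G_def using p summable_LIMSEQ[OF elim] by (intro tendsto_powr2) (auto simp: sum_nonneg)
    then have "(\<lambda>n. ennreal (G n x)) \<longlonglongrightarrow> ennreal ((\<Sum>i. norm (g i x)) powr p)"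
      by (intro tendsto_ennrealI)
    moreover have "(\<lambda>n. ennreal (G n x)) \<longlonglongrightarrow> (SUP n. ennreal (G n x))"
      using inc[of x] by (intro LIMSEQ_SUP) (auto simp: incseq_def ennreal_leI)
    ultimately show ?case
      using suminf_nonneg[OF elim] by (simp add: LIMSEQ_unique)
  qed
  have meas: "(\<lambda>x. \<bar>\<Sum>i. norm (g i x)\<bar> powr p) \<in> borel_measurable M"
    using m by measurable
  have le: "(\<integral>\<^sup>+ x. ennreal (\<bar>\<Sum>i. norm (g i x)\<bar> powr p) \<partial>M) \<le> ennreal (B powr p)"
    using sup by (subst nn_integral_cong_AE[OF lim])
  then have "(\<integral>\<^sup>+ x. ennreal (\<bar>\<Sum>i. norm (g i x)\<bar> powr p) \<partial>M) < \<infinity>" 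
    by (rule le_less_trans) simp
  then show int: "integrable M (\<lambda>x. \<bar>\<Sum>i. norm (g i x)\<bar> powr p)"
    using meas by (intro integrableI_nonneg) auto
  have "(LINT x|M. \<bar>\<Sum>i. norm (g i x)\<bar> powr p) \<le> B powr p"
    using le nn_integral_eq_integral[OF int] by simp
  then show "Lp_norm p M (\<lambda>x. \<Sum>i. norm (g i x)) \<le> (\<Sum>i. Lp_norm p M (g i))"
    using p B by (subst Lp_norm_le_iff) (auto simp: B_def)
qed

section \<open>Limits of Banach space valued integrals\<close>

lemma has_integral_norm_le:
  fixes f :: "real \<Rightarrow> 'b::banach"
  assumes "(f has_integral i) S" "(g has_integral j) S" "\<And>x. x \<in> S \<Longrightarrow> norm (f x) \<le> g x"
  shows "norm i \<le> j"
  using integral_norm_bound_integral[of f S g] assms by (auto simp: integrable_on_def integral_unique)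

text \<open>
  Dominated convergence for functions whose range may be non-separable: an error bound by real functions
  of small integral passes directly to Riemann sums.
\<close>

lemma has_integral_limit_dominated:
  fixes f :: "real \<Rightarrow> 'b::banach" and g :: "nat \<Rightarrow> real \<Rightarrow> 'b"
  assumes g: "\<And>n. (g n has_integral I n) {a..b}"
    and h: "\<And>n. (h n has_integral H n) {a..b}" and H: "H \<longlonglongrightarrow> (0::real)"
    and le: "\<And>n x. x \<in> {a..b} \<Longrightarrow> norm (f x - g n x) \<le> h n x"
  shows "\<exists>J. (f has_integral J) {a..b} \<and> I \<longlonglongrightarrow> J"
proof -
  have *: "norm (I m - I n) \<le> H m + H n" for m n
  proof (rule has_integral_norm_le[OF has_integral_diff[OF g g] has_integral_add[OF h h]])
    fix x assume "x \<in> {a..b}"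
    then show "norm (g m x - g n x) \<le> h m x + h n x"
      using le[of x m] le[of x n] norm_triangle_ineq4[of "f x - g n x" "f x - g m x"] by simp
  qed
  have "Cauchy I"
  proof (rule metric_CauchyI)
    fix e :: real assume "e > 0"
    then have "eventually (\<lambda>n. H n < e / 2) sequentially"
      using order_tendstoD(2)[OF H, of "e/2"] by simp
    then obtain N where "\<And>n. n \<ge> N \<Longrightarrow> H n < e / 2" by (auto simp: eventually_sequentially)
    then show "\<exists>M. \<forall>m\<ge>M. \<forall>n\<ge>M. dist (I m) (I n) < e"
      using * by (intro exI[of _ N]) (smt (verit) dist_norm field_sum_of_halves)
  qed
  then obtain J where J: "I \<longlonglongrightarrow> J" using Cauchy_convergent_iff convergent_def by blast
  have "(f has_integral J) {a..b}"
    unfolding has_integral_real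
  proof (intro allI impI)
    fix e :: real assume e: "e > 0"
    have "eventually (\<lambda>n. H n < e / 4) sequentially"
      using e order_tendstoD(2)[OF H, of "e/4"] by simp
    moreover have "eventually (\<lambda>n. dist (I n) J < e / 4) sequentially"
      using e J by (intro tendstoD) auto
    ultimately have "eventually (\<lambda>n. H n < e / 4 \<and> dist (I n) J < e / 4) sequentially"
      by (rule eventually_conj)
    \<comment> \<open>Riemann sums of \<open>f\<close> differ from those of \<open>g n\<close> by at most those of \<open>h n\<close>; all three are controlled
      by one gauge.\<close>
    then obtain n where n: "H n < e / 4" "norm (I n - J) < e / 4"
      by (auto simp: eventually_sequentially dist_norm)
    obtain A where A: "gauge A" "\<And>D. D tagged_division_of {a..b} \<Longrightarrow> A fine D \<Longrightarrow>
        norm ((\<Sum>(x, k)\<in>D. measure lborel k *\<^sub>R g n x) - I n) < e / 4"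
      using g[of n, unfolded has_integral_real, rule_format, of "e / 4"] e by auto
    obtain B where B: "gauge B" "\<And>D. D tagged_division_of {a..b} \<Longrightarrow> B fine D \<Longrightarrow>
        norm ((\<Sum>(x, k)\<in>D. measure lborel k *\<^sub>R h n x) - H n) < e / 4"
      using h[of n, unfolded has_integral_real, rule_format, of "e / 4"] e by auto
    show "\<exists>\<gamma>. gauge \<gamma> \<and> (\<forall>\<D>. \<D> tagged_division_of {a..b} \<and> \<gamma> fine \<D> \<longrightarrow>
        norm ((\<Sum>(x, k)\<in>\<D>. measure lborel k *\<^sub>R f x) - J) < e)"
    proof (intro exI conjI allI impI)
      show "gauge (\<lambda>x. A x \<inter> B x)" using A(1) B(1) by (rule gauge_Int)
      fix D assume D: "D tagged_division_of {a..b} \<and> (\<lambda>x. A x \<inter> B x) fine D"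
      then have fine: "A fine D" "B fine D" by (auto simp: fine_Int)
      have "norm ((\<Sum>(x, k)\<in>D. measure lborel k *\<^sub>R f x) - (\<Sum>(x, k)\<in>D. measure lborel k *\<^sub>R g n x))
          = norm (\<Sum>(x, k)\<in>D. measure lborel k *\<^sub>R (f x - g n x))"
        by (simp add: sum_subtractf[symmetric] scaleR_diff_right split_beta)
      also have "\<dots> \<le> (\<Sum>(x, k)\<in>D. measure lborel k *\<^sub>R h n x)"
      proof (rule sum_norm_le, clarify)
        fix x k assume "(x, k) \<in> D"
        then have "x \<in> {a..b}" using D tag_in_interval[of D "{a..b}" x k] by auto
        then show "norm (measure lborel k *\<^sub>R (f x - g n x)) \<le> measure lborel k *\<^sub>R h n x"
          using le by (simp add: mult_left_mono)
      qed
      also have "\<dots> < e / 2" using B(2)[of D] D fine n(1) by (simp add: abs_if split: if_splits)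
      finally have 1: "norm ((\<Sum>(x, k)\<in>D. measure lborel k *\<^sub>R f x) - (\<Sum>(x, k)\<in>D. measure lborel k *\<^sub>R g n x)) < e / 2" .
      have 2: "norm ((\<Sum>(x, k)\<in>D. measure lborel k *\<^sub>R g n x) - I n) < e / 4" using A(2)[of D] D fine by auto
      have "norm ((\<Sum>(x, k)\<in>D. measure lborel k *\<^sub>R f x) - J) \<le>
        norm ((\<Sum>(x, k)\<in>D. measure lborel k *\<^sub>R f x) - (\<Sum>(x, k)\<in>D. measure lborel k *\<^sub>R g n x))
        + norm ((\<Sum>(x, k)\<in>D. measure lborel k *\<^sub>R g n x) - I n) + norm (I n - J)"
        by norm
      then show "norm ((\<Sum>(x, k)\<in>D. measure lborel k *\<^sub>R f x) - J) < e" using 1 2 n(2) by linarith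
    qed
  qed
  with J show ?thesis by blast
qed

section \<open>Periodic functions and trigonometric polynomials\<close>

interpretation scaleC: bounded_bilinear "scaleC :: complex \<Rightarrow> 'a::complex_banach \<Rightarrow> 'a"
proof
  fix a b :: complex and x y :: 'a and r :: real
  show "(r *\<^sub>R a) *\<^sub>C x = r *\<^sub>R (a *\<^sub>C x)"
    by (simp add: scaleR_scaleC scaleC_scaleC scaleR_conv_of_real)
  show "a *\<^sub>C (r *\<^sub>R x) = r *\<^sub>R (a *\<^sub>C x)"
    by (simp add: scaleR_scaleC scaleC_scaleC mult.commute)
  show "\<exists>K. \<forall>a (x::'a). norm (a *\<^sub>C x) \<le> norm a * norm x * K"
    by (intro exI[of _ 1]) (simp add: norm_scaleC)
qed (simp_all add: scaleC_add_left scaleC_add_right)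

lemma scaleC_one [simp]: "1 *\<^sub>C (x::'a::complex_banach) = x"
  using scaleR_scaleC[of 1 x] by simp

lemma has_integral_nonneg_iff:
  fixes G :: "real \<Rightarrow> real"
  assumes "\<And>x. 0 \<le> G x"
  shows "(G has_integral I) {a..b} \<longleftrightarrow> integrable (lebesgue_on {a..b}) G \<and> I = (LINT x|lebesgue_on {a..b}. G x)"
proof
  assume *: "(G has_integral I) {a..b}"
  then have "G absolutely_integrable_on {a..b}"
    using assms by (intro nonnegative_absolutely_integrable_1) auto
  then have "integrable (lebesgue_on {a..b}) G"
    by (simp add: integrable_restrict_space set_integrable_def)
  moreover have "I = (LINT x|lebesgue_on {a..b}. G x)"
    by (rule has_integral_unique[OF * has_integral_integral_lebesgue_on[OF calculation]]) simp
  ultimately show "integrable (lebesgue_on {a..b}) G \<and> I = (LINT x|lebesgue_on {a..b}. G x)" ..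
next
  assume "integrable (lebesgue_on {a..b}) G \<and> I = (LINT x|lebesgue_on {a..b}. G x)"
  then show "(G has_integral I) {a..b}" 
    using has_integral_integral_lebesgue_on[of "{a..b}" G] by simp
qed

lemma periodic_int:
  fixes G :: "real \<Rightarrow> 'b"
  assumes "\<And>t. G (t + 2 * pi) = G t"
  shows "G (t + 2 * pi * of_int m) = G t"
proof -
  have nat: "G (t + 2 * pi * real n) = G t" for n t
  proof (induction n)
    case (Suc n)
    have "t + 2 * pi * real (Suc n) = t + 2 * pi * real n + 2 * pi" by (simp add: algebra_simps)
    then show ?case using Suc assms by metis
  qed simp
  show ?thesis
  proof (cases m rule: int_cases2)
    case (nonneg n)
    then show ?thesis using nat[of t n] by simp
  next
    case (nonpos n)
    then show ?thesis using nat[of "t - 2 * pi * real n" n] by simp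
  qed
qed

text \<open>
  The interval \<open>{a..a + 2 * pi}\<close> contains a multiple \<open>c\<close> of the period; the part to the right of \<open>c\<close> is moved one
  period to the left.
\<close>

lemma has_integral_periodic:
  fixes G :: "real \<Rightarrow> 'b::banach"
  assumes per: "\<And>t. G (t + 2 * pi) = G t" and I: "(G has_integral I) {0..2 * pi}"
  shows "(G has_integral I) {a..a + 2 * pi}"
proof -
  have int: "(G has_integral I) {2 * pi * of_int m..2 * pi * of_int m + 2 * pi}" for m
  proof -
    have "(\<lambda>x. G (x + - (2 * pi * of_int m))) = G"
      using periodic_int[of G, OF per, of _ "- m"] by (intro ext) simp
    then show ?thesis
      using has_integral_shift_real_ivl[OF I, of "- (2 * pi * of_int m)"] by (simp add: add.commute)
  qed
  define c where "c = 2 * pi * of_int (\<lfloor>a / (2 * pi)\<rfloor> + 1)"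
  have c: "c - 2 * pi \<le> a" "a \<le> c"
    unfolding c_def using floor_divide_lower[of "2 * pi" a] floor_divide_upper[of "2 * pi" a] 
    by (auto simp: algebra_simps)
  have Ic: "(G has_integral I) {c - 2 * pi..c}"
    using int[of "\<lfloor>a / (2 * pi)\<rfloor>"] by (simp add: c_def algebra_simps)
  obtain J1 where J1: "(G has_integral J1) {c - 2 * pi..a}"
    using integrable_subinterval_real[of G "c - 2 * pi" c "c - 2 * pi" a] Ic c by (auto simp: integrable_on_def)
  obtain J2 where J2: "(G has_integral J2) {a..c}"
    using integrable_subinterval_real[of G "c - 2 * pi" c a c] Ic c by (auto simp: integrable_on_def)
  have "I = J1 + J2"
    by (rule has_integral_unique[OF Ic has_integral_combine[OF c J1 J2]])
  moreover have "(G has_integral J1) {c..a + 2 * pi}"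
  proof -
    have "(\<lambda>x. G (x + - (2 * pi))) = G"
      using periodic_int[of G, OF per, of _ "- 1"] by (intro ext) simp
    then show ?thesis
      using has_integral_shift_real_ivl[OF J1, of "- (2 * pi)"] by simp
  qed
  ultimately show ?thesis
    using has_integral_combine[OF _ _ J2, of "a + 2 * pi" J1] c by (simp add: add.commute)
qed

lemma has_integral_periodic_multiple:
  fixes G :: "real \<Rightarrow> 'b::banach"
  assumes per: "\<And>t. G (t + 2 * pi) = G t" and I: "(G has_integral I) {0..2 * pi}"
  shows "(G has_integral real N *\<^sub>R I) {a..a + 2 * pi * real N}"
proof (induction N)
  case (Suc N)
  show ?case
  proof -
    have "a \<le> a + 2 * pi * real N" "a + 2 * pi * real N \<le> a + 2 * pi * real N + 2 * pi" by simp_all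
    from has_integral_combine[OF this Suc has_integral_periodic[OF per I]]
    show ?thesis by (simp add: scaleR_add_left distrib_left add_ac)
  qed
qed (use has_integral_null_real[of a a G] in simp)

definition trig_poly :: "int set \<Rightarrow> (int \<Rightarrow> 'a) \<Rightarrow> real \<Rightarrow> 'a::complex_banach" where
  "trig_poly S c t = (\<Sum>k\<in>S. cis (of_int k * t) *\<^sub>C c k)"

lemma trig_poly_cong: "(\<And>k. k \<in> S \<Longrightarrow> c k = d k) \<Longrightarrow> trig_poly S c t = trig_poly S d t"
  by (simp add: trig_poly_def)

lemma cis_periodic [simp]: "cis (of_int k * (t + 2 * pi)) = cis (of_int k * t)"
proof -
  have "cis (of_int k * (t + 2 * pi)) = cis (of_int k * t) * cis (2 * pi * of_int k)"
    by (simp add: cis_mult algebra_simps)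
  then show ?thesis by simp
qed

lemma trig_poly_periodic [simp]: "trig_poly S c (t + 2 * pi) = trig_poly S c t"
  by (simp add: trig_poly_def)

lemma continuous_on_trig_poly [continuous_intros]: "continuous_on T (trig_poly S c)"
  unfolding trig_poly_def by (intro continuous_intros scaleC.continuous_on)

lemma trig_poly_add: "trig_poly S (\<lambda>k. c k + d k) t = trig_poly S c t + trig_poly S d t"
  by (simp add: trig_poly_def scaleC_add_right sum.distrib)

lemma trig_poly_sum: "trig_poly S (\<lambda>k. \<Sum>i\<in>I. c i k) t = (\<Sum>i\<in>I. trig_poly S (c i) t)"
  unfolding trig_poly_def scaleC.sum_right by (rule sum.swap)

lemma trig_poly_scaleC: "trig_poly S (\<lambda>k. z *\<^sub>C c k) t = z *\<^sub>C trig_poly S c t"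
  by (simp add: trig_poly_def scaleC.sum_right scaleC_scaleC mult.commute)

lemma trig_poly_translate: "trig_poly S (\<lambda>k. cis (of_int k * u) *\<^sub>C c k) t = trig_poly S c (t + u)"
  by (simp add: trig_poly_def scaleC_scaleC cis_mult distrib_left)

lemma trig_poly_modulate:
  "trig_poly ((\<lambda>k. k + m) ` S) (\<lambda>k. c (k - m)) t = cis (of_int m * t) *\<^sub>C trig_poly S c t"
proof -
  have "trig_poly ((\<lambda>k. k + m) ` S) (\<lambda>k. c (k - m)) t = (\<Sum>k\<in>S. cis (of_int (k + m) * t) *\<^sub>C c k)"
    unfolding trig_poly_def by (subst sum.reindex) (auto simp: inj_on_def)
  also have "\<dots> = (\<Sum>k\<in>S. cis (of_int m * t) *\<^sub>C cis (of_int k * t) *\<^sub>C c k)"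
    by (intro sum.cong refl) (simp add: scaleC_scaleC cis_mult distrib_right add.commute)
  finally show ?thesis by (simp add: trig_poly_def scaleC.sum_right)
qed

abbreviation torus_norm :: "real \<Rightarrow> (real \<Rightarrow> 'b::real_normed_vector) \<Rightarrow> real" where
  "torus_norm p f \<equiv> Lp_norm p torus f"

lemma continuous_measurable_on_Icc:
  fixes f :: "real \<Rightarrow> 'b::real_normed_vector"
  assumes "continuous_on {a..b} f"
  shows "(\<lambda>x. norm (f x)) \<in> borel_measurable (lebesgue_on {a..b})"
  using assms by (intro continuous_imp_measurable_on_sets_lebesgue continuous_intros) auto

lemma continuous_integrable_powr_Icc:
  fixes f :: "real \<Rightarrow> 'b::real_normed_vector"
  assumes "continuous_on {a..b} f" "1 \<le> p"
  shows "integrable (lebesgue_on {a..b}) (\<lambda>x. norm (f x) powr p)"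
proof -
  have "continuous_on {a..b} (\<lambda>x. norm (f x) powr p)"
    using assms by (intro continuous_on_powr' continuous_intros) auto
  then have "(\<lambda>x. norm (f x) powr p) integrable_on {a..b}"
    by (rule integrable_continuous_real)
  then obtain I where "((\<lambda>x. norm (f x) powr p) has_integral I) {a..b}"
    by (auto simp: integrable_on_def)
  then show ?thesis by (subst (asm) has_integral_nonneg_iff) simp_all
qed

lemma torus_norm_triangle:
  fixes f g :: "real \<Rightarrow> 'b::real_normed_vector"
  assumes "1 \<le> p" "continuous_on {0..2 * pi} f" "continuous_on {0..2 * pi} g"
  shows "torus_norm p (\<lambda>t. f t + g t) \<le> torus_norm p f + torus_norm p g"
proof -
  have m: "(\<lambda>x. norm (f x + g x)) \<in> borel_measurable torus"
    by (rule continuous_measurable_on_Icc) (rule continuous_on_add[OF assms(2,3)])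
  have i: "integrable torus (\<lambda>x. norm (f x) powr p)" "integrable torus (\<lambda>x. norm (g x) powr p)"
    by (rule continuous_integrable_powr_Icc[OF assms(2,1)], rule continuous_integrable_powr_Icc[OF assms(3,1)])
  have "AE x in torus. norm (f x + g x) \<le> norm (f x) + norm (g x)"
    by (rule AE_I2) (rule norm_triangle_ineq)
  from Lp_norm_triangle(2)[OF assms(1) m i this] show ?thesis .
qed

lemma torus_norm_scale:
  assumes "\<And>t. norm (g t) = a * norm (f t)" "0 \<le> a" "1 \<le> p"
  shows "torus_norm p g = a * torus_norm p f"
proof -
  have "(LINT t|torus. norm (g t) powr p) = a powr p * (LINT t|torus. norm (f t) powr p)"
    using assms(2) by (simp add: assms(1) powr_mult)
  then show ?thesis
    using assms(2,3) by (simp add: Lp_norm_def powr_mult powr_powr integral_nonneg_AE)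
qed

lemma torus_norm_mono:
  fixes f :: "real \<Rightarrow> 'b::real_normed_vector" and g :: "real \<Rightarrow> 'c::real_normed_vector"
  assumes "1 \<le> p" "continuous_on {0..2 * pi} f" "continuous_on {0..2 * pi} g"
    "\<And>t. norm (f t) \<le> norm (g t)"
  shows "torus_norm p f \<le> torus_norm p g"
proof -
  have "(LINT t|torus. norm (f t) powr p) \<le> (LINT t|torus. norm (g t) powr p)"
  proof (rule integral_mono)
    show "norm (f t) powr p \<le> norm (g t) powr p" for t
      using assms(1,4) by (intro powr_mono2) auto
  qed (rule continuous_integrable_powr_Icc[OF assms(2,1)], rule continuous_integrable_powr_Icc[OF assms(3,1)])
  then show ?thesis
    unfolding Lp_norm_def using assms(1) by (intro powr_mono2) (simp_all add: integral_nonneg_AE)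
qed

lemma torus_norm_translate:
  fixes f :: "real \<Rightarrow> 'b::real_normed_vector"
  assumes p: "1 \<le> p" and f: "continuous_on UNIV f" "\<And>t. f (t + 2 * pi) = f t"
  shows "torus_norm p (\<lambda>t. f (t + u)) = torus_norm p f"
proof -
  let ?G = "\<lambda>t. norm (f t) powr p"
  have "integrable torus ?G"
    by (rule continuous_integrable_powr_Icc[OF continuous_on_subset[OF f(1)] p]) simp
  then have "(?G has_integral (LINT t|torus. ?G t)) {0..2 * pi}"
    by (subst has_integral_nonneg_iff) auto
  then have "(?G has_integral (LINT t|torus. ?G t)) {u..u + 2 * pi}"
    using f(2) by (intro has_integral_periodic) auto
  then have "((\<lambda>t. ?G (t + u)) has_integral (LINT t|torus. ?G t)) {0..2 * pi}"
    using has_integral_shift_real_ivl[of ?G _ u "u + 2 * pi" u] by simp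
  then have "(LINT t|torus. ?G (t + u)) = (LINT t|torus. ?G t)"
    by (subst (asm) has_integral_nonneg_iff) auto
  then show ?thesis by (simp add: Lp_norm_def)
qed

section \<open>Scalar Fourier multipliers\<close>

lemma sum_cis_roots_of_unity:
  fixes j :: int and K :: nat
  assumes "\<bar>j\<bar> < int K"
  shows "(\<Sum>m<K. cis (of_int j * (2 * pi * real m / real K))) = (if j = 0 then of_nat K else 0)"
proof (cases "j = 0")
  case False
  define z where "z = cis (of_int j * (2 * pi / real K))"
  have K: "K > 0" using assms False by linarith
  have pow: "cis (of_int j * (2 * pi * real m / real K)) = z ^ m" for m
    unfolding z_def Complex.DeMoivre by (simp add: mult_ac)
  have "z ^ K = cis (2 * pi * of_int j)"
    unfolding z_def Complex.DeMoivre using K by (simp add: mult_ac)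
  then have zK: "z ^ K = 1" by simp
  have "z \<noteq> 1"
  proof
    assume "z = 1"
    then have "cos (of_int j * (2 * pi / real K)) = 1" by (simp add: z_def complex_eq_iff)
    then obtain n :: int where n: "of_int j * (2 * pi / real K) = of_int n * 2 * pi"
      using cos_one_2pi_int by blast
    then have "real_of_int j = real_of_int (n * int K)" using K by (simp add: field_simps)
    then have "j = n * int K" by linarith
    then have "int K dvd j" by simp
    then show False using False assms zdvd_imp_le[of "int K" "\<bar>j\<bar>"] by simp
  qed
  then show ?thesis unfolding pow using False zK by (simp add: sum_gp_strict)
qed simp

lemma sum_of_bool_diff_eq:
  "(\<Sum>l<r. \<Sum>l'<r. of_bool (int l - int l' = k)) = (r - nat \<bar>k\<bar> :: nat)"
proof -
  have inner: "(\<Sum>l'<r. of_bool (int l - int l' = k) :: nat) = of_bool (k \<le> int l \<and> int l < int r + k)" for l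
  proof (cases "k \<le> int l \<and> int l < int r + k")
    case True
    have "(\<Sum>l'<r. of_bool (int l - int l' = k) :: nat) = (\<Sum>l'<r. if l' = nat (int l - k) then 1 else 0)"
      using True by (intro sum.cong) auto
    also have "\<dots> = 1" using True by (simp add: nat_less_iff)
    finally show ?thesis using True by simp
  next
    case False
    then have "(\<Sum>l'<r. of_bool (int l - int l' = k) :: nat) = 0" by (intro sum.neutral) auto
    with False show ?thesis by simp
  qed
  have "(\<Sum>l<r. of_bool (k \<le> int l \<and> int l < int r + k) :: nat)
      = card {l \<in> {..<r}. k \<le> int l \<and> int l < int r + k}"
    by (subst sum_of_bool_eq) (simp_all add: Int_def)
  also have "{l \<in> {..<r}. k \<le> int l \<and> int l < int r + k} = {nat k..<nat (min (int r) (int r + k))}"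
    by auto
  also have "card \<dots> = r - nat \<bar>k\<bar>" by (cases "k \<ge> 0") auto
  finally show ?thesis by (simp add: inner)
qed

text \<open>
  The square of the absolute value of a geometric sum is Fejer's kernel. Its coefficients count the pairs
  with a given difference and so form a tent. Averages over roots of unity take the place of integrals,
  which turns convolutions into finite sums of translates.
\<close>

lemma fejer_tent:
  fixes k :: int and r K :: nat
  defines "u \<equiv> \<lambda>m. 2 * pi * real m / real K"
  assumes K: "\<bar>k\<bar> + int r \<le> int K" "0 < K"
  shows "(\<Sum>m<K. of_real ((cmod (\<Sum>l<r. cis (real l * u m)))\<^sup>2 / real K) * cis (of_int k * - u m))
    = of_nat (r - nat \<bar>k\<bar>)"
proof -
  have "of_real ((cmod (\<Sum>l<r. cis (real l * u m)))\<^sup>2 / real K) * cis (of_int k * - u m)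
      = (\<Sum>l<r. \<Sum>l'<r. cis (of_int (int l - int l' - k) * u m) / of_nat K)" for m
  proof -
    have "of_real ((cmod (\<Sum>l<r. cis (real l * u m)))\<^sup>2) = (\<Sum>l<r. cis (real l * u m)) * cnj (\<Sum>l<r. cis (real l * u m))"
      by (rule complex_norm_square)
    also have "\<dots> = (\<Sum>l<r. \<Sum>l'<r. cis (real l * u m) * cis (- (real l' * u m)))"
      by (simp add: sum_product cis_cnj)
    finally show ?thesis
      by (simp add: sum_distrib_right cis_mult sum_divide_distrib left_diff_distrib)
  qed
  then have "(\<Sum>m<K. of_real ((cmod (\<Sum>l<r. cis (real l * u m)))\<^sup>2 / real K) * cis (of_int k * - u m))
    = (\<Sum>m<K. \<Sum>l<r. \<Sum>l'<r. cis (of_int (int l - int l' - k) * u m) / of_nat K)"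
    by simp
  also have "\<dots> = (\<Sum>l<r. \<Sum>m<K. \<Sum>l'<r. cis (of_int (int l - int l' - k) * u m) / of_nat K)"
    by (rule sum.swap)
  also have "\<dots> = (\<Sum>l<r. \<Sum>l'<r. \<Sum>m<K. cis (of_int (int l - int l' - k) * u m) / of_nat K)"
    by (intro sum.cong refl sum.swap)
  also have "\<dots> = (\<Sum>l<r. \<Sum>l'<r. of_nat (of_bool (int l - int l' = k)))"
  proof (intro sum.cong refl)
    fix l l' assume "l \<in> {..<r}" "l' \<in> {..<r}"
    then have "\<bar>int l - int l' - k\<bar> < int K" using K(1) by auto
    from sum_cis_roots_of_unity[OF this]
    show "(\<Sum>m<K. cis (of_int (int l - int l' - k) * u m) / of_nat K) = of_nat (of_bool (int l - int l' = k))"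
      using K(2) by (simp add: u_def sum_divide_distrib[symmetric])
  qed
  also have "\<dots> = of_nat (r - nat \<bar>k\<bar>)"
    unfolding of_nat_sum[symmetric] sum_of_bool_diff_eq ..
  finally show ?thesis .
qed

text \<open>
  Discrete Taylor formula: up to \<open>Suc Q\<close> a sequence is a constant plus tents, the weights being its second
  differences. They are nonnegative for a convex sequence.
\<close>

lemma convex_tent_decomposition:
  fixes g :: "nat \<Rightarrow> real"
  assumes "k \<le> Suc Q"
  shows "g k = g (Suc Q) + real (Suc Q - k) * (g Q - g (Suc Q))
    + (\<Sum>r<Q. real (Suc r - k) * (g r - 2 * g (Suc r) + g (Suc (Suc r))))"
  using assms
proof (induction Q)
  case 0
  then have "k = 0 \<or> k = 1" by auto
  then show ?case by auto
next
  case (Suc Q)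
  show ?case
  proof (cases "k = Suc (Suc Q)")
    case True
    then show ?thesis by simp
  next
    case False
    then have k: "k \<le> Suc Q" using Suc.prems by simp
    then have "real (Suc (Suc Q) - k) = real (Suc Q - k) + 1" by (simp add: of_nat_diff)
    then show ?thesis
      by (subst Suc.IH[OF k]) (simp add: algebra_simps)
  qed
qed

text \<open>
  \<open>C\<close> bounds the norm of the multiplier \<open>a\<close> on the trigonometric polynomials with spectrum in \<open>S\<close>. The type
  argument fixes the space in which they take their values.
\<close>

definition multiplier_bound ::
    "real \<Rightarrow> 'a::complex_banach itself \<Rightarrow> int set \<Rightarrow> (int \<Rightarrow> complex) \<Rightarrow> real \<Rightarrow> bool" where
  "multiplier_bound p (X :: 'a itself) S a C \<longleftrightarrow> 0 \<le> C \<and> (\<forall>F c. finite F \<longrightarrow> F \<subseteq> S \<longrightarrow>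
     torus_norm p (trig_poly F (\<lambda>k. a k *\<^sub>C (c k :: 'a))) \<le> C * torus_norm p (trig_poly F c))"

context
  fixes p :: real and X :: "'a::complex_banach itself"
  assumes p: "1 \<le> p"
begin

lemma multiplier_boundD:
  assumes "multiplier_bound p X S a C" "finite F" "F \<subseteq> S"
  shows "torus_norm p (trig_poly F (\<lambda>k. a k *\<^sub>C (c k :: 'a))) \<le> C * torus_norm p (trig_poly F c)"
  using assms by (simp add: multiplier_bound_def)

lemma multiplier_bound_nonneg: "multiplier_bound p X S a C \<Longrightarrow> 0 \<le> C"
  by (simp add: multiplier_bound_def)

lemma multiplier_boundI:
  assumes "0 \<le> C" "\<And>F (c :: int \<Rightarrow> 'a). finite F \<Longrightarrow> F \<subseteq> S \<Longrightarrow>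
     torus_norm p (trig_poly F (\<lambda>k. a k *\<^sub>C c k)) \<le> C * torus_norm p (trig_poly F c)"
  shows "multiplier_bound p X S a C"
  using assms by (simp add: multiplier_bound_def)

lemma multiplier_bound_cong: 
  assumes "multiplier_bound p X S a C" "\<And>k. k \<in> S \<Longrightarrow> a k = b k"
  shows "multiplier_bound p X S b C"
proof (rule multiplier_boundI[OF multiplier_bound_nonneg[OF assms(1)]])
  fix F and c :: "int \<Rightarrow> 'a" assume F: "finite F" "F \<subseteq> S"
  have "trig_poly F (\<lambda>k. a k *\<^sub>C c k) = trig_poly F (\<lambda>k. b k *\<^sub>C c k)"
    using F by (intro ext trig_poly_cong) (simp add: assms(2) subset_iff)
  then show "torus_norm p (trig_poly F (\<lambda>k. b k *\<^sub>C c k)) \<le> C * torus_norm p (trig_poly F c)"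
    using multiplier_boundD[OF assms(1) F, of c] by simp
qed

lemma multiplier_bound_mono: 
  assumes "multiplier_bound p X S a C" "T \<subseteq> S" "C \<le> D"
  shows "multiplier_bound p X T a D"
proof (rule multiplier_boundI)
  show "0 \<le> D" using multiplier_bound_nonneg[OF assms(1)] assms(3) by linarith
  fix F and c :: "int \<Rightarrow> 'a" assume F: "finite F" "F \<subseteq> T"
  then have "torus_norm p (trig_poly F (\<lambda>k. a k *\<^sub>C c k)) \<le> C * torus_norm p (trig_poly F c)"
    using assms(2) by (intro multiplier_boundD[OF assms(1)]) auto
  also have "\<dots> \<le> D * torus_norm p (trig_poly F c)"
    by (rule mult_right_mono[OF assms(3)]) simp
  finally show "torus_norm p (trig_poly F (\<lambda>k. a k *\<^sub>C c k)) \<le> D * torus_norm p (trig_poly F c)" .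
qed

lemma multiplier_bound_mult:
  assumes "multiplier_bound p X S a C" "multiplier_bound p X S b D"
  shows "multiplier_bound p X S (\<lambda>k. a k * b k) (C * D)"
proof (rule multiplier_boundI)
  show "0 \<le> C * D" using assms[THEN multiplier_bound_nonneg] by simp
  fix F and c :: "int \<Rightarrow> 'a" assume F: "finite F" "F \<subseteq> S"
  have "torus_norm p (trig_poly F (\<lambda>k. (a k * b k) *\<^sub>C c k))
      = torus_norm p (trig_poly F (\<lambda>k. a k *\<^sub>C (b k *\<^sub>C c k)))" by (simp add: scaleC_scaleC)
  also have "\<dots> \<le> C * torus_norm p (trig_poly F (\<lambda>k. b k *\<^sub>C c k))"
    by (rule multiplier_boundD[OF assms(1) F])
  also have "\<dots> \<le> C * (D * torus_norm p (trig_poly F c))"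
    by (rule mult_left_mono[OF multiplier_boundD[OF assms(2) F] multiplier_bound_nonneg[OF assms(1)]])
  finally show "torus_norm p (trig_poly F (\<lambda>k. (a k * b k) *\<^sub>C c k)) \<le> C * D * torus_norm p (trig_poly F c)"
    by simp
qed

lemma multiplier_bound_add:
  assumes "multiplier_bound p X S a C" "multiplier_bound p X S b D"
  shows "multiplier_bound p X S (\<lambda>k. a k + b k) (C + D)"
proof (rule multiplier_boundI)
  show "0 \<le> C + D" using assms[THEN multiplier_bound_nonneg] by simp
  fix F and c :: "int \<Rightarrow> 'a" assume F: "finite F" "F \<subseteq> S"
  have "trig_poly F (\<lambda>k. (a k + b k) *\<^sub>C c k)
      = (\<lambda>t. trig_poly F (\<lambda>k. a k *\<^sub>C c k) t + trig_poly F (\<lambda>k. b k *\<^sub>C c k) t)"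
    by (rule ext) (simp add: scaleC_add_left trig_poly_add)
  moreover have "torus_norm p (\<lambda>t. trig_poly F (\<lambda>k. a k *\<^sub>C c k) t + trig_poly F (\<lambda>k. b k *\<^sub>C c k) t)
      \<le> torus_norm p (trig_poly F (\<lambda>k. a k *\<^sub>C c k)) + torus_norm p (trig_poly F (\<lambda>k. b k *\<^sub>C c k))"
    by (rule torus_norm_triangle[OF p continuous_on_trig_poly continuous_on_trig_poly])
  moreover have "torus_norm p (trig_poly F (\<lambda>k. a k *\<^sub>C c k)) + torus_norm p (trig_poly F (\<lambda>k. b k *\<^sub>C c k))
      \<le> C * torus_norm p (trig_poly F c) + D * torus_norm p (trig_poly F c)"
    by (rule add_mono[OF multiplier_boundD[OF assms(1) F] multiplier_boundD[OF assms(2) F]])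
  ultimately show "torus_norm p (trig_poly F (\<lambda>k. (a k + b k) *\<^sub>C c k)) \<le> (C + D) * torus_norm p (trig_poly F c)"
    by (simp add: distrib_right)
qed

lemma multiplier_bound_const: "multiplier_bound p X S (\<lambda>_. z) (cmod z)"
proof (rule multiplier_boundI)
  fix F and c :: "int \<Rightarrow> 'a" assume F: "finite F" "F \<subseteq> S"
  have "torus_norm p (trig_poly F (\<lambda>k. z *\<^sub>C c k)) = cmod z * torus_norm p (trig_poly F c)"
    by (rule torus_norm_scale[OF _ _ p]) (simp_all add: trig_poly_scaleC norm_scaleC)
  then show "torus_norm p (trig_poly F (\<lambda>k. z *\<^sub>C c k)) \<le> cmod z * torus_norm p (trig_poly F c)"
    by simp
qed simp

lemma multiplier_bound_cmult: "multiplier_bound p X S a C \<Longrightarrow> multiplier_bound p X S (\<lambda>k. z * a k) (cmod z * C)"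
  by (rule multiplier_bound_mult[OF multiplier_bound_const])

lemma multiplier_bound_sum:
  assumes "finite I" "\<And>i. i \<in> I \<Longrightarrow> multiplier_bound p X S (a i) (C i)"
  shows "multiplier_bound p X S (\<lambda>k. \<Sum>i\<in>I. a i k) (\<Sum>i\<in>I. C i)"
  using assms
proof (induction I)
  case empty
  show ?case using multiplier_bound_const[of S 0] by simp
next
  case (insert i I)
  have "multiplier_bound p X S (\<lambda>k. a i k + (\<Sum>i\<in>I. a i k)) (C i + (\<Sum>i\<in>I. C i))"
    by (rule multiplier_bound_add[OF insert.prems insert.IH[OF insert.prems]]) simp_all
  then show ?case using insert.hyps by simp
qed

lemma multiplier_bound_translation: "multiplier_bound p X S (\<lambda>k. cis (of_int k * u)) 1"
proof (rule multiplier_boundI)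
  fix F and c :: "int \<Rightarrow> 'a" assume F: "finite F" "F \<subseteq> S"
  have "torus_norm p (\<lambda>t. trig_poly F c (t + u)) = torus_norm p (trig_poly F c)"
    by (rule torus_norm_translate[OF p continuous_on_trig_poly trig_poly_periodic])
  moreover have "trig_poly F (\<lambda>k. cis (of_int k * u) *\<^sub>C c k) = (\<lambda>t. trig_poly F c (t + u))"
    by (rule ext) (rule trig_poly_translate)
  ultimately show "torus_norm p (trig_poly F (\<lambda>k. cis (of_int k * u) *\<^sub>C c k)) \<le> 1 * torus_norm p (trig_poly F c)"
    by simp
qed simp

lemma multiplier_bound_modulation:
  assumes "multiplier_bound p X ((\<lambda>k. k - m) ` S) a C"
  shows "multiplier_bound p X S (\<lambda>k. a (k - m)) C"
proof (rule multiplier_boundI[OF multiplier_bound_nonneg[OF assms]])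
  fix F and c :: "int \<Rightarrow> 'a" assume F: "finite F" "F \<subseteq> S"
  define G where "G = (\<lambda>k. k - m) ` F"
  have FG: "F = (\<lambda>k. k + m) ` G" by (auto simp: G_def image_image)
  have shift: "torus_norm p (trig_poly F d) = torus_norm p (trig_poly G (\<lambda>k. d (k + m)))" for d :: "int \<Rightarrow> 'a"
  proof -
    have "trig_poly F d t = cis (of_int m * t) *\<^sub>C trig_poly G (\<lambda>k. d (k + m)) t" for t
      using trig_poly_modulate[of m G "\<lambda>k. d (k + m)" t] by (simp add: FG)
    then show ?thesis 
      using torus_norm_scale[of "trig_poly F d" 1 "trig_poly G (\<lambda>k. d (k + m))"] p by (simp add: norm_scaleC)
  qed
  have "finite G" "G \<subseteq> (\<lambda>k. k - m) ` S" using F by (auto simp: G_def)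
  then have "torus_norm p (trig_poly G (\<lambda>k. a k *\<^sub>C c (k + m))) \<le> C * torus_norm p (trig_poly G (\<lambda>k. c (k + m)))"
    by (rule multiplier_boundD[OF assms])
  then show "torus_norm p (trig_poly F (\<lambda>k. a (k - m) *\<^sub>C c k)) \<le> C * torus_norm p (trig_poly F c)"
    by (simp add: shift)
qed

lemma multiplier_bound_power: 
  assumes "multiplier_bound p X S a C"
  shows "multiplier_bound p X S (\<lambda>k. a k ^ n) (C ^ n)"
proof (induction n)
  case 0
  show ?case using multiplier_bound_const[of S 1] by simp
next
  case (Suc n)
  show ?case unfolding power_Suc by (rule multiplier_bound_mult[OF assms Suc])
qed

text \<open>
  The kernel is positive, so its norm is its mean, which is the value \<open>r\<close> of the tent at frequency 0.
\<close>

lemma multiplier_bound_tent: "multiplier_bound p X {- B..B} (\<lambda>k. of_nat (r - nat \<bar>k\<bar>)) (real r)"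
proof -
  \<comment> \<open>The number \<open>K\<close> of nodes is so large that no two frequencies that occur are congruent modulo \<open>K\<close>.\<close>
  define K where "K = nat \<bar>B\<bar> + r + 1"
  define u where "u m = 2 * pi * real m / real K" for m
  define w where "w m = (cmod (\<Sum>l<r. cis (real l * u m)))\<^sup>2 / real K" for m
  have eq: "(\<Sum>m<K. of_real (w m) * cis (of_int k * - u m)) = of_nat (r - nat \<bar>k\<bar>)" if "\<bar>k\<bar> \<le> \<bar>B\<bar>" for k
    unfolding w_def u_def by (rule fejer_tent) (use that in \<open>auto simp: K_def\<close>)
  have "multiplier_bound p X {- B..B} (\<lambda>k. \<Sum>m<K. of_real (w m) * cis (of_int k * - u m)) (\<Sum>m<K. cmod (of_real (w m)) * 1)"
    by (intro multiplier_bound_sum multiplier_bound_cmult multiplier_bound_translation) simp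
  moreover have "(\<Sum>m<K. cmod (of_real (w m)) * 1) = real r"
  proof -
    have "complex_of_real (\<Sum>m<K. w m) = of_real (real r)" using eq[of 0] by simp
    then have "(\<Sum>m<K. w m) = real r" unfolding of_real_eq_iff .
    moreover have "0 \<le> w m" for m by (simp add: w_def)
    then have "cmod (of_real (w m)) = w m" for m by (simp only: norm_of_real abs_of_nonneg)
    ultimately show ?thesis by (simp only: mult_1_right)
  qed
  ultimately have "multiplier_bound p X {- B..B} (\<lambda>k. \<Sum>m<K. of_real (w m) * cis (of_int k * - u m)) (real r)"
    by (simp only:)
  then show ?thesis by (rule multiplier_bound_cong) (use eq in auto)
qed

text \<open>
  All weights in the tent decomposition are nonnegative, so the norms of the tents add up to the value of
  the same decomposition at 0.
\<close>

lemma multiplier_bound_convex: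
  fixes g :: "nat \<Rightarrow> real"
  assumes "0 \<le> g (Suc Q)" "g (Suc Q) \<le> g Q"
    and "\<And>r. 2 * g (Suc r) \<le> g r + g (Suc (Suc r))"
  shows "multiplier_bound p X {- int (Suc Q)..int (Suc Q)} (\<lambda>k. of_real (g (nat \<bar>k\<bar>))) (g 0)"
proof -
  define d where "d r = g r - 2 * g (Suc r) + g (Suc (Suc r))" for r
  have d: "0 \<le> d r" for r using assms(3)[of r] by (simp add: d_def)
  let ?S = "{- int (Suc Q)..int (Suc Q)}"
  have "multiplier_bound p X ?S (\<lambda>k. of_real (g (Suc Q)) + of_real (g Q - g (Suc Q)) * of_nat (Suc Q - nat \<bar>k\<bar>)
     + (\<Sum>r<Q. of_real (d r) * of_nat (Suc r - nat \<bar>k\<bar>)))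
    (cmod (of_real (g (Suc Q))) + cmod (of_real (g Q - g (Suc Q))) * real (Suc Q)
     + (\<Sum>r<Q. cmod (of_real (d r)) * real (Suc r)))"
    by (intro multiplier_bound_add multiplier_bound_sum multiplier_bound_cmult multiplier_bound_const multiplier_bound_tent) simp
  moreover have "(cmod (of_real (g (Suc Q))) + cmod (of_real (g Q - g (Suc Q))) * real (Suc Q)
     + (\<Sum>r<Q. cmod (of_real (d r)) * real (Suc r))) = g 0"
    using convex_tent_decomposition[of 0 Q g] assms(1,2) d 
    by (simp only: norm_of_real abs_of_nonneg diff_ge_0_iff_ge d_def[symmetric] mult.commute minus_nat.diff_0 le0)
  ultimately have "multiplier_bound p X ?S (\<lambda>k. of_real (g (Suc Q)) + of_real (g Q - g (Suc Q)) * of_nat (Suc Q - nat \<bar>k\<bar>)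
     + (\<Sum>r<Q. of_real (d r) * of_nat (Suc r - nat \<bar>k\<bar>))) (g 0)" by simp
  then show ?thesis
  proof (rule multiplier_bound_cong)
    fix k assume "k \<in> ?S"
    then have "nat \<bar>k\<bar> \<le> Suc Q" by auto
    from convex_tent_decomposition[OF this, of g]
    have "complex_of_real (g (nat \<bar>k\<bar>)) = of_real (g (Suc Q) + real (Suc Q - nat \<bar>k\<bar>) * (g Q - g (Suc Q))
       + (\<Sum>r<Q. real (Suc r - nat \<bar>k\<bar>) * d r))" by (simp only: d_def)
    then show "of_real (g (Suc Q)) + of_real (g Q - g (Suc Q)) * of_nat (Suc Q - nat \<bar>k\<bar>)
     + (\<Sum>r<Q. of_real (d r) * of_nat (Suc r - nat \<bar>k\<bar>)) = complex_of_real (g (nat \<bar>k\<bar>))"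
      by (simp add: mult.commute)
  qed
qed

text \<open>
  On either half line \<open>1 / \<bar>k\<bar>\<close> is a convex decreasing function of the distance from \<open>\<plusminus>M\<close>. The two halves are
  glued by means of the multiplier \<open>sgn k\<close>, which away from 0 is proportional to a difference of tents.
\<close>

lemma multiplier_bound_inverse_frequency:
  fixes M :: int
  assumes M: "1 \<le> M"
  shows "multiplier_bound p X {k. M \<le> \<bar>k\<bar> \<and> \<bar>k\<bar> \<le> 4 * M} (\<lambda>k. 1 / (\<i> * of_int k)) (6 / of_int M)"
proof -
  let ?S = "{k. M \<le> \<bar>k\<bar> \<and> \<bar>k\<bar> \<le> 4 * M}"
  define g where "g l = 1 / (of_int M + real l)" for l
  define Q where "Q = nat (5 * M) - 1"
  have Q: "int (Suc Q) = 5 * M" using M by (simp add: Q_def)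
  have E0: "multiplier_bound p X {- (5 * M)..5 * M} (\<lambda>k. of_real (g (nat \<bar>k\<bar>))) (g 0)"
    unfolding Q[symmetric]
  proof (rule multiplier_bound_convex)
    show "0 \<le> g (Suc Q)" "g (Suc Q) \<le> g Q" using M by (auto simp: g_def frac_le)
    fix r
    define x where "x = of_int M + real r"
    have x: "x > 0" using M by (simp add: x_def)
    have "1 / x + 1 / (x + 2) - 2 / (x + 1) = 2 / (x * (x + 1) * (x + 2))"
      using x by (simp add: divide_simps) (simp add: algebra_simps)
    moreover have "0 \<le> 2 / (x * (x + 1) * (x + 2))" using x by simp
    ultimately have "2 / (x + 1) \<le> 1 / x + 1 / (x + 2)" by linarith
    then show "2 * g (Suc r) \<le> g r + g (Suc (Suc r))" by (simp add: g_def x_def algebra_simps)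
  qed
  have T0: "multiplier_bound p X {- (5 * M)..5 * M} (\<lambda>k. of_nat (nat (5 * M) - nat \<bar>k\<bar>)) (5 * of_int M)"
    using multiplier_bound_tent[of "5 * M" "nat (5 * M)"] M by simp
  have shift: "multiplier_bound p X ?S (\<lambda>k. a (k - m)) C" if "multiplier_bound p X {- (5 * M)..5 * M} a C" "\<bar>m\<bar> = M" for a C m
    by (rule multiplier_bound_modulation, rule multiplier_bound_mono[OF that(1)]) (use that(2) in auto)
  \<comment> \<open>For \<open>k \<in> ?S\<close> of the sign of \<open>m = \<plusminus>M\<close> the value \<open>E m k\<close> is \<open>1 / \<bar>k\<bar>\<close>. The sign of \<open>k\<close> is a
    multiple \<open>W\<close> of the difference of two tents and selects the right one of the two functions. The radius
    \<open>5 M\<close> bounds \<open>\<bar>k - m\<bar>\<close>.\<close>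
  define E where "E m k = complex_of_real (g (nat \<bar>k - m\<bar>))" for m k :: int
  have E: "multiplier_bound p X ?S (E m) (1 / of_int M)" if "\<bar>m\<bar> = M" for m
    using shift[OF E0 that] by (simp add: E_def[abs_def] g_def)
  define W where "W k = 1 / (2 * of_int M) * (of_nat (nat (5 * M) - nat \<bar>k - M\<bar>)
    + (-1) * of_nat (nat (5 * M) - nat \<bar>k - - M\<bar>) :: complex)" for k
  have W: "multiplier_bound p X ?S W 5"
  proof -
    have "multiplier_bound p X ?S W (cmod (1 / (2 * of_int M)) * (5 * of_int M + cmod (-1) * (5 * of_int M)))"
      unfolding W_def by (intro multiplier_bound_cmult multiplier_bound_add shift[OF T0]) (use M in auto)
    moreover have "cmod (1 / (2 * of_int M)) * (5 * of_int M + cmod (-1) * (5 * of_int M)) = 5"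
      using M by (simp add: norm_divide norm_mult)
    ultimately show ?thesis by (simp only:)
  qed
  have W_sgn: "W k = of_int (sgn k)" if "k \<in> ?S" for k
  proof -
    have "int (nat (5 * M) - nat \<bar>k - M\<bar>) - int (nat (5 * M) - nat \<bar>k - - M\<bar>) = 2 * M * sgn k"
      using that M by (cases "k \<ge> 0") (auto simp: of_nat_diff sgn_if)
    then have "complex_of_int (int (nat (5 * M) - nat \<bar>k - M\<bar>) - int (nat (5 * M) - nat \<bar>k - - M\<bar>)) = of_int (2 * M * sgn k)"
      by (rule arg_cong)
    then have "of_nat (nat (5 * M) - nat \<bar>k - M\<bar>) - of_nat (nat (5 * M) - nat \<bar>k - - M\<bar>) = (2 * of_int M * of_int (sgn k) :: complex)"
      by simp
    then show ?thesis using M by (simp add: W_def)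
  qed
  have P: "multiplier_bound p X ?S (\<lambda>k. 1 / 2 * (1 + z * W k)) 3" if "cmod z = 1" for z
  proof -
    have "multiplier_bound p X ?S (\<lambda>k. 1 / 2 * (1 + z * W k)) (cmod (1 / 2) * (cmod 1 + cmod z * 5))"
      by (intro multiplier_bound_cmult multiplier_bound_add multiplier_bound_const W)
    then show ?thesis using that by simp
  qed
  have "multiplier_bound p X ?S (\<lambda>k. 1 / \<i> * (E M k * (1 / 2 * (1 + 1 * W k)) + (-1) * (E (- M) k * (1 / 2 * (1 + (-1) * W k)))))
     (cmod (1 / \<i>) * (1 / of_int M * 3 + cmod (-1) * (1 / of_int M * 3)))"
    by (intro multiplier_bound_cmult multiplier_bound_add multiplier_bound_mult E P) (use M in auto)
  then have "multiplier_bound p X ?S (\<lambda>k. 1 / \<i> * (E M k * (1 / 2 * (1 + 1 * W k)) + (-1) * (E (- M) k * (1 / 2 * (1 + (-1) * W k)))))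
     (6 / of_int M)" by (simp add: norm_divide)
  then show ?thesis
  proof (rule multiplier_bound_cong)
    fix k assume k: "k \<in> ?S"
    have rot: "1 / \<i> * (1 / z) = 1 / (\<i> * z)" for z :: complex
      by (simp only: times_divide_times_eq mult_1)
    show "1 / \<i> * (E M k * (1 / 2 * (1 + 1 * W k)) + (-1) * (E (- M) k * (1 / 2 * (1 + (-1) * W k)))) = 1 / (\<i> * of_int k)"
    proof (cases "k \<ge> 0")
      case True
      then have "of_int M + real (nat \<bar>k - M\<bar>) = of_int k" "sgn k = 1" using k M by auto
      then have "E M k = 1 / of_int k" "W k = 1" using W_sgn[OF k] by (auto simp: E_def g_def)
      then show ?thesis using rot[of "of_int k"] by simp
    next
      case False
      then have "of_int M + real (nat \<bar>k - - M\<bar>) = - of_int k" "sgn k = -1" using k M by auto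
      then have "E (- M) k = 1 / (- of_int k)" "W k = - 1" using W_sgn[OF k] by (auto simp: E_def g_def)
      then show ?thesis using rot[of "of_int k"] by simp
    qed
  qed
qed

text \<open>
  Bernstein's inequality reversed: on frequencies of size \<open>M\<close> each derivative costs at least a factor
  proportional to \<open>M\<close>.
\<close>

lemma torus_norm_antiderivative:
  fixes c :: "int \<Rightarrow> 'a" and M :: int
  assumes M: "1 \<le> M" and F: "finite F" "\<And>k. k \<in> F \<Longrightarrow> M \<le> \<bar>k\<bar> \<and> \<bar>k\<bar> \<le> 4 * M"
  shows "torus_norm p (trig_poly F (\<lambda>k. (\<i> * of_int k) ^ l *\<^sub>C c k))
    \<le> (6 / of_int M) ^ m * torus_norm p (trig_poly F (\<lambda>k. (\<i> * of_int k) ^ (l + m) *\<^sub>C c k))"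
proof -
  have "multiplier_bound p X {k. M \<le> \<bar>k\<bar> \<and> \<bar>k\<bar> \<le> 4 * M} (\<lambda>k. (1 / (\<i> * of_int k)) ^ m) ((6 / of_int M) ^ m)"
    by (rule multiplier_bound_power[OF multiplier_bound_inverse_frequency[OF M]])
  then have "torus_norm p (trig_poly F (\<lambda>k. (1 / (\<i> * of_int k)) ^ m *\<^sub>C ((\<i> * of_int k) ^ (l + m) *\<^sub>C c k)))
    \<le> (6 / of_int M) ^ m * torus_norm p (trig_poly F (\<lambda>k. (\<i> * of_int k) ^ (l + m) *\<^sub>C c k))"
    by (rule multiplier_boundD) (use F in auto)
  moreover have "trig_poly F (\<lambda>k. (1 / (\<i> * of_int k)) ^ m *\<^sub>C ((\<i> * of_int k) ^ (l + m) *\<^sub>C c k))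
    = trig_poly F (\<lambda>k. (\<i> * of_int k) ^ l *\<^sub>C c k)"
  proof (rule ext, rule trig_poly_cong)
    fix k assume "k \<in> F"
    then have "k \<noteq> 0" using F(2)[of k] M by auto
    then have "(1 / (\<i> * of_int k)) ^ m * (\<i> * of_int k) ^ (l + m) = (\<i> * of_int k) ^ l"
      by (simp add: power_add power_divide)
    then show "(1 / (\<i> * of_int k)) ^ m *\<^sub>C ((\<i> * of_int k) ^ (l + m) *\<^sub>C c k) = (\<i> * of_int k) ^ l *\<^sub>C c k"
      by (simp only: scaleC_scaleC)
  qed
  ultimately show ?thesis by simp
qed

end

section \<open>Strong measurability and periodic null sets\<close>

lemma borel_measurable_lebesgue_on_AE:
  fixes f g :: "real \<Rightarrow> real"
  assumes "f \<in> borel_measurable (lebesgue_on S)" "AE x in lebesgue_on S. f x = g x" "S \<in> sets lebesgue"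
  shows "g \<in> borel_measurable (lebesgue_on S)"
proof -
  let ?f = "\<lambda>x. if x \<in> S then f x else 0" and ?g = "\<lambda>x. if x \<in> S then g x else 0"
  have "?f \<in> borel_measurable lebesgue"
    using assms(1,3) by (simp add: borel_measurable_if)
  moreover have "AE x in lebesgue. ?f x = ?g x"
    using assms(2,3) by (simp add: AE_restrict_space_iff)
  ultimately have "?g \<in> borel_measurable lebesgue" by (rule borel_measurable_AE)
  then show ?thesis using assms(3) by (simp add: borel_measurable_if)
qed

text \<open>
  Completeness of Lebesgue measure absorbs the null set on which the simple functions fail to converge.
\<close>

lemma strongly_measurable_norm_diff:
  fixes f :: "real \<Rightarrow> 'b::real_normed_vector"
  assumes f: "strongly_measurable (lebesgue_on S) f" and S: "S \<in> sets lebesgue"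
  shows "(\<lambda>x. norm (f x - c)) \<in> borel_measurable (lebesgue_on S)"
proof -
  obtain s where s: "\<And>i. simple_function (lebesgue_on S) (s i)"
    and lim: "AE x in lebesgue_on S. (\<lambda>i. s i x) \<longlonglongrightarrow> f x"
    using f by (auto simp: strongly_measurable_def)
  have meas: "(\<lambda>x. norm (s i x - c)) \<in> borel_measurable (lebesgue_on S)" for i
    using simple_function_compose1[OF s[of i], of "\<lambda>y. norm (y - c)"] by (rule borel_measurable_simple_function)
  define F where "F x = lim (\<lambda>i. norm (s i x - c))" for x
  have "F \<in> borel_measurable (lebesgue_on S)"
    unfolding F_def using meas by measurable
  moreover have "AE x in lebesgue_on S. F x = norm (f x - c)"
    using lim
  proof eventually_elim
    case (elim x)
    then have "(\<lambda>i. norm (s i x - c)) \<longlonglongrightarrow> norm (f x - c)" by (intro tendsto_intros)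
    then show ?case unfolding F_def by (rule limI)
  qed
  ultimately show ?thesis using S by (rule borel_measurable_lebesgue_on_AE)
qed

lemma strongly_measurable_norm:
  fixes f :: "real \<Rightarrow> 'b::real_normed_vector"
  assumes "strongly_measurable (lebesgue_on S) f" "S \<in> sets lebesgue"
  shows "(\<lambda>x. norm (f x)) \<in> borel_measurable (lebesgue_on S)"
  using strongly_measurable_norm_diff[OF assms, of 0] by simp

lemma strongly_measurable_diff:
  assumes "strongly_measurable M f" "strongly_measurable M g"
  shows "strongly_measurable M (\<lambda>x. f x - g x)"
proof -
  obtain s where s: "\<And>i. simple_function M (s i)" "AE x in M. (\<lambda>i. s i x) \<longlonglongrightarrow> f x"
    using assms(1) by (auto simp: strongly_measurable_def)
  obtain u where u: "\<And>i. simple_function M (u i)" "AE x in M. (\<lambda>i. u i x) \<longlonglongrightarrow> g x"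
    using assms(2) by (auto simp: strongly_measurable_def)
  have "AE x in M. (\<lambda>i. s i x - u i x) \<longlonglongrightarrow> f x - g x"
    using s(2) u(2) by eventually_elim (rule tendsto_diff)
  moreover have "simple_function M (\<lambda>x. s i x - u i x)" for i
    by (rule simple_function_compose2[OF s(1) u(1)])
  ultimately show ?thesis unfolding strongly_measurable_def by (intro exI[of _ "\<lambda>i x. s i x - u i x"]) simp
qed

lemma strongly_measurable_AE_cong:
  assumes "strongly_measurable M f" "AE x in M. f x = g x"
  shows "strongly_measurable M g"
proof -
  obtain s where s: "\<And>i. simple_function M (s i)" "AE x in M. (\<lambda>i. s i x) \<longlonglongrightarrow> f x"
    using assms(1) by (auto simp: strongly_measurable_def)
  have "AE x in M. (\<lambda>i. s i x) \<longlonglongrightarrow> g x" using s(2) assms(2) by eventually_elim simp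
  with s(1) show ?thesis unfolding strongly_measurable_def by blast
qed

lemma continuous_simple_approximation:
  fixes f :: "real \<Rightarrow> 'b::real_normed_vector"
  assumes f: "continuous_on UNIV f" and e: "e > 0"
  shows "\<exists>s. simple_function (lebesgue_on {a..b}) s \<and> (\<forall>t\<in>{a..b}. norm (s t - f t) < e)"
proof -
  \<comment> \<open>Rounding down can leave \<open>{a..b}\<close>, but only by less than 1.\<close>
  have "uniformly_continuous_on {a - 1..b} f"
    using continuous_on_subset[OF f] by (intro compact_uniformly_continuous) auto
  then obtain d where d: "d > 0" "\<And>x y. x \<in> {a - 1..b} \<Longrightarrow> y \<in> {a - 1..b} \<Longrightarrow> dist y x < d \<Longrightarrow> dist (f y) (f x) < e"
    using e unfolding uniformly_continuous_on_def by metis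
  obtain m where m: "1 / d < real m" "1 \<le> m"
    by (metis reals_Archimedean2 le_add2 max.strict_coboundedI2 max.cobounded1 of_nat_max of_nat_less_iff less_le_trans of_nat_le_iff)
  define q where "q t = of_int \<lfloor>real m * t\<rfloor> / real m" for t
  have q: "q t \<le> t" "t < q t + 1 / real m" for t
    unfolding q_def using m(2) floor_correct[of "real m * t"] by (auto simp: field_simps)
  have md: "1 / real m < d" "1 / real m \<le> 1" using m d(1) by (auto simp: field_simps)
  have "q ` {a..b} \<subseteq> (\<lambda>i. of_int i / real m) ` {\<lfloor>real m * a\<rfloor>..\<lfloor>real m * b\<rfloor>}"
    by (auto simp: q_def intro!: imageI floor_mono mult_left_mono)
  then have "finite (q ` {a..b})" by (rule finite_subset) simp
  then have fin: "finite (q ` space (lebesgue_on {a..b}))" by (simp add: space_restrict_space)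
  have "q \<in> borel_measurable borel" unfolding q_def by measurable
  then have "q \<in> borel_measurable (lebesgue_on {a..b})"
    by (intro measurable_restrict_space1 measurable_completion) simp
  then have "simple_function (lebesgue_on {a..b}) q" using fin by (rule simple_function_borel_measurable)
  then have "simple_function (lebesgue_on {a..b}) (\<lambda>t. f (q t))" by (rule simple_function_compose1)
  moreover have "norm (f (q t) - f t) < e" if "t \<in> {a..b}" for t
    using d(2)[of t "q t"] q[of t] md that by (auto simp: dist_norm)
  ultimately show ?thesis by blast
qed

text \<open>
  Simple functions within \<open>1 / Suc j\<close> of the \<open>P j\<close> have the same limit.
\<close>

lemma strongly_measurable_limit:
  fixes P :: "nat \<Rightarrow> real \<Rightarrow> 'b::real_normed_vector"
  assumes P: "\<And>j. continuous_on UNIV (P j)" and lim: "AE t in lebesgue_on {a..b}. (\<lambda>j. P j t) \<longlonglongrightarrow> Y t"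
  shows "strongly_measurable (lebesgue_on {a..b}) Y"
proof -
  have "\<exists>s. simple_function (lebesgue_on {a..b}) s \<and> (\<forall>t\<in>{a..b}. norm (s t - P j t) < 1 / real (Suc j))" for j
    by (rule continuous_simple_approximation[OF P]) simp
  then obtain s where s: "\<And>j. simple_function (lebesgue_on {a..b}) (s j)"
    "\<And>j t. t \<in> {a..b} \<Longrightarrow> norm (s j t - P j t) < 1 / real (Suc j)"
    by metis
  have "AE t in lebesgue_on {a..b}. t \<in> {a..b}" by (rule AE_I2) (simp add: space_restrict_space)
  with lim have "AE t in lebesgue_on {a..b}. (\<lambda>j. s j t) \<longlonglongrightarrow> Y t"
  proof eventually_elim
    case (elim t)
    have "(\<lambda>j. s j t - P j t) \<longlonglongrightarrow> 0"
    proof (rule Lim_null_comparison)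
      show "eventually (\<lambda>j. norm (s j t - P j t) \<le> 1 / real (Suc j)) sequentially"
        by (rule always_eventually) (intro allI less_imp_le s(2) elim(2))
      show "(\<lambda>j. 1 / real (Suc j)) \<longlonglongrightarrow> 0" using LIMSEQ_inverse_real_of_nat by (simp add: inverse_eq_divide)
    qed
    from tendsto_add[OF this elim(1)] show ?case by simp
  qed
  with s(1) show ?thesis unfolding strongly_measurable_def by blast
qed

lemma negligible_periodic:
  fixes Z :: "real set"
  assumes per: "\<And>t. t + 2 * pi \<in> Z \<longleftrightarrow> t \<in> Z" and Z: "negligible (Z \<inter> {0..2 * pi})"
  shows "negligible Z"
proof -
  have "Z = (\<Union>m::int. (+) (2 * pi * of_int m) ` (Z \<inter> {0..2 * pi}))"
  proof (intro equalityI subsetI)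
    fix t assume t: "t \<in> Z"
    define m where "m = \<lfloor>t / (2 * pi)\<rfloor>"
    have "2 * pi * of_int m \<le> t" "t \<le> 2 * pi * of_int m + 2 * pi"
      unfolding m_def using floor_divide_lower[of "2 * pi" t] floor_divide_upper[of "2 * pi" t]
      by (auto simp: algebra_simps)
    moreover have "t + 2 * pi * of_int (- m) \<in> Z"
      using periodic_int[of "\<lambda>t. t \<in> Z", OF per, of t "- m"] t by simp
    ultimately have "t - 2 * pi * of_int m \<in> Z \<inter> {0..2 * pi}" by simp
    then have "2 * pi * of_int m + (t - 2 * pi * of_int m) \<in> (+) (2 * pi * of_int m) ` (Z \<inter> {0..2 * pi})" 
      by (rule imageI)
    then have "t \<in> (+) (2 * pi * of_int m) ` (Z \<inter> {0..2 * pi})" by simp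
    then show "t \<in> (\<Union>m::int. (+) (2 * pi * of_int m) ` (Z \<inter> {0..2 * pi}))" by blast
  next
    fix t assume "t \<in> (\<Union>m::int. (+) (2 * pi * of_int m) ` (Z \<inter> {0..2 * pi}))"
    then obtain m :: int and x where x: "x \<in> Z" "t = x + 2 * pi * of_int m" by (auto simp: add.commute)
    then show "t \<in> Z" using periodic_int[of "\<lambda>t. t \<in> Z", OF per, of x m] by simp
  qed
  moreover have "negligible (\<Union>m::int. (+) (2 * pi * of_int m) ` (Z \<inter> {0..2 * pi}))"
    by (intro negligible_countable_Union negligible_translation) (auto intro: Z negligible_translation)
  ultimately show ?thesis by simp
qed

lemma AE_lebesgue_on_iff_negligible:
  fixes S :: "real set"
  assumes "S \<in> sets lebesgue"
  shows "(AE t in lebesgue_on S. Q t) \<longleftrightarrow> negligible {t \<in> S. \<not> Q t}"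
  using assms
  by (subst AE_restrict_space_iff) (simp_all add: completion.AE_iff_null_sets negligible_iff_null_sets)

lemma AE_lebesgue_on_shift:
  assumes "negligible Z" "S \<in> sets lebesgue" "\<And>t. t \<notin> Z \<Longrightarrow> Q t"
  shows "AE \<theta> in lebesgue_on S. Q (t + \<theta> :: real)"
proof -
  have "{\<theta> \<in> S. \<not> Q (t + \<theta>)} \<subseteq> (+) (- t) ` Z"
  proof
    fix \<theta> assume "\<theta> \<in> {\<theta> \<in> S. \<not> Q (t + \<theta>)}"
    then have "t + \<theta> \<in> Z" using assms(3) by blast
    then have "- t + (t + \<theta>) \<in> (+) (- t) ` Z" by (rule imageI)
    then show "\<theta> \<in> (+) (- t) ` Z" by simp
  qed
  from negligible_subset[OF negligible_translation[OF assms(1)] this]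
  show ?thesis unfolding AE_lebesgue_on_iff_negligible[OF assms(2)] .
qed

lemma integrable_powr_1:
  assumes "finite_measure M" "1 \<le> p" "integrable M (\<lambda>x. \<bar>h x :: real\<bar> powr p)" "h \<in> borel_measurable M"
  shows "integrable M h"
proof -
  interpret finite_measure M by fact
  show ?thesis
  proof (rule Bochner_Integration.integrable_bound[OF _ assms(4)])
    show "integrable M (\<lambda>x. 1 + \<bar>h x\<bar> powr p)" using assms(3) by simp
    show "AE x in M. norm (h x) \<le> norm (1 + \<bar>h x\<bar> powr p)"
    proof (rule AE_I2)
      fix x
      have "\<bar>h x\<bar> \<le> 1 + \<bar>h x\<bar> powr p"
      proof (cases "\<bar>h x\<bar> \<le> 1")
        case True
        then show ?thesis using powr_ge_zero[of "\<bar>h x\<bar>" p] by linarith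
      next
        case False
        then have "\<bar>h x\<bar> powr 1 \<le> \<bar>h x\<bar> powr p" using assms(2) by (intro powr_mono) auto
        then show ?thesis using False by simp
      qed
      then show "norm (h x) \<le> norm (1 + \<bar>h x\<bar> powr p)" by simp
    qed
  qed
qed

lemma finite_measure_lebesgue_on_Icc: "finite_measure (lebesgue_on {a..b::real})"
  using emeasure_lborel_cbox_finite[of a b]
  by (intro finite_measureI) (simp add: space_restrict_space emeasure_restrict_space)

lemma lebesgue_integral_history:
  fixes G :: "real \<Rightarrow> real"
  assumes G: "\<And>t. 0 \<le> G t" "\<And>t. G (t + 2 * pi) = G t" "integrable torus G"
  shows "integrable (lebesgue_on {- (2 * pi * real N)..0}) (\<lambda>\<theta>. G (t + \<theta>))"
    and "(LINT \<theta>|lebesgue_on {- (2 * pi * real N)..0}. G (t + \<theta>)) = real N * (LINT t|torus. G t)"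
proof -
  let ?I = "LINT t|torus. G t"
  have "(G has_integral ?I) {0..2 * pi}"
    by (rule has_integral_integral_lebesgue_on[OF G(3)]) simp
  then have "(G has_integral real N *\<^sub>R ?I) {t - 2 * pi * real N..t - 2 * pi * real N + 2 * pi * real N}"
    by (rule has_integral_periodic_multiple[where G = G, OF G(2)])
  then have "((\<lambda>\<theta>. G (\<theta> + t)) has_integral real N *\<^sub>R ?I) {- (2 * pi * real N)..0}"
    using has_integral_shift_real_ivl[of G _ "t - 2 * pi * real N" t t] by simp
  then have "((\<lambda>\<theta>. G (t + \<theta>)) has_integral real N *\<^sub>R ?I) {- (2 * pi * real N)..0}"
    by (simp only: add.commute)
  then have "integrable (lebesgue_on {- (2 * pi * real N)..0}) (\<lambda>\<theta>. G (t + \<theta>)) \<and>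
    real N *\<^sub>R ?I = (LINT \<theta>|lebesgue_on {- (2 * pi * real N)..0}. G (t + \<theta>))"
    by (subst (asm) has_integral_nonneg_iff) (simp_all add: G(1))
  then show "integrable (lebesgue_on {- (2 * pi * real N)..0}) (\<lambda>\<theta>. G (t + \<theta>))"
    and "(LINT \<theta>|lebesgue_on {- (2 * pi * real N)..0}. G (t + \<theta>)) = real N * ?I" by simp_all
qed

section \<open>Absolutely convergent series of periodic functions\<close>

text \<open>
  Such a series converges in \<open>L\<^sup>p\<close> and almost everywhere, and integrals and bounded operators may be applied
  term by term. The dyadic blocks of a distribution of positive smoothness are the main instance.
\<close>

locale periodic_Lp_series =
  fixes p :: real and P :: "nat \<Rightarrow> real \<Rightarrow> 'a::complex_banach"
  assumes p: "1 \<le> p"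
    and cont: "\<And>j. continuous_on UNIV (P j)"
    and per: "\<And>j t. P j (t + 2 * pi) = P j t"
    and summable_norms: "summable (\<lambda>j. torus_norm p (P j))"
begin

definition exceptional :: "real set" where
  "exceptional = {t. \<not> summable (\<lambda>j. norm (P j t))}"

text \<open>
  The sum is set to 0 on the exceptional null set, so that it is periodic everywhere.
\<close>

definition total :: "real \<Rightarrow> 'a" where
  "total t = (if t \<in> exceptional then 0 else (\<Sum>j. P j t))"

text \<open>
  The pointwise error bound for the partial sums; it takes the place of an integrable majorant.
\<close>

definition tail :: "nat \<Rightarrow> real \<Rightarrow> real" where
  "tail J t = (if t \<in> exceptional then 0 else (\<Sum>j. norm (P (j + J) t)))"

definition tail_norm :: "nat \<Rightarrow> real" where
  "tail_norm J = (\<Sum>j. torus_norm p (P (j + J)))"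

lemma cont': "continuous_on T (P j)"
  by (rule continuous_on_subset[OF cont]) simp

lemma exceptional_periodic: "t + 2 * pi \<in> exceptional \<longleftrightarrow> t \<in> exceptional"
  by (simp add: exceptional_def per)

lemma total_periodic: "total (t + 2 * pi) = total t"
  by (simp add: total_def exceptional_periodic per)

lemma tail_periodic: "tail J (t + 2 * pi) = tail J t"
  by (simp add: tail_def exceptional_periodic per)

lemma Levi:
  "AE t in torus. summable (\<lambda>j. norm (P (j + J) t))"
  "integrable torus (\<lambda>t. \<bar>\<Sum>j. norm (P (j + J) t)\<bar> powr p)"
  "torus_norm p (\<lambda>t. \<Sum>j. norm (P (j + J) t)) \<le> tail_norm J"
  unfolding tail_norm_def
  using p summable_norms
  by (auto intro!: Lp_norm_suminf continuous_measurable_on_Icc cont' continuous_integrable_powr_Icc 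
      simp: summable_iff_shift[of "\<lambda>j. torus_norm p (P j)"])

lemma negligible_exceptional: "negligible exceptional"
proof (rule negligible_periodic[OF exceptional_periodic])
  have "negligible {t \<in> {0..2 * pi}. \<not> summable (\<lambda>j. norm (P (j + 0) t))}"
    using Levi(1)[of 0] by (subst (asm) AE_lebesgue_on_iff_negligible) auto
  then show "negligible (exceptional \<inter> {0..2 * pi})"
    by (rule negligible_subset) (auto simp: exceptional_def)
qed

lemma sums_total: "t \<notin> exceptional \<Longrightarrow> (\<lambda>j. P j t) sums total t"
  unfolding total_def exceptional_def by (auto intro: summable_sums summable_norm_cancel)

lemma tail_nonneg: "0 \<le> tail J t"
  unfolding tail_def exceptional_def
  by (auto intro!: suminf_nonneg simp: summable_iff_shift[of "\<lambda>j. norm (P j t)"])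

lemma tail_tendsto_0: "(\<lambda>J. tail J t) \<longlonglongrightarrow> 0"
proof (cases "t \<in> exceptional")
  case False
  then show ?thesis
    using suminf_exist_split2[of "\<lambda>j. norm (P j t)"] by (simp add: tail_def exceptional_def)
qed (simp add: tail_def)

lemma tail_antimono: "tail J t \<le> tail 0 t"
proof (cases "t \<in> exceptional")
  case False
  then have s: "summable (\<lambda>j. norm (P j t))" by (simp add: exceptional_def)
  have "(\<Sum>j. norm (P j t)) = (\<Sum>j. norm (P (j + J) t)) + (\<Sum>j<J. norm (P j t))"
    by (rule suminf_split_initial_segment[OF s])
  then show ?thesis using False by (simp add: tail_def sum_nonneg)
qed (simp add: tail_def)

lemma norm_total_minus_partial: 
  assumes "t \<notin> exceptional"
  shows "norm (total t - (\<Sum>j<J. P j t)) \<le> tail J t"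
proof -
  have s: "summable (\<lambda>j. norm (P j t))" using assms by (simp add: exceptional_def)
  have "(\<Sum>j. P j t) = (\<Sum>j. P (j + J) t) + (\<Sum>j<J. P j t)"
    by (rule suminf_split_initial_segment[OF summable_norm_cancel[OF s]])
  moreover have "norm (\<Sum>j. P (j + J) t) \<le> (\<Sum>j. norm (P (j + J) t))"
    by (rule summable_norm) (use s in \<open>simp add: summable_iff_shift[of "\<lambda>j. norm (P j t)"]\<close>)
  ultimately show ?thesis using assms by (simp add: total_def tail_def)
qed

lemma AE_tail: "AE t in torus. (\<Sum>j. norm (P (j + J) t)) = tail J t"
  using AE_lebesgue_on_shift[OF negligible_exceptional, of "{0..2 * pi}" "\<lambda>t. (\<Sum>j. norm (P (j + J) t)) = tail J t" 0]
  by (simp add: tail_def)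

lemma tail_measurable: "tail J \<in> borel_measurable torus"
proof (rule borel_measurable_lebesgue_on_AE[OF _ AE_tail])
  show "(\<lambda>t. \<Sum>j. norm (P (j + J) t)) \<in> borel_measurable torus"
    by (intro borel_measurable_suminf continuous_measurable_on_Icc cont')
qed simp

lemma tail_integrable_powr: "integrable torus (\<lambda>t. tail J t powr p)"
proof -
  have "(\<lambda>t. tail J t powr p) \<in> borel_measurable torus" using tail_measurable by measurable
  moreover have "AE t in torus. \<bar>\<Sum>j. norm (P (j + J) t)\<bar> powr p = tail J t powr p"
    using AE_tail[of J] by eventually_elim (simp add: abs_of_nonneg tail_nonneg)
  ultimately show ?thesis
    by (rule integrable_cong_AE_imp[OF Levi(2)])
qed

lemma tail_integral_powr: "(LINT t|torus. tail J t powr p) \<le> tail_norm J powr p"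
proof -
  have tn: "0 \<le> tail_norm J" using Levi(3)[of J] Lp_norm_nonneg order_trans by blast
  have "(LINT t|torus. tail J t powr p) = (LINT t|torus. norm (\<Sum>j. norm (P (j + J) t)) powr p)"
  proof (rule integral_cong_AE)
    show "(\<lambda>t. tail J t powr p) \<in> borel_measurable torus" using tail_measurable by measurable
    show "(\<lambda>t. norm (\<Sum>j. norm (P (j + J) t)) powr p) \<in> borel_measurable torus"
      using Levi(2)[of J] by (simp add: borel_measurable_integrable)
    show "AE t in torus. tail J t powr p = norm (\<Sum>j. norm (P (j + J) t)) powr p"
      using AE_tail[of J] by eventually_elim (simp add: abs_of_nonneg tail_nonneg)
  qed
  also have "\<dots> \<le> tail_norm J powr p"
    using Levi(3)[of J] p tn by (subst (asm) Lp_norm_le_iff) auto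
  finally show ?thesis .
qed

lemma tail_norm_nonneg: "0 \<le> tail_norm J"
  using Levi(3)[of J] Lp_norm_nonneg order_trans by blast

lemma tail_norm_tendsto_0: "tail_norm \<longlonglongrightarrow> 0"
  unfolding tail_norm_def by (rule suminf_exist_split2[OF summable_norms])

lemma tail_integrable: "integrable torus (tail J)"
  by (rule integrable_powr_1[OF finite_measure_lebesgue_on_Icc p])
    (use tail_integrable_powr tail_measurable tail_nonneg in \<open>simp_all add: abs_of_nonneg\<close>)

lemma tail_integral_tendsto_0: "(\<lambda>J. LINT t|torus. tail J t) \<longlonglongrightarrow> 0"
proof -
  have "(\<lambda>J. LINT t|torus. tail J t) \<longlonglongrightarrow> (LINT t|torus. 0)"
  proof (rule integral_dominated_convergence[where w = "tail 0"])
    show "AE t in torus. norm (tail J t) \<le> tail 0 t" for J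
      by (rule AE_I2) (simp add: tail_nonneg tail_antimono)
    show "AE t in torus. (\<lambda>J. tail J t) \<longlonglongrightarrow> 0" by (rule AE_I2) (rule tail_tendsto_0)
  qed (simp_all add: tail_measurable tail_integrable)
  then show ?thesis by simp
qed

lemma history_strongly_measurable: "strongly_measurable (lebesgue_on {a..b}) (\<lambda>\<theta>. total (t + \<theta>))"
proof (rule strongly_measurable_limit)
  show "continuous_on UNIV (\<lambda>\<theta>. \<Sum>j<J. P j (t + \<theta>))" for J
    by (intro continuous_on_sum continuous_on_compose2[OF cont] continuous_intros) auto
  show "AE \<theta> in lebesgue_on {a..b}. (\<lambda>J. \<Sum>j<J. P j (t + \<theta>)) \<longlonglongrightarrow> total (t + \<theta>)"
    by (rule AE_lebesgue_on_shift[OF negligible_exceptional]) (use sums_total in \<open>auto simp: sums_def\<close>)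
qed

lemma history_tail:
  "integrable (lebesgue_on {- (2 * pi * real N)..0}) (\<lambda>\<theta>. tail J (t + \<theta>) powr p)"
  "(LINT \<theta>|lebesgue_on {- (2 * pi * real N)..0}. tail J (t + \<theta>) powr p) \<le> real N * tail_norm J powr p"
proof -
  note * = lebesgue_integral_history[of "\<lambda>t. tail J t powr p" N t, OF _ _ tail_integrable_powr]
  show "integrable (lebesgue_on {- (2 * pi * real N)..0}) (\<lambda>\<theta>. tail J (t + \<theta>) powr p)"
    by (rule *(1)) (simp_all add: tail_periodic)
  have "(LINT \<theta>|lebesgue_on {- (2 * pi * real N)..0}. tail J (t + \<theta>) powr p) = real N * (LINT t|torus. tail J t powr p)"
    by (rule *(2)) (simp_all add: tail_periodic)
  then show "(LINT \<theta>|lebesgue_on {- (2 * pi * real N)..0}. tail J (t + \<theta>) powr p) \<le> real N * tail_norm J powr p"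
    by (simp add: mult_left_mono tail_integral_powr)
qed

lemma history_mem_Lp: "mem_Lp p (lebesgue_on {- (2 * pi * real N)..0}) (\<lambda>\<theta>. total (t + \<theta>))"
  unfolding mem_Lp_def
proof (rule conjI[OF history_strongly_measurable Bochner_Integration.integrable_bound[OF history_tail(1)[of N 0 t]]])
  show "(\<lambda>\<theta>. norm (total (t + \<theta>)) powr p) \<in> borel_measurable (lebesgue_on {- (2 * pi * real N)..0})"
    using strongly_measurable_norm[OF history_strongly_measurable, of "- (2 * pi * real N)" 0 t] by simp
  have "AE \<theta> in lebesgue_on {- (2 * pi * real N)..0}. norm (total (t + \<theta>)) \<le> tail 0 (t + \<theta>)"
    by (rule AE_lebesgue_on_shift[OF negligible_exceptional]) (use norm_total_minus_partial[of _ 0] in auto)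
  then show "AE \<theta> in lebesgue_on {- (2 * pi * real N)..0}. norm (norm (total (t + \<theta>)) powr p) \<le> norm (tail 0 (t + \<theta>) powr p)"
    by eventually_elim (use p in \<open>simp add: powr_mono2\<close>)
qed

lemma total_mem_L1: "mem_Lp 1 torus total"
  unfolding mem_Lp_def
proof
  show sm: "strongly_measurable torus total"
    using history_strongly_measurable[of 0 "2 * pi" 0] by simp
  have m: "(\<lambda>t. norm (total t)) \<in> borel_measurable torus"
    by (rule strongly_measurable_norm[OF sm]) simp
  have "AE t in torus. norm (total (0 + t)) \<le> tail 0 (0 + t)"
    by (rule AE_lebesgue_on_shift[OF negligible_exceptional]) (use norm_total_minus_partial[of _ 0] in auto)
  then have "AE t in torus. norm (norm (total t)) \<le> norm (tail 0 t)"
    by eventually_elim (simp add: tail_nonneg)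
  from Bochner_Integration.integrable_bound[OF tail_integrable m this]
  show "integrable torus (\<lambda>t. norm (total t) powr 1)" by simp
qed

lemma has_integral_total:
  fixes \<psi> :: "real \<Rightarrow> complex"
  assumes "continuous_on {0..2 * pi} \<psi>"
  shows "\<exists>I. ((\<lambda>t. \<psi> t *\<^sub>C total t) has_integral I) {0..2 * pi} \<and>
    (\<lambda>j. integral {0..2 * pi} (\<lambda>t. \<psi> t *\<^sub>C P j t)) sums I"
proof -
  obtain B where B: "\<And>t. t \<in> {0..2 * pi} \<Longrightarrow> cmod (\<psi> t) \<le> B" "0 \<le> B"
  proof -
    have "bounded (\<psi> ` {0..2 * pi})" using assms by (intro compact_imp_bounded compact_continuous_image) auto
    then obtain B where "\<forall>x\<in>\<psi> ` {0..2 * pi}. cmod x \<le> B" unfolding bounded_iff by blast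
    then have "cmod (\<psi> t) \<le> B" if "t \<in> {0..2 * pi}" for t using that by blast
    moreover from this[of 0] have "0 \<le> B" by (auto intro: order_trans[OF norm_ge_zero])
    ultimately show thesis by (rule that)
  qed
  define g where "g J t = (if t \<in> exceptional then 0 else \<psi> t *\<^sub>C (\<Sum>j<J. P j t))" for J t
  define f where "f t = (if t \<in> exceptional then 0 else \<psi> t *\<^sub>C total t)" for t
  have int: "((\<lambda>t. \<psi> t *\<^sub>C P j t) has_integral integral {0..2 * pi} (\<lambda>t. \<psi> t *\<^sub>C P j t)) {0..2 * pi}" for j
    by (intro integrable_integral integrable_continuous_real scaleC.continuous_on assms cont')
  have g: "(g J has_integral (\<Sum>j<J. integral {0..2 * pi} (\<lambda>t. \<psi> t *\<^sub>C P j t))) {0..2 * pi}" for J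
  proof (rule has_integral_spike[OF negligible_exceptional])
    show "((\<lambda>t. \<Sum>j<J. \<psi> t *\<^sub>C P j t) has_integral (\<Sum>j<J. integral {0..2 * pi} (\<lambda>t. \<psi> t *\<^sub>C P j t))) {0..2 * pi}"
      by (intro has_integral_sum int) simp
  qed (simp add: g_def scaleC.sum_right)
  have h: "((\<lambda>t. B * tail J t) has_integral B * (LINT t|torus. tail J t)) {0..2 * pi}" for J
  proof -
    have "(tail J has_integral (LINT t|torus. tail J t)) {0..2 * pi}"
      by (subst has_integral_nonneg_iff) (simp_all add: tail_nonneg tail_integrable)
    then show ?thesis by (rule has_integral_mult_right)
  qed
  have H: "(\<lambda>J. B * (LINT t|torus. tail J t)) \<longlonglongrightarrow> 0"
    using tendsto_mult_left[OF tail_integral_tendsto_0, of B] by simp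
  have le: "norm (f t - g J t) \<le> B * tail J t" if "t \<in> {0..2 * pi}" for J t
  proof (cases "t \<in> exceptional")
    case False
    have "norm (f t - g J t) = cmod (\<psi> t) * norm (total t - (\<Sum>j<J. P j t))"
      using False by (simp add: f_def g_def scaleC.diff_right[symmetric] norm_scaleC)
    also have "\<dots> \<le> B * tail J t"
      using B that norm_total_minus_partial[OF False] by (intro mult_mono) auto
    finally show ?thesis .
  qed (use B tail_nonneg in \<open>simp add: f_def g_def\<close>)
  obtain I where I: "(f has_integral I) {0..2 * pi}" "(\<lambda>J. \<Sum>j<J. integral {0..2 * pi} (\<lambda>t. \<psi> t *\<^sub>C P j t)) \<longlonglongrightarrow> I"
    using has_integral_limit_dominated[OF g h H le] by blast
  have "((\<lambda>t. \<psi> t *\<^sub>C total t) has_integral I) {0..2 * pi}"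
    by (rule has_integral_spike[OF negligible_exceptional _ I(1)]) (simp add: f_def)
  with I(2) show ?thesis by (auto simp: sums_def)
qed

end

section \<open>Test functions and trigonometric approximation\<close>

lemma higher_vderiv_0 [simp]: "higher_vderiv 0 f = f"
  by (simp add: higher_vderiv_def)

lemma higher_vderiv_Suc: "higher_vderiv (Suc m) f t = vector_derivative (higher_vderiv m f) (at t)"
  by (simp add: higher_vderiv_def)

lemma higher_vderiv_add: "higher_vderiv m (higher_vderiv l f) = higher_vderiv (m + l) f"
  by (simp add: higher_vderiv_def funpow_add)

lemma smooth_fun_has_vderiv:
  "smooth_fun f \<Longrightarrow> (higher_vderiv m f has_vector_derivative higher_vderiv (Suc m) f t) (at t)"
  unfolding higher_vderiv_Suc smooth_fun_def by (simp add: vector_derivative_works[symmetric])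

lemma smooth_funI:
  assumes "g 0 = f" "\<And>m t. (g m has_vector_derivative g (Suc m) t) (at t)"
  shows "smooth_fun f" and "higher_vderiv m f = g m"
proof -
  have eq: "higher_vderiv m f = g m" for m
  proof (induction m)
    case (Suc m)
    show ?case
      by (rule ext) (simp add: higher_vderiv_Suc Suc vector_derivative_at[OF assms(2)])
  qed (simp add: assms(1))
  then show "higher_vderiv m f = g m" .
  show "smooth_fun f"
    unfolding smooth_fun_def eq using assms(2) differentiableI_vector by blast
qed

lemma smooth_fun_plus:
  assumes "smooth_fun f" "smooth_fun g"
  shows "smooth_fun (\<lambda>t. f t + g t)"
    and "higher_vderiv m (\<lambda>t. f t + g t) = (\<lambda>t. higher_vderiv m f t + higher_vderiv m g t)"
  by (rule smooth_funI[where g = "\<lambda>m t. higher_vderiv m f t + higher_vderiv m g t"];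
      auto intro!: has_vector_derivative_add smooth_fun_has_vderiv assms)+

lemma smooth_fun_cmult:
  assumes "smooth_fun f"
  shows "smooth_fun (\<lambda>t. c * f t)" and "higher_vderiv m (\<lambda>t. c * f t) = (\<lambda>t. c * higher_vderiv m f t)"
  by (rule smooth_funI[where g = "\<lambda>m t. c * higher_vderiv m f t"];
      auto intro!: has_vector_derivative_mult_right smooth_fun_has_vderiv assms)+

lemma smooth_fun_diff:
  assumes "smooth_fun f" "smooth_fun g"
  shows "smooth_fun (\<lambda>t. f t - g t)"
    and "higher_vderiv m (\<lambda>t. f t - g t) = (\<lambda>t. higher_vderiv m f t - higher_vderiv m g t)"
  by (rule smooth_funI[where g = "\<lambda>m t. higher_vderiv m f t - higher_vderiv m g t"];
      auto intro!: has_vector_derivative_diff smooth_fun_has_vderiv assms)+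

lemma has_vector_derivative_cis:
  "((\<lambda>t. cis (a * t)) has_vector_derivative (\<i> * of_real a) * cis (a * t)) (at t)"
proof -
  have "((\<lambda>t. exp (t *\<^sub>R (\<i> * of_real a))) has_vector_derivative exp (t *\<^sub>R (\<i> * of_real a)) * (\<i> * of_real a)) (at t)"
    by (rule exp_scaleR_has_vector_derivative_right)
  moreover have "exp (t *\<^sub>R (\<i> * of_real a)) = cis (a * t)" for t
    by (simp add: cis_conv_exp scaleR_conv_of_real mult_ac)
  ultimately show ?thesis by (simp only: mult.commute)
qed

lemma smooth_fun_cis:
  shows "smooth_fun (\<lambda>t. cis (of_int k * t))"
    and "higher_vderiv m (\<lambda>t. cis (of_int k * t)) = (\<lambda>t. (\<i> * of_int k) ^ m * cis (of_int k * t))"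
proof -
  have *: "((\<lambda>t. (\<i> * of_int k) ^ m * cis (of_int k * t)) has_vector_derivative
    (\<i> * of_int k) ^ Suc m * cis (of_int k * t)) (at t)" for m t
    using has_vector_derivative_mult_right[OF has_vector_derivative_cis[of "of_int k" t], of "(\<i> * of_int k) ^ m"]
    by (simp add: mult_ac)
  show "smooth_fun (\<lambda>t. cis (of_int k * t))"
    and "higher_vderiv m (\<lambda>t. cis (of_int k * t)) = (\<lambda>t. (\<i> * of_int k) ^ m * cis (of_int k * t))"
    using smooth_funI[where g = "\<lambda>m t. (\<i> * of_int k) ^ m * cis (of_int k * t)", OF _ *] by simp_all
qed

lemma test_functionsD:
  assumes "\<psi> \<in> test_functions"
  shows "smooth_fun \<psi>" "\<psi> (t + 2 * pi) = \<psi> t"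
  using assms by (auto simp: test_functions_def)

lemma test_functions_plus: "\<psi> \<in> test_functions \<Longrightarrow> \<eta> \<in> test_functions \<Longrightarrow> (\<lambda>t. \<psi> t + \<eta> t) \<in> test_functions"
  by (auto simp: test_functions_def smooth_fun_plus)

lemma test_functions_cmult: "\<psi> \<in> test_functions \<Longrightarrow> (\<lambda>t. c * \<psi> t) \<in> test_functions"
  by (auto simp: test_functions_def smooth_fun_cmult)

lemma test_functions_diff: "\<psi> \<in> test_functions \<Longrightarrow> \<eta> \<in> test_functions \<Longrightarrow> (\<lambda>t. \<psi> t - \<eta> t) \<in> test_functions"
  by (auto simp: test_functions_def smooth_fun_diff)

lemma test_functions_cis: "(\<lambda>t. cis (of_int k * t)) \<in> test_functions"
  by (auto simp: test_functions_def smooth_fun_cis(1))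

lemma higher_vderiv_periodic:
  assumes "\<psi> \<in> test_functions"
  shows "higher_vderiv m \<psi> (t + 2 * pi) = higher_vderiv m \<psi> t"
proof (induction m arbitrary: t)
  case 0
  then show ?case using test_functionsD(2)[OF assms] by simp
next
  case (Suc m)
  have "((higher_vderiv m \<psi> \<circ> (\<lambda>t. t + 2 * pi)) has_vector_derivative 1 *\<^sub>R higher_vderiv (Suc m) \<psi> (t + 2 * pi)) (at t)"
    by (rule vector_diff_chain_at)
      (auto intro!: derivative_eq_intros smooth_fun_has_vderiv test_functionsD(1)[OF assms])
  moreover have "higher_vderiv m \<psi> \<circ> (\<lambda>t. t + 2 * pi) = higher_vderiv m \<psi>" using Suc by auto
  ultimately have "(higher_vderiv m \<psi> has_vector_derivative higher_vderiv (Suc m) \<psi> (t + 2 * pi)) (at t)" by simp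
  then show ?case
    by (rule vector_derivative_unique_at[OF _ smooth_fun_has_vderiv[OF test_functionsD(1)[OF assms]]])
qed

lemma test_functions_higher_vderiv: 
  assumes "\<psi> \<in> test_functions"
  shows "higher_vderiv l \<psi> \<in> test_functions"
  using assms higher_vderiv_periodic[OF assms]
  by (simp add: test_functions_def smooth_fun_def higher_vderiv_add)

lemma continuous_on_higher_vderiv:
  assumes "\<psi> \<in> test_functions"
  shows "continuous_on T (higher_vderiv m \<psi>)"
  by (rule continuous_on_subset[of UNIV])
    (auto intro!: has_vector_derivative_continuous smooth_fun_has_vderiv[OF test_functionsD(1)[OF assms]]
      continuous_at_imp_continuous_on)

lemma continuous_on_test: "\<psi> \<in> test_functions \<Longrightarrow> continuous_on T \<psi>"
  using continuous_on_higher_vderiv[of \<psi> T 0] by simp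

lemma periodic_reduce:
  fixes t :: real
  obtains m :: int where "t + 2 * pi * of_int m \<in> {0..2 * pi}"
proof
  show "t + 2 * pi * of_int (- \<lfloor>t / (2 * pi)\<rfloor>) \<in> {0..2 * pi}"
    using floor_divide_lower[of "2 * pi" t] floor_divide_upper[of "2 * pi" t]
    by (auto simp: algebra_simps)
qed

lemma higher_vderiv_bounded:
  assumes "\<psi> \<in> test_functions"
  shows "bdd_above (range (\<lambda>t. cmod (higher_vderiv m \<psi> t)))"
proof -
  have "bounded (higher_vderiv m \<psi> ` {0..2 * pi})"
    by (intro compact_imp_bounded compact_continuous_image continuous_on_higher_vderiv assms) simp
  then obtain B where "\<forall>z\<in>higher_vderiv m \<psi> ` {0..2 * pi}. cmod z \<le> B" unfolding bounded_iff by blast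
  then have B: "cmod (higher_vderiv m \<psi> t) \<le> B" if "t \<in> {0..2 * pi}" for t using that by blast
  have "cmod (higher_vderiv m \<psi> t) \<le> B" for t
  proof -
    obtain i where "t + 2 * pi * of_int i \<in> {0..2 * pi}" by (rule periodic_reduce)
    from B[OF this] show ?thesis
      using periodic_int[of "higher_vderiv m \<psi>", OF higher_vderiv_periodic[OF assms]] by simp
  qed
  then show ?thesis by (intro bdd_aboveI[of _ B]) auto
qed

lemma le_test_seminorm: "\<psi> \<in> test_functions \<Longrightarrow> cmod (higher_vderiv m \<psi> t) \<le> test_seminorm m \<psi>"
  unfolding test_seminorm_def by (intro cSUP_upper higher_vderiv_bounded) auto

lemma test_seminorm_le: "(\<And>t. cmod (higher_vderiv m \<psi> t) \<le> B) \<Longrightarrow> test_seminorm m \<psi> \<le> B"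
  unfolding test_seminorm_def by (intro cSUP_least) auto

text \<open>
  Complex trigonometric polynomials. The inductive form gives the induction along which a distribution, an
  integral or a primitive is computed from its values on \<open>cis (of_int k * t)\<close>.
\<close>

inductive scalar_trig_poly :: "(real \<Rightarrow> complex) \<Rightarrow> bool" where
  monomial: "scalar_trig_poly (\<lambda>t. c * cis (of_int k * t))"
| add: "scalar_trig_poly f \<Longrightarrow> scalar_trig_poly g \<Longrightarrow> scalar_trig_poly (\<lambda>t. f t + g t)"

lemma scalar_trig_poly_const: "scalar_trig_poly (\<lambda>t. c)"
  using scalar_trig_poly.monomial[of c 0] by simp

lemma scalar_trig_poly_cmult: "scalar_trig_poly f \<Longrightarrow> scalar_trig_poly (\<lambda>t. c * f t)"
proof (induction rule: scalar_trig_poly.induct)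
  case (monomial b k)
  show ?case using scalar_trig_poly.monomial[of "c * b" k] by (simp add: mult.assoc)
next
  case (add f g)
  then show ?case using scalar_trig_poly.add[OF add.IH] by (simp add: distrib_left)
qed

lemma scalar_trig_poly_mult: 
  assumes "scalar_trig_poly f" "scalar_trig_poly g"
  shows "scalar_trig_poly (\<lambda>t. f t * g t)"
  using assms(1)
proof (induction rule: scalar_trig_poly.induct)
  case (monomial c k)
  show ?case using assms(2)
  proof (induction rule: scalar_trig_poly.induct)
    case (monomial b l)
    have "(\<lambda>t. c * cis (of_int k * t) * (b * cis (of_int l * t))) = (\<lambda>t. (c * b) * cis (of_int (k + l) * t))"
      by (rule ext) (simp add: distrib_right cis_mult[symmetric])
    then show ?case using scalar_trig_poly.monomial[of "c * b" "k + l"] by simp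
  next
    case (add f g)
    then show ?case using scalar_trig_poly.add[OF add.IH] by (simp add: distrib_left)
  qed
next
  case (add f h)
  then show ?case using scalar_trig_poly.add[OF add.IH] by (simp add: distrib_right)
qed

lemma scalar_trig_poly_test: "scalar_trig_poly f \<Longrightarrow> f \<in> test_functions"
  by (induction rule: scalar_trig_poly.induct)
    (auto intro: test_functions_plus test_functions_cmult test_functions_cis)

text \<open>
  The mean \<open>c\<close> has to be removed, as its primitive is not periodic.
\<close>

lemma scalar_trig_poly_antiderivative:
  assumes "scalar_trig_poly f"
  shows "\<exists>c g. scalar_trig_poly g \<and> (\<forall>t. (g has_vector_derivative f t - c) (at t))"
  using assms
proof (induction rule: scalar_trig_poly.induct)
  case (monomial c k)
  show ?case
  proof (cases "k = 0")
    case True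
    then show ?thesis
      by (intro exI[of _ c] exI[of _ "\<lambda>_. 0"]) (auto intro: scalar_trig_poly_const)
  next
    case False
    have "((\<lambda>t. c / (\<i> * of_int k) * cis (of_int k * t)) has_vector_derivative
      c / (\<i> * of_int k) * ((\<i> * of_real (of_int k)) * cis (of_int k * t))) (at t)" for t
      by (intro has_vector_derivative_mult_right has_vector_derivative_cis)
    then show ?thesis using False scalar_trig_poly.monomial[of "c / (\<i> * of_int k)" k]
      by (intro exI[of _ 0] exI[of _ "\<lambda>t. c / (\<i> * of_int k) * cis (of_int k * t)"])
        auto
  qed
next
  case (add f1 f2)
  then obtain c1 g1 c2 g2 where "scalar_trig_poly g1" "\<And>t. (g1 has_vector_derivative f1 t - c1) (at t)"
    "scalar_trig_poly g2" "\<And>t. (g2 has_vector_derivative f2 t - c2) (at t)" by blast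
  then show ?case
    using has_vector_derivative_add[of g1 "f1 t - c1" "at t" g2 "f2 t - c2" for t]
    by (intro exI[of _ "c1 + c2"] exI[of _ "\<lambda>t. g1 t + g2 t"])
      (auto intro: scalar_trig_poly.add simp: algebra_simps)
qed

text \<open>
  The circle is the quotient of the interval: preimages of closed sets under \<open>F\<close> are images of compact sets
  under \<open>cis\<close>.
\<close>

lemma continuous_on_circle_of_interval:
  fixes h :: "real \<Rightarrow> real"
  assumes h: "continuous_on {0..2 * pi} h" "h (2 * pi) = h 0"
  shows "\<exists>F. continuous_on (sphere (0::complex) 1) F \<and> (\<forall>t\<in>{0..2 * pi}. F (cis t) = h t)"
proof -
  define F where "F z = h (Arg2pi z)" for z
  have F: "F (cis t) = h t" if t: "t \<in> {0..2 * pi}" for t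
  proof (cases "t = 2 * pi")
    case True
    have "Arg2pi 1 = 0" by (simp add: Arg2pi_eq_0)
    then show ?thesis using True h(2) by (simp add: F_def)
  next
    case False
    have "Arg2pi (cis t) = t"
      by (rule Arg2pi_unique[of 1]) (use t False in \<open>auto simp: cis_conv_exp\<close>)
    then show ?thesis by (simp add: F_def)
  qed
  have "closed (sphere 0 1 \<inter> F -` C)" if "closed C" for C
  proof -
    have "sphere 0 1 \<inter> F -` C = cis ` ({0..2 * pi} \<inter> h -` C)"
    proof (intro equalityI subsetI)
      fix z assume z: "z \<in> sphere 0 1 \<inter> F -` C"
      then have "z = cis (Arg2pi z)" using Arg2pi_eq[of z] by (simp add: cis_conv_exp)
      moreover have "Arg2pi z \<in> {0..2 * pi} \<inter> h -` C"
        using z Arg2pi_ge_0[of z] Arg2pi_lt_2pi[of z] by (simp add: F_def)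
      ultimately show "z \<in> cis ` ({0..2 * pi} \<inter> h -` C)" by (rule image_eqI)
    qed (auto simp: F)
    moreover have "compact ({0..2 * pi} \<inter> h -` C)"
    proof -
      have "closed ({0..2 * pi} \<inter> h -` C)" by (rule continuous_closed_preimage[OF h(1) _ that]) simp
      moreover have "bounded ({0..2 * pi} \<inter> h -` C)" by (rule bounded_subset[OF bounded_closed_interval]) auto
      ultimately show ?thesis by (simp add: compact_eq_bounded_closed)
    qed
    then have "compact (cis ` ({0..2 * pi} \<inter> h -` C))"
      by (rule compact_continuous_image[rotated]) (intro continuous_intros)
    ultimately show ?thesis by (metis compact_imp_closed)
  qed
  then have "continuous_on (sphere 0 1) F"
    unfolding continuous_on_closed_invariant
    by (intro allI impI exI[of _ "sphere 0 1 \<inter> F -` B" for B] conjI) auto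
  with F show ?thesis by blast
qed

text \<open>
  Makes the Stone--Weierstrass theorem for polynomials in two real variables applicable on the circle.
\<close>

lemma real_polynomial_on_circle:
  fixes g :: "complex \<Rightarrow> real"
  assumes "real_polynomial_function g"
  shows "scalar_trig_poly (\<lambda>t. of_real (g (cis t)))"
  using assms
proof (induction rule: real_polynomial_function.induct)
  case (linear f)
  then interpret bounded_linear f .
  have "complex_of_real (f (cis t)) = (of_real (f 1) - \<i> * of_real (f \<i>)) / 2 * cis (of_int 1 * t)
     + (of_real (f 1) + \<i> * of_real (f \<i>)) / 2 * cis (of_int (- 1) * t)" for t
  proof -
    have "cis t = cos t *\<^sub>R 1 + sin t *\<^sub>R \<i>" by (simp add: complex_eq_iff)
    then have "f (cis t) = cos t * f 1 + sin t * f \<i>" by (metis add scaleR real_scaleR_def)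
    then show ?thesis by (simp add: complex_eq_iff field_simps)
  qed
  then show ?case by (simp only:) (intro scalar_trig_poly.intros)
next
  case (const c)
  then show ?case by (rule scalar_trig_poly_const)
next
  case (add f g)
  then show ?case using scalar_trig_poly.add by simp
next
  case (mult f g)
  then show ?case using scalar_trig_poly_mult by simp
qed

lemma trig_approximation_real:
  fixes h :: "real \<Rightarrow> real"
  assumes h: "continuous_on {0..2 * pi} h" "h (2 * pi) = h 0" and e: "e > 0"
  shows "\<exists>Q. scalar_trig_poly Q \<and> (\<forall>t\<in>{0..2 * pi}. cmod (Q t - of_real (h t)) < e)"
proof -
  obtain F where F: "continuous_on (sphere (0::complex) 1) F" "\<And>t. t \<in> {0..2 * pi} \<Longrightarrow> F (cis t) = h t"
    using continuous_on_circle_of_interval[OF h] by blast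
  obtain g where g: "real_polynomial_function g" "\<And>z. z \<in> sphere 0 1 \<Longrightarrow> \<bar>F z - g z\<bar> < e"
    using Stone_Weierstrass_real_polynomial_function[OF compact_sphere F(1) e] by blast
  have "cmod (of_real (g (cis t)) - of_real (h t)) < e" if "t \<in> {0..2 * pi}" for t
    using g(2)[of "cis t"] that by (simp add: F(2) abs_minus_commute flip: of_real_diff)
  with real_polynomial_on_circle[OF g(1)] show ?thesis by blast
qed

lemma trig_approximation:
  fixes h :: "real \<Rightarrow> complex"
  assumes h: "continuous_on UNIV h" "\<And>t. h (t + 2 * pi) = h t" and e: "e > 0"
  shows "\<exists>Q. scalar_trig_poly Q \<and> (\<forall>t. cmod (Q t - h t) < e)"
proof -
  have hc: "continuous_on {0..2 * pi} h" by (rule continuous_on_subset[OF h(1)]) simp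
  obtain Q1 where Q1: "scalar_trig_poly Q1" "\<And>t. t \<in> {0..2 * pi} \<Longrightarrow> cmod (Q1 t - of_real (Re (h t))) < e / 2"
    using trig_approximation_real[of "\<lambda>t. Re (h t)" "e / 2"] h(2)[of 0] e continuous_on_Re[OF hc] by auto
  obtain Q2 where Q2: "scalar_trig_poly Q2" "\<And>t. t \<in> {0..2 * pi} \<Longrightarrow> cmod (Q2 t - of_real (Im (h t))) < e / 2"
    using trig_approximation_real[of "\<lambda>t. Im (h t)" "e / 2"] h(2)[of 0] e continuous_on_Im[OF hc] by auto
  have on_period: "cmod (Q1 t + \<i> * Q2 t - h t) < e" if t: "t \<in> {0..2 * pi}" for t
  proof -
    have "Q1 t + \<i> * Q2 t - h t = (Q1 t - of_real (Re (h t))) + \<i> * (Q2 t - of_real (Im (h t)))"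
      using complex_eq[of "h t"] by (simp add: algebra_simps)
    then have "cmod (Q1 t + \<i> * Q2 t - h t) \<le> cmod (Q1 t - of_real (Re (h t))) + cmod (Q2 t - of_real (Im (h t)))"
      by (metis norm_triangle_ineq norm_mult norm_ii mult_1)
    then show ?thesis using Q1(2)[OF t] Q2(2)[OF t] by linarith
  qed
  have Q: "scalar_trig_poly (\<lambda>t. Q1 t + \<i> * Q2 t)"
    by (intro scalar_trig_poly.add scalar_trig_poly_cmult Q1 Q2)
  have "cmod (Q1 t + \<i> * Q2 t - h t) < e" for t
  proof -
    obtain i where "t + 2 * pi * of_int i \<in> {0..2 * pi}" by (rule periodic_reduce)
    from on_period[OF this] show ?thesis
      using periodic_int[of "\<lambda>t. Q1 t + \<i> * Q2 t - h t" t i] h(2) test_functionsD(2)[OF scalar_trig_poly_test[OF Q]]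
      by simp
  qed
  with Q show ?thesis by blast
qed

text \<open>
  Density of the trigonometric polynomials in the topology of the test functions: the derivative is
  approximated first, and the approximation is integrated.
\<close>

lemma trig_approximation_smooth:
  assumes "\<psi> \<in> test_functions" "e > 0"
  shows "\<exists>\<eta>. scalar_trig_poly \<eta> \<and> (\<forall>j\<le>m. \<forall>t. cmod (higher_vderiv j \<eta> t - higher_vderiv j \<psi> t) < e)"
  using assms
proof (induction m arbitrary: \<psi> e)
  case 0
  then show ?case using trig_approximation[OF continuous_on_test[of \<psi> UNIV] test_functionsD(2)] by simp
next
  case (Suc m)
  \<comment> \<open>The approximant of \<open>\<psi>\<close> is a primitive of \<open>Q - c\<close>, where \<open>Q\<close> approximates the derivative of \<open>\<psi>\<close> up to \<open>d\<close>
    and \<open>c\<close> is the mean of \<open>Q\<close>. So the derivatives are off by at most \<open>2 d\<close>, and \<open>\<psi>\<close> itself by \<open>2 \<pi>\<close> times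
    that.\<close>
  define d where "d = e / (4 * pi + 4)"
  have d: "d > 0" "2 * d < e" "4 * pi * d < e"
    using Suc.prems(2) pi_gt_zero by (auto simp: d_def field_simps add_pos_pos)
  let ?\<psi>' = "higher_vderiv 1 \<psi>"
  have \<psi>': "?\<psi>' \<in> test_functions" by (rule test_functions_higher_vderiv[OF Suc.prems(1)])
  obtain Q where Q: "scalar_trig_poly Q" "\<And>j t. j \<le> m \<Longrightarrow> cmod (higher_vderiv j Q t - higher_vderiv j ?\<psi>' t) < d"
    using Suc.IH[OF \<psi>' d(1)] by blast
  obtain c G where G: "scalar_trig_poly G" "\<And>t. (G has_vector_derivative Q t - c) (at t)"
    using scalar_trig_poly_antiderivative[OF Q(1)] by blast
  have d\<psi>: "(\<psi> has_vector_derivative ?\<psi>' t) (at t)" for t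
    using smooth_fun_has_vderiv[OF test_functionsD(1)[OF Suc.prems(1)], of 0] by simp
  have intG: "((\<lambda>t. Q t - c) has_integral G b - G a) {a..b}" if "a \<le> b" for a b
    by (rule fundamental_theorem_of_calculus[OF that]) (rule has_vector_derivative_at_within[OF G(2)])
  have int\<psi>: "(?\<psi>' has_integral \<psi> b - \<psi> a) {a..b}" if "a \<le> b" for a b
    by (rule fundamental_theorem_of_calculus[OF that]) (rule has_vector_derivative_at_within[OF d\<psi>])
  have Gper: "G (t + 2 * pi) = G t" for t by (rule test_functionsD(2)[OF scalar_trig_poly_test[OF G(1)]])
  have Qd: "cmod (Q t - ?\<psi>' t) \<le> d" for t using Q(2)[of 0 t] by simp
  have c: "cmod c \<le> d"
  proof -
    have "((\<lambda>t. (Q t - c) - ?\<psi>' t) has_integral (G (2 * pi) - G 0) - (\<psi> (2 * pi) - \<psi> 0)) {0..2 * pi}"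
      by (intro has_integral_diff[OF intG int\<psi>]) simp_all
    then have "((\<lambda>t. (Q t - c) - ?\<psi>' t) has_integral 0) {0..2 * pi}"
      using Gper[of 0] test_functionsD(2)[OF Suc.prems(1), of 0] by simp
    moreover have "((\<lambda>t. c) has_integral (2 * pi) *\<^sub>R c) {0..2 * pi}"
      using has_integral_const_real[of c 0 "2 * pi"] by simp
    ultimately have "((\<lambda>t. ((Q t - c) - ?\<psi>' t) + c) has_integral 0 + (2 * pi) *\<^sub>R c) {0..2 * pi}"
      by (rule has_integral_add)
    moreover have "((\<lambda>t. d) has_integral (2 * pi) * d) {0..2 * pi}"
      using has_integral_const_real[of d 0 "2 * pi"] by simp
    ultimately have "norm (0 + (2 * pi) *\<^sub>R c) \<le> (2 * pi) * d"
      by (rule has_integral_norm_le) (use Qd in \<open>simp add: algebra_simps\<close>)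
    then show ?thesis by simp
  qed
  define \<eta> where "\<eta> t = G t + (\<psi> 0 - G 0)" for t
  have \<eta>: "scalar_trig_poly \<eta>"
    unfolding \<eta>_def by (intro scalar_trig_poly.add G scalar_trig_poly_const)
  have \<eta>': "(\<eta> has_vector_derivative Q t - c) (at t)" for t
    unfolding \<eta>_def using has_vector_derivative_add[OF G(2)[of t] has_vector_derivative_const] by simp
  have diff: "cmod ((Q t - c) - ?\<psi>' t) \<le> 2 * d" for t
    using Qd[of t] c norm_triangle_ineq4[of "Q t - ?\<psi>' t" c] by (simp add: algebra_simps)
  have per: "\<eta> t - \<psi> t = \<eta> (t + 2 * pi * of_int i) - \<psi> (t + 2 * pi * of_int i)" for t i
    by (rule periodic_int[of "\<lambda>t. \<eta> t - \<psi> t", symmetric])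
      (use test_functionsD(2)[OF Suc.prems(1)] test_functionsD(2)[OF scalar_trig_poly_test[OF \<eta>]] in simp)
  have on_period: "cmod (\<eta> t - \<psi> t) \<le> 4 * pi * d" if t: "t \<in> {0..2 * pi}" for t
  proof -
    have "((\<lambda>u. (Q u - c) - ?\<psi>' u) has_integral (\<eta> t - \<eta> 0) - (\<psi> t - \<psi> 0)) {0..t}"
      using has_integral_diff[OF intG[of 0 t] int\<psi>[of 0 t]] t by (simp add: \<eta>_def)
    moreover have "((\<lambda>u. 2 * d) has_integral t * (2 * d)) {0..t}"
      using has_integral_const_real[of "2 * d" 0 t] t by simp
    ultimately have "cmod ((\<eta> t - \<eta> 0) - (\<psi> t - \<psi> 0)) \<le> t * (2 * d)"
      by (rule has_integral_norm_le) (rule diff)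
    also have "\<dots> \<le> (2 * pi) * (2 * d)" using t d by (intro mult_right_mono) auto
    finally show ?thesis by (simp add: \<eta>_def algebra_simps)
  qed
  have zero: "cmod (\<eta> t - \<psi> t) < e" for t
  proof -
    obtain i where "t + 2 * pi * of_int i \<in> {0..2 * pi}" by (rule periodic_reduce)
    from on_period[OF this] show ?thesis unfolding per[of t i] using d(3) by linarith
  qed
  have hv\<eta>: "higher_vderiv 1 \<eta> = (\<lambda>t. Q t - c)"
    by (rule ext) (simp add: higher_vderiv_Suc vector_derivative_at[OF \<eta>'])
  have smQ: "smooth_fun Q" "smooth_fun (\<lambda>_. c)"
    using scalar_trig_poly_test[OF Q(1)] scalar_trig_poly_test[OF scalar_trig_poly_const] by (auto dest: test_functionsD)
  have const: "higher_vderiv j (\<lambda>_. c) = (\<lambda>_. if j = 0 then c else 0)" for j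
    by (rule smooth_funI(2)[where g = "\<lambda>j _. if j = 0 then c else 0"]) auto
  have succ: "cmod (higher_vderiv (Suc j) \<eta> t - higher_vderiv (Suc j) \<psi> t) < e" if "j \<le> m" for j t
  proof -
    have "higher_vderiv (Suc j) \<eta> t - higher_vderiv (Suc j) \<psi> t
      = (higher_vderiv j Q t - higher_vderiv j ?\<psi>' t) - higher_vderiv j (\<lambda>_. c) t"
    proof -
      have "higher_vderiv (Suc j) \<eta> = higher_vderiv j (higher_vderiv 1 \<eta>)"
        "higher_vderiv (Suc j) \<psi> = higher_vderiv j ?\<psi>'"
        by (simp_all add: higher_vderiv_add)
      then show ?thesis unfolding hv\<eta> smooth_fun_diff(2)[OF smQ] by simp
    qed
    moreover have "cmod (higher_vderiv j (\<lambda>_. c) t) \<le> d" using c d(1) by (simp add: const)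
    ultimately show ?thesis
      using Q(2)[OF that, of t] norm_triangle_ineq4[of "higher_vderiv j Q t - higher_vderiv j ?\<psi>' t" "higher_vderiv j (\<lambda>_. c) t"] d(2)
      by simp
  qed
  show ?case
  proof (intro exI[of _ \<eta>] conjI allI impI \<eta>)
    fix j t assume "j \<le> Suc m"
    then show "cmod (higher_vderiv j \<eta> t - higher_vderiv j \<psi> t) < e"
      using zero succ by (cases j) auto
  qed
qed

section \<open>Periodic distributions\<close>

lemma distributionsD:
  assumes "u \<in> distributions"
  shows "u \<in> extensional test_functions"
    and "\<psi> \<in> test_functions \<Longrightarrow> \<eta> \<in> test_functions \<Longrightarrow> u (\<lambda>t. \<psi> t + \<eta> t) = u \<psi> + u \<eta>"
    and "\<psi> \<in> test_functions \<Longrightarrow> u (\<lambda>t. c * \<psi> t) = c *\<^sub>C u \<psi>"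
    and "\<psi> \<in> test_functions \<Longrightarrow> \<epsilon> > 0 \<Longrightarrow> \<exists>m. \<exists>\<delta>>0. \<forall>\<eta>\<in>test_functions.
        (\<forall>j\<le>m. test_seminorm j (\<lambda>t. \<eta> t - \<psi> t) < \<delta>) \<longrightarrow> norm (u \<eta> - u \<psi>) < \<epsilon>"
  using assms by (auto simp: distributions_def)

lemma distribution_on_cis:
  "u (\<lambda>t. cis (of_int k * t)) = (2 * pi) *\<^sub>R fourier_coeff u (- k)"
  by (simp add: fourier_coeff_def)

text \<open>
  The coefficients determine a distribution on the trigonometric polynomials, which are dense.
\<close>

lemma distributions_eq_iff_fourier_coeff:
  fixes u v :: "(real \<Rightarrow> complex) \<Rightarrow> 'a::complex_banach"
  assumes u: "u \<in> distributions" and v: "v \<in> distributions"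
    and eq: "\<And>k. fourier_coeff u k = fourier_coeff v k"
  shows "u = v"
proof -
  have trig: "u \<eta> = v \<eta>" if "scalar_trig_poly \<eta>" for \<eta>
    using that
  proof (induction rule: scalar_trig_poly.induct)
    case (monomial c k)
    show ?case
      using distributionsD(3)[OF u test_functions_cis, of c k] distributionsD(3)[OF v test_functions_cis, of c k]
      by (simp add: distribution_on_cis eq)
  next
    case (add f g)
    then show ?case
      using distributionsD(2)[OF u, of f g] distributionsD(2)[OF v, of f g] by (simp add: scalar_trig_poly_test)
  qed
  have "u \<psi> = v \<psi>" if \<psi>: "\<psi> \<in> test_functions" for \<psi>
  proof (rule ccontr)
    assume "u \<psi> \<noteq> v \<psi>"
    define \<epsilon> where "\<epsilon> = norm (u \<psi> - v \<psi>) / 2"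
    have \<epsilon>: "\<epsilon> > 0" using \<open>u \<psi> \<noteq> v \<psi>\<close> by (simp add: \<epsilon>_def)
    obtain m1 d1 where 1: "d1 > 0" "\<forall>\<eta>\<in>test_functions.
        (\<forall>j\<le>m1. test_seminorm j (\<lambda>t. \<eta> t - \<psi> t) < d1) \<longrightarrow> norm (u \<eta> - u \<psi>) < \<epsilon>"
      using distributionsD(4)[OF u \<psi> \<epsilon>] by (elim exE conjE)
    obtain m2 d2 where 2: "d2 > 0" "\<forall>\<eta>\<in>test_functions.
        (\<forall>j\<le>m2. test_seminorm j (\<lambda>t. \<eta> t - \<psi> t) < d2) \<longrightarrow> norm (v \<eta> - v \<psi>) < \<epsilon>"
      using distributionsD(4)[OF v \<psi> \<epsilon>] by (elim exE conjE)
    define d where "d = min d1 d2"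
    have d: "d > 0" "d \<le> d1" "d \<le> d2" using 1(1) 2(1) by (auto simp: d_def)
    obtain \<eta> where \<eta>: "scalar_trig_poly \<eta>"
      "\<And>j t. j \<le> max m1 m2 \<Longrightarrow> cmod (higher_vderiv j \<eta> t - higher_vderiv j \<psi> t) < d / 2"
      using trig_approximation_smooth[OF \<psi>, of "d / 2" "max m1 m2"] d by auto
    have \<eta>t: "\<eta> \<in> test_functions" by (rule scalar_trig_poly_test[OF \<eta>(1)])
    have small: "test_seminorm j (\<lambda>t. \<eta> t - \<psi> t) < d" if "j \<le> max m1 m2" for j
    proof -
      have "test_seminorm j (\<lambda>t. \<eta> t - \<psi> t) \<le> d / 2"
        using \<eta>(2)[OF that] smooth_fun_diff(2)[OF test_functionsD(1)[OF \<eta>t] test_functionsD(1)[OF \<psi>], of j]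
        by (intro test_seminorm_le) (simp add: less_imp_le)
      then show ?thesis using d(1) by linarith
    qed
    have "norm (u \<eta> - u \<psi>) < \<epsilon>" 
      by (intro 1(2)[rule_format, OF \<eta>t] less_le_trans[OF small d(2)]) simp
    moreover have "norm (v \<eta> - v \<psi>) < \<epsilon>" 
      by (intro 2(2)[rule_format, OF \<eta>t] less_le_trans[OF small d(3)]) simp
    moreover have "norm (u \<psi> - v \<psi>) \<le> norm (u \<eta> - u \<psi>) + norm (v \<eta> - v \<psi>)"
      using trig[OF \<eta>(1)] norm_triangle_ineq4[of "v \<eta> - v \<psi>" "u \<eta> - u \<psi>"] by (simp add: norm_minus_commute)
    ultimately show False by (simp add: \<epsilon>_def)
  qed
  then show ?thesis
    using distributionsD(1)[OF u] distributionsD(1)[OF v] by (auto intro: extensionalityI)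
qed

lemma distr_deriv_distribution:
  fixes u :: "(real \<Rightarrow> complex) \<Rightarrow> 'a::complex_banach"
  assumes u: "u \<in> distributions"
  shows "distr_deriv l u \<in> distributions"
proof -
  note hv = test_functions_higher_vderiv
  have sm: "smooth_fun \<psi>" if "\<psi> \<in> test_functions" for \<psi> by (rule test_functionsD(1)[OF that])
  have "\<exists>m. \<exists>\<delta>>0. \<forall>\<eta>\<in>test_functions. (\<forall>j\<le>m. test_seminorm j (\<lambda>t. \<eta> t - \<psi> t) < \<delta>) \<longrightarrow>
      norm (distr_deriv l u \<eta> - distr_deriv l u \<psi>) < \<epsilon>" if \<psi>: "\<psi> \<in> test_functions" and \<epsilon>: "\<epsilon> > 0" for \<psi> \<epsilon>
  proof -
    obtain m d where m: "d > 0" "\<forall>\<eta>\<in>test_functions.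
        (\<forall>j\<le>m. test_seminorm j (\<lambda>t. \<eta> t - higher_vderiv l \<psi> t) < d) \<longrightarrow> norm (u \<eta> - u (higher_vderiv l \<psi>)) < \<epsilon>"
      using distributionsD(4)[OF u hv[OF \<psi>, of l] \<epsilon>] by (elim exE conjE)
    show ?thesis
    proof (intro exI[of _ "m + l"] exI[of _ d] conjI ballI impI m(1))
      fix \<eta> assume \<eta>: "\<eta> \<in> test_functions" and small: "\<forall>j\<le>m + l. test_seminorm j (\<lambda>t. \<eta> t - \<psi> t) < d"
      have eq: "(\<lambda>t. higher_vderiv l \<eta> t - higher_vderiv l \<psi> t) = higher_vderiv l (\<lambda>t. \<eta> t - \<psi> t)"
        by (rule smooth_fun_diff(2)[OF sm[OF \<eta>] sm[OF \<psi>], symmetric])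
      have "test_seminorm j (\<lambda>t. higher_vderiv l \<eta> t - higher_vderiv l \<psi> t) < d" if "j \<le> m" for j
      proof -
        have "test_seminorm j (\<lambda>t. higher_vderiv l \<eta> t - higher_vderiv l \<psi> t) = test_seminorm (j + l) (\<lambda>t. \<eta> t - \<psi> t)"
          unfolding eq by (simp add: test_seminorm_def higher_vderiv_add)
        then show ?thesis using small that by simp
      qed
      then have "norm (u (higher_vderiv l \<eta>) - u (higher_vderiv l \<psi>)) < \<epsilon>"
        by (rule m(2)[rule_format, OF hv[OF \<eta>]])
      then show "norm (distr_deriv l u \<eta> - distr_deriv l u \<psi>) < \<epsilon>"
        using \<eta> \<psi> by (simp add: distr_deriv_def scaleR_diff_right[symmetric])
    qed
  qed
  moreover have "distr_deriv l u (\<lambda>t. \<psi> t + \<eta> t) = distr_deriv l u \<psi> + distr_deriv l u \<eta>"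
    if "\<psi> \<in> test_functions" "\<eta> \<in> test_functions" for \<psi> \<eta>
    using that distributionsD(2)[OF u hv[OF that(1)] hv[OF that(2)]]
    by (simp add: distr_deriv_def test_functions_plus smooth_fun_plus(2)[OF sm sm] scaleR_add_right)
  moreover have "distr_deriv l u (\<lambda>t. c * \<psi> t) = c *\<^sub>C distr_deriv l u \<psi>" if "\<psi> \<in> test_functions" for \<psi> c
    using that distributionsD(3)[OF u hv[OF that]]
    by (simp add: distr_deriv_def test_functions_cmult smooth_fun_cmult(2)[OF sm] scaleC.scaleR_right)
  ultimately show ?thesis unfolding distributions_def by (simp add: distr_deriv_def)
qed

lemma fourier_coeff_distr_deriv:
  fixes u :: "(real \<Rightarrow> complex) \<Rightarrow> 'a::complex_banach"
  assumes u: "u \<in> distributions"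
  shows "fourier_coeff (distr_deriv l u) k = (\<i> * of_int k) ^ l *\<^sub>C fourier_coeff u k"
proof -
  have cis: "(\<lambda>t. cis (- (of_int k * t))) = (\<lambda>t. cis (of_int (- k) * t))" by simp
  have "distr_deriv l u (\<lambda>t. cis (of_int (- k) * t)) = (-1) ^ l *\<^sub>R u (\<lambda>t. (\<i> * of_int (- k)) ^ l * cis (of_int (- k) * t))"
    unfolding distr_deriv_def by (simp only: restrict_apply if_True test_functions_cis smooth_fun_cis(2))
  also have "u (\<lambda>t. (\<i> * of_int (- k)) ^ l * cis (of_int (- k) * t)) = (\<i> * of_int (- k)) ^ l *\<^sub>C u (\<lambda>t. cis (of_int (- k) * t))"
    by (rule distributionsD(3)[OF u test_functions_cis])
  also have "(-1) ^ l *\<^sub>R ((\<i> * of_int (- k)) ^ l *\<^sub>C u (\<lambda>t. cis (of_int (- k) * t)))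
      = (\<i> * of_int k) ^ l *\<^sub>C u (\<lambda>t. cis (of_int (- k) * t))"
    by (simp add: scaleR_scaleC scaleC_scaleC power_mult_distrib[symmetric])
  finally show ?thesis
    unfolding fourier_coeff_def cis by (simp only: scaleC.scaleR_right)
qed

definition function_distribution :: "(real \<Rightarrow> 'a::complex_banach) \<Rightarrow> (real \<Rightarrow> complex) \<Rightarrow> 'a" where
  "function_distribution g = restrict (\<lambda>\<psi>. integral {0..2 * pi} (\<lambda>t. \<psi> t *\<^sub>C g t)) test_functions"

lemma function_distribution:
  fixes g :: "real \<Rightarrow> 'a::complex_banach"
  assumes per: "\<And>t. g (t + 2 * pi) = g t" and g: "mem_Lp 1 torus g"
    and int: "\<And>\<psi>. \<psi> \<in> test_functions \<Longrightarrow> (\<lambda>t. \<psi> t *\<^sub>C g t) integrable_on {0..2 * pi}"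
  shows "represents g (function_distribution g)" and "function_distribution g \<in> distributions"
proof -
  have I: "((\<lambda>t. \<psi> t *\<^sub>C g t) has_integral function_distribution g \<psi>) {0..2 * pi}" if "\<psi> \<in> test_functions" for \<psi>
    using integrable_integral[OF int[OF that]] that by (simp add: function_distribution_def)
  show "represents g (function_distribution g)"
    unfolding represents_def using per g I by blast
  have add: "function_distribution g (\<lambda>t. \<psi> t + \<eta> t) = function_distribution g \<psi> + function_distribution g \<eta>"
    if "\<psi> \<in> test_functions" "\<eta> \<in> test_functions" for \<psi> \<eta>
  proof (rule has_integral_unique[OF I[OF test_functions_plus[OF that]]])
    show "((\<lambda>t. (\<psi> t + \<eta> t) *\<^sub>C g t) has_integral function_distribution g \<psi> + function_distribution g \<eta>) {0..2 * pi}"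
      using has_integral_add[OF I[OF that(1)] I[OF that(2)]] by (simp add: scaleC_add_left)
  qed
  have cmult: "function_distribution g (\<lambda>t. c * \<psi> t) = c *\<^sub>C function_distribution g \<psi>"
    if "\<psi> \<in> test_functions" for \<psi> c
  proof (rule has_integral_unique[OF I[OF test_functions_cmult[OF that]]])
    show "((\<lambda>t. (c * \<psi> t) *\<^sub>C g t) has_integral c *\<^sub>C function_distribution g \<psi>) {0..2 * pi}"
      using has_integral_linear[OF I[OF that] scaleC.bounded_linear_right[of c]] by (simp add: scaleC_scaleC o_def)
  qed
  have cont: "\<exists>m. \<exists>\<delta>>0. \<forall>\<eta>\<in>test_functions. (\<forall>j\<le>m. test_seminorm j (\<lambda>t. \<eta> t - \<psi> t) < \<delta>) \<longrightarrow>
      norm (function_distribution g \<eta> - function_distribution g \<psi>) < \<epsilon>"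
    if \<psi>: "\<psi> \<in> test_functions" and \<epsilon>: "\<epsilon> > 0" for \<psi> \<epsilon>
  proof -
    define K where "K = (LINT t|torus. norm (g t))"
    have gi: "integrable torus (\<lambda>t. norm (g t))" using g by (simp add: mem_Lp_def)
    have K: "((\<lambda>t. norm (g t)) has_integral K) {0..2 * pi}" "0 \<le> K"
      unfolding K_def using gi has_integral_nonneg_iff[of "\<lambda>t. norm (g t)"] by (simp_all add: integral_nonneg_AE)
    define \<delta> where "\<delta> = \<epsilon> / (K + 1)"
    have \<delta>: "\<delta> > 0" "\<delta> * K < \<epsilon>" using \<epsilon> K(2) by (auto simp: \<delta>_def field_simps)
    show ?thesis
    proof (intro exI[of _ "0::nat"] exI[of _ \<delta>] conjI ballI impI \<delta>(1))
      fix \<eta> assume \<eta>: "\<eta> \<in> test_functions" and small: "\<forall>j\<le>0. test_seminorm j (\<lambda>t. \<eta> t - \<psi> t) < \<delta>"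
      have "norm (function_distribution g \<eta> - function_distribution g \<psi>) \<le> \<delta> * K"
      proof (rule has_integral_norm_le[OF has_integral_diff[OF I[OF \<eta>] I[OF \<psi>]] has_integral_mult_right[OF K(1)]])
        fix t
        have "cmod (\<eta> t - \<psi> t) \<le> \<delta>"
          using le_test_seminorm[OF test_functions_diff[OF \<eta> \<psi>], of 0 t] small by simp
        then show "norm (\<eta> t *\<^sub>C g t - \<psi> t *\<^sub>C g t) \<le> \<delta> * norm (g t)"
          by (simp add: scaleC.diff_left[symmetric] norm_scaleC mult_right_mono)
      qed
      then show "norm (function_distribution g \<eta> - function_distribution g \<psi>) < \<epsilon>" using \<delta>(2) by linarith
    qed
  qed
  have ext: "function_distribution g \<in> extensional test_functions" by (simp add: function_distribution_def)
  show "function_distribution g \<in> distributions"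
    unfolding distributions_def using ext add cmult cont by simp
qed

section \<open>Uniqueness of the representing function\<close>

text \<open>
  The bound 2 leaves room for the error of the uniform approximation of functions with values in \<open>{0..1}\<close>, and it
  makes dominated convergence applicable.
\<close>

lemma indicator_trig_approximation:
  assumes E: "E \<in> sets lebesgue"
  shows "\<exists>Q. (\<forall>n. scalar_trig_poly (Q n)) \<and> (\<forall>n. \<forall>t\<in>{0..2 * pi}. cmod (Q n t) \<le> 2) \<and>
    (AE t in torus. (\<lambda>n. Q n t) \<longlonglongrightarrow> indicator E t)"
proof -
  have "(indicator E :: real \<Rightarrow> real) \<in> borel_measurable lebesgue" using E by simp
  then have "(indicator E :: real \<Rightarrow> real) measurable_on UNIV"
    by (rule lebesgue_measurable_imp_measurable_on) simp
  then obtain N g where N: "negligible N" and g: "\<And>n. continuous_on UNIV (g n)"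
    "\<And>t. t \<notin> N \<Longrightarrow> (\<lambda>n. g n t) \<longlonglongrightarrow> (indicator E t :: real)"
    unfolding measurable_on_def by auto
  \<comment> \<open>The second factor vanishes at both ends of the period, so that \<open>h n\<close> is continuous on the circle.\<close>
  define h where "h n t = min 1 (max 0 (g n t)) * min 1 (real n * min t (2 * pi - t))" for n and t :: real
  have h01: "\<bar>h n t\<bar> \<le> 1" if "t \<in> {0..2 * pi}" for n t
    unfolding h_def abs_mult using that by (intro mult_le_one) auto
  have hlim: "(\<lambda>n. h n t) \<longlonglongrightarrow> indicator E t" if t: "t \<in> {0<..<2 * pi}" "t \<notin> N" for t
  proof -
    have "(\<lambda>n. min 1 (max 0 (g n t))) \<longlonglongrightarrow> min 1 (max 0 (indicator E t))"
      by (intro tendsto_intros g t)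
    then have 1: "(\<lambda>n. min 1 (max 0 (g n t))) \<longlonglongrightarrow> indicator E t" by (simp add: indicator_def split: if_splits)
    have m: "min t (2 * pi - t) > 0" using t by simp
    then obtain n0 where n0: "1 < real n0 * min t (2 * pi - t)" using reals_Archimedean3 by blast
    have "eventually (\<lambda>n. min 1 (real n * min t (2 * pi - t)) = 1) sequentially"
      using eventually_ge_at_top[of n0]
    proof eventually_elim
      case (elim n)
      then have "real n0 * min t (2 * pi - t) \<le> real n * min t (2 * pi - t)" using m by (intro mult_right_mono) auto
      then show ?case using n0 by simp
    qed
    then have "(\<lambda>n. min 1 (real n * min t (2 * pi - t))) \<longlonglongrightarrow> 1" by (rule tendsto_eventually)
    from tendsto_mult[OF 1 this] show ?thesis by (simp add: h_def)
  qed
  have "\<exists>Q. scalar_trig_poly Q \<and> (\<forall>t\<in>{0..2 * pi}. cmod (Q t - of_real (h n t)) < 1 / real (Suc n))" for n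
    by (rule trig_approximation_real) 
      (auto simp: h_def intro!: continuous_intros continuous_on_subset[OF g(1)])
  then obtain Q where Q: "\<And>n. scalar_trig_poly (Q n)"
    "\<And>n t. t \<in> {0..2 * pi} \<Longrightarrow> cmod (Q n t - of_real (h n t)) < 1 / real (Suc n)"
    by metis
  show ?thesis
  proof (intro exI[of _ Q] conjI allI ballI Q(1))
    fix n t assume t: "t \<in> {0..2 * pi}"
    have "cmod (Q n t) \<le> cmod (Q n t - of_real (h n t)) + cmod (of_real (h n t))"
      using norm_triangle_ineq[of "Q n t - of_real (h n t)" "of_real (h n t)"] by simp
    moreover have "1 / real (Suc n) \<le> 1" by simp
    ultimately show "cmod (Q n t) \<le> 2" using Q(2)[OF t, of n] h01[OF t, of n] by (simp only: norm_of_real)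
  next
    have lim: "(\<lambda>n. Q n t) \<longlonglongrightarrow> indicator E t" if t: "t \<in> {0<..<2 * pi}" "t \<notin> N" for t
    proof -
      have "(\<lambda>n. Q n t - of_real (h n t)) \<longlonglongrightarrow> 0"
      proof (rule Lim_null_comparison)
        show "eventually (\<lambda>n. cmod (Q n t - of_real (h n t)) \<le> 1 / real (Suc n)) sequentially"
          using t by (intro always_eventually allI less_imp_le Q(2)) auto
        show "(\<lambda>j. 1 / real (Suc j)) \<longlonglongrightarrow> 0" using LIMSEQ_inverse_real_of_nat by (simp add: inverse_eq_divide)
      qed
      from tendsto_add[OF this tendsto_of_real[OF hlim[OF t]]] show ?thesis by (simp add: of_real_indicator)
    qed
    show "AE t in torus. (\<lambda>n. Q n t) \<longlonglongrightarrow> indicator E t"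
    proof (subst AE_lebesgue_on_iff_negligible)
      have "negligible (insert 0 (insert (2 * pi) N))" using N by simp
      then show "negligible {t \<in> {0..2 * pi}. \<not> (\<lambda>n. Q n t) \<longlonglongrightarrow> indicator E t}"
        by (rule negligible_subset) (use lim in \<open>force simp: less_le\<close>)
    qed simp
  qed
qed

text \<open>
  On the set where \<open>d\<close> is close to a value \<open>c\<close> its mean is close to \<open>c\<close>. But the mean vanishes, as the indicator
  of that set is a limit of trigonometric polynomials.
\<close>

lemma zero_fourier_coeffs_imp_zero:
  fixes d :: "real \<Rightarrow> 'a::complex_banach"
  assumes sm: "strongly_measurable torus d" and di: "integrable torus (\<lambda>t. norm (d t))"
    and zero: "\<And>k. ((\<lambda>t. cis (of_int k * t) *\<^sub>C d t) has_integral 0) {0..2 * pi}"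
  shows "AE t in torus. d t = 0"
proof -
  have trig: "((\<lambda>t. Q t *\<^sub>C d t) has_integral 0) {0..2 * pi}" if "scalar_trig_poly Q" for Q
    using that
  proof (induction rule: scalar_trig_poly.induct)
    case (monomial c k)
    show ?case
      using has_integral_linear[OF zero scaleC.bounded_linear_right[of c], of k]
      by (simp add: o_def scaleC_scaleC scaleC.zero_right)
  next
    case (add f g)
    show ?case using has_integral_add[OF add.IH] by (simp add: scaleC_add_left)
  qed
  \<comment> \<open>Where \<open>d\<close> does not vanish it is close to some value \<open>c \<noteq> 0\<close> of the simple functions that approximate
    it, so it suffices that each of the sets \<open>E c\<close> is null.\<close>
  define E where "E c = {t \<in> {0..2 * pi}. norm (d t - c) < norm c / 2}" for c
  have nd: "(\<lambda>t. norm (d t - c)) \<in> borel_measurable torus" for c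
    by (rule strongly_measurable_norm_diff[OF sm]) simp
  have Es: "E c \<in> sets torus" for c
  proof -
    have "{t \<in> space torus. norm (d t - c) < norm c / 2} \<in> sets torus" using nd[of c] by measurable
    then show ?thesis by (simp add: E_def space_restrict_space)
  qed
  then have El: "E c \<in> sets lebesgue" for c by (simp add: sets_restrict_space_iff)
  interpret fm: finite_measure torus by (rule finite_measure_lebesgue_on_Icc)
  have null: "AE t in torus. t \<notin> E c" if c: "c \<noteq> 0" for c
  proof -
    obtain Q where Q: "\<And>n. scalar_trig_poly (Q n)" "\<And>n t. t \<in> {0..2 * pi} \<Longrightarrow> cmod (Q n t) \<le> 2"
      "AE t in torus. (\<lambda>n. Q n t) \<longlonglongrightarrow> indicator (E c) t"
      using indicator_trig_approximation[OF El[of c]] by blast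
    have Qm: "Q n \<in> borel_measurable torus" for n
      using continuous_on_test[OF scalar_trig_poly_test[OF Q(1)]]
      by (intro continuous_imp_measurable_on_sets_lebesgue) auto
    have Qi: "integrable torus (Q n)" for n
      by (rule fm.integrable_const_bound[of _ 2]) (use Q(2) Qm in \<open>auto intro!: AE_I2 simp: space_restrict_space\<close>)
    have ndi: "integrable torus (\<lambda>t. norm (d t - c))"
    proof (rule Bochner_Integration.integrable_bound[OF _ nd])
      show "integrable torus (\<lambda>t. norm (d t) + norm c)" using di by simp
      show "AE t in torus. norm (norm (d t - c)) \<le> norm (norm (d t) + norm c)"
        by (rule AE_I2) (use norm_triangle_ineq4 in \<open>simp add: abs_of_nonneg\<close>)
    qed
    have bnd: "AE t in torus. norm (cmod (Q n t) * norm (d t - c)) \<le> 2 * norm (d t - c)" for n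
      by (rule AE_I2) (use Q(2) in \<open>auto simp: space_restrict_space intro!: mult_right_mono\<close>)
    have pm: "(\<lambda>t. cmod (Q n t) * norm (d t - c)) \<in> borel_measurable torus" for n
      using Qm nd by measurable
    have pi: "integrable torus (\<lambda>t. cmod (Q n t) * norm (d t - c))" for n
    proof (rule Bochner_Integration.integrable_bound[OF _ pm])
      show "integrable torus (\<lambda>t. 2 * norm (d t - c))" using ndi by simp
      show "AE t in torus. norm (cmod (Q n t) * norm (d t - c)) \<le> norm (2 * norm (d t - c))"
        using bnd[of n] by eventually_elim simp
    qed
    \<comment> \<open>As \<open>Q n\<close> is orthogonal to \<open>d\<close>, integrating \<open>Q n\<close> against \<open>c\<close> is the same as against \<open>c - d\<close>. In the limit the
      measure \<open>\<mu>\<close> of \<open>E c\<close> satisfies \<open>\<mu> \<parallel>c\<parallel> \<le> \<mu> \<parallel>c\<parallel> / 2\<close>.\<close>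
    have le: "cmod (LINT t|torus. Q n t) * norm c \<le> (LINT t|torus. cmod (Q n t) * norm (d t - c))" for n
    proof -
      have "((\<lambda>t. Q n t *\<^sub>C c) has_integral (LINT t|torus. Q n t) *\<^sub>C c) {0..2 * pi}"
        using has_integral_linear[OF has_integral_integral_lebesgue_on[OF Qi] scaleC.bounded_linear_left[of c], of n]
        by (simp add: o_def)
      from has_integral_diff[OF this trig[OF Q(1)]]
      have "((\<lambda>t. Q n t *\<^sub>C c - Q n t *\<^sub>C d t) has_integral (LINT t|torus. Q n t) *\<^sub>C c) {0..2 * pi}" by simp
      moreover have "((\<lambda>t. cmod (Q n t) * norm (d t - c)) has_integral (LINT t|torus. cmod (Q n t) * norm (d t - c))) {0..2 * pi}"
        by (rule has_integral_integral_lebesgue_on[OF pi]) simp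
      ultimately have "norm ((LINT t|torus. Q n t) *\<^sub>C c) \<le> (LINT t|torus. cmod (Q n t) * norm (d t - c))"
        by (rule has_integral_norm_le) (simp add: scaleC.diff_right[symmetric] norm_scaleC norm_minus_commute)
      then show ?thesis by (simp add: norm_scaleC)
    qed
    have lim1: "(\<lambda>n. LINT t|torus. Q n t) \<longlonglongrightarrow> (LINT t|torus. indicator (E c) t)"
    proof (rule integral_dominated_convergence[where w = "\<lambda>_. 2"])
      show "AE t in torus. norm (Q n t) \<le> 2" for n
        by (rule AE_I2) (use Q(2) in \<open>auto simp: space_restrict_space\<close>)
    qed (use Qm Q(3) Es in auto)
    have lim2: "(\<lambda>n. LINT t|torus. cmod (Q n t) * norm (d t - c)) \<longlonglongrightarrow> (LINT t|torus. indicator (E c) t * norm (d t - c))"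
    proof (rule integral_dominated_convergence[where w = "\<lambda>t. 2 * norm (d t - c)"])
      show "(\<lambda>t. indicator (E c) t * norm (d t - c)) \<in> borel_measurable torus" using nd Es by measurable
      show "AE t in torus. (\<lambda>n. cmod (Q n t) * norm (d t - c)) \<longlonglongrightarrow> indicator (E c) t * norm (d t - c)"
        using Q(3)
      proof eventually_elim
        case (elim t)
        have "(\<lambda>n. cmod (Q n t) * norm (d t - c)) \<longlonglongrightarrow> cmod (indicator (E c) t) * norm (d t - c)"
          by (intro tendsto_intros elim)
        moreover have "cmod (indicator (E c) t) = indicator (E c) t" by (simp add: indicator_def)
        ultimately show ?case by simp
      qed
    qed (use pm ndi bnd in auto)
    define \<mu> where "\<mu> = measure torus (E c)"
    have ind: "(LINT t|torus. indicator (E c) t :: complex) = of_real \<mu>"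
    proof -
      have "(LINT t|torus. indicator (E c) t :: complex) = (LINT t|torus. of_real (indicator (E c) t))"
        by (simp only: of_real_indicator)
      also have "\<dots> = of_real (LINT t|torus. indicator (E c) t)" by (rule integral_complex_of_real)
      also have "(LINT t|torus. indicator (E c) t :: real) = \<mu>" using Es sets.sets_into_space[OF Es[of c]] 
        by (simp add: \<mu>_def Int_absorb2)
      finally show ?thesis .
    qed
    have "cmod (LINT t|torus. indicator (E c) t) * norm c \<le> (LINT t|torus. indicator (E c) t * norm (d t - c))"
      by (rule LIMSEQ_le[OF tendsto_mult[OF tendsto_norm[OF lim1] tendsto_const] lim2]) (use le in auto)
    also have "\<dots> \<le> (LINT t|torus. indicator (E c) t * (norm c / 2))"
    proof (rule integral_mono)
      show "integrable torus (\<lambda>t. indicator (E c) t * norm (d t - c))"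
        using integrable_mult_indicator[OF Es[of c] ndi] by simp
      show "integrable torus (\<lambda>t. indicator (E c) t * (norm c / 2))" using integrable_mult_indicator[OF Es[of c], of "\<lambda>_. norm c / 2"] by simp
    qed (auto simp: E_def indicator_def)
    also have "\<dots> = \<mu> * (norm c / 2)" using Es sets.sets_into_space[OF Es[of c]]
      by (simp add: \<mu>_def Int_absorb2)
    finally have "\<mu> * norm c \<le> \<mu> * (norm c / 2)" by (simp add: ind \<mu>_def)
    then have "\<mu> * (norm c / 2) \<le> 0" by (simp add: algebra_simps)
    then have "\<mu> = 0" using c by (simp add: \<mu>_def mult_le_0_iff measure_le_0_iff)
    then have "E c \<in> null_sets torus" using Es by (simp add: \<mu>_def null_sets_def fm.emeasure_eq_measure)
    then show ?thesis by (rule AE_not_in)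
  qed
  obtain s where s: "\<And>i. simple_function torus (s i)" "AE t in torus. (\<lambda>i. s i t) \<longlonglongrightarrow> d t"
    using sm by (auto simp: strongly_measurable_def)
  define R where "R = (\<Union>i. s i ` space torus) - {0}"
  have "countable R"
    unfolding R_def
    by (intro countable_Diff countable_UN countableI_type countable_finite simple_functionD(1)[OF s(1)])
  then have "AE t in torus. \<forall>c\<in>R. t \<notin> E c"
    by (subst AE_ball_countable) (auto simp: R_def null)
  moreover have "AE t in torus. t \<in> space torus" by (rule AE_space)
  ultimately show ?thesis using s(2)
  proof eventually_elim
    case (elim t)
    show ?case
    proof (rule ccontr)
      assume nz: "d t \<noteq> 0"
      have "eventually (\<lambda>i. dist (s i t) (d t) < norm (d t) / 4) sequentially"
        using nz by (intro tendstoD[OF elim(3)]) simp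
      then obtain i where i: "norm (s i t - d t) < norm (d t) / 4"
        by (auto simp: eventually_sequentially dist_norm)
      have "norm (d t) \<le> norm (s i t - d t) + norm (s i t)"
        using norm_triangle_ineq4[of "s i t" "s i t - d t"] by simp
      then have lt: "norm (d t - s i t) < norm (s i t) / 2" using i norm_ge_zero[of "s i t - d t"] unfolding norm_minus_commute[of "d t"] by linarith
      then have "s i t \<noteq> 0" by force
      then have "s i t \<in> R" using elim(2) unfolding R_def by blast
      then have "t \<notin> E (s i t)" using elim(1) by blast
      then show False using lt elim(2) by (simp add: E_def space_restrict_space)
    qed
  qed
qed

lemma representsD:
  "represents g u \<Longrightarrow> \<psi> \<in> test_functions \<Longrightarrow> ((\<lambda>t. \<psi> t *\<^sub>C g t) has_integral u \<psi>) {0..2 * pi}"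
  by (simp add: represents_def)

lemma represents_unique:
  fixes u :: "(real \<Rightarrow> complex) \<Rightarrow> 'a::complex_banach"
  assumes g: "represents g u" and h: "represents h u"
  shows "AE t in torus. g t = h t"
proof -
  have sm: "strongly_measurable torus g" "strongly_measurable torus h"
    and i: "integrable torus (\<lambda>t. norm (g t))" "integrable torus (\<lambda>t. norm (h t))"
    using g h by (auto simp: represents_def mem_Lp_def)
  have smd: "strongly_measurable torus (\<lambda>t. g t - h t)" by (rule strongly_measurable_diff[OF sm])
  have "AE t in torus. g t - h t = 0"
  proof (rule zero_fourier_coeffs_imp_zero[OF smd])
    show "integrable torus (\<lambda>t. norm (g t - h t))"
    proof (rule Bochner_Integration.integrable_bound[OF Bochner_Integration.integrable_add[OF i]])
      show "(\<lambda>t. norm (g t - h t)) \<in> borel_measurable torus" by (rule strongly_measurable_norm[OF smd]) simp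
      show "AE t in torus. norm (norm (g t - h t)) \<le> norm (norm (g t) + norm (h t))"
        by (rule AE_I2) (use norm_triangle_ineq4 in \<open>simp add: abs_of_nonneg\<close>)
    qed
    show "((\<lambda>t. cis (of_int k * t) *\<^sub>C (g t - h t)) has_integral 0) {0..2 * pi}" for k
    proof -
      have "((\<lambda>t. cis (of_int k * t) *\<^sub>C g t) has_integral u (\<lambda>t. cis (of_int k * t))) {0..2 * pi}"
        "((\<lambda>t. cis (of_int k * t) *\<^sub>C h t) has_integral u (\<lambda>t. cis (of_int k * t))) {0..2 * pi}"
        by (rule representsD[OF g test_functions_cis], rule representsD[OF h test_functions_cis])
      from has_integral_diff[OF this] show ?thesis by (simp add: scaleC.diff_right)
    qed
  qed
  then show ?thesis by eventually_elim simp
qed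

section \<open>The delay operator\<close>

abbreviation history_measure :: "nat \<Rightarrow> real measure" where
  "history_measure N \<equiv> lebesgue_on {- (2 * pi * real N)..0}"

lemma mem_Lp_continuous:
  fixes f :: "real \<Rightarrow> 'b::real_normed_vector"
  assumes "continuous_on UNIV f" "1 \<le> p"
  shows "mem_Lp p (lebesgue_on {a..b}) f"
  unfolding mem_Lp_def
proof
  show "strongly_measurable (lebesgue_on {a..b}) f"
    by (rule strongly_measurable_limit[of "\<lambda>_. f"]) (simp_all add: assms)
  show "integrable (lebesgue_on {a..b}) (\<lambda>x. norm (f x) powr p)"
    by (rule continuous_integrable_powr_Icc[OF continuous_on_subset[OF assms(1)] assms(2)]) simp
qed

lemma mem_Lp_scaleC:
  assumes "mem_Lp p M f"
  shows "mem_Lp p M (\<lambda>x. c *\<^sub>C f x)"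
proof -
  obtain s where s: "\<And>i. simple_function M (s i)" "AE x in M. (\<lambda>i. s i x) \<longlonglongrightarrow> f x"
    using assms by (auto simp: mem_Lp_def strongly_measurable_def)
  have "AE x in M. (\<lambda>i. c *\<^sub>C s i x) \<longlonglongrightarrow> c *\<^sub>C f x"
    using s(2) by eventually_elim (rule scaleC.tendsto[OF tendsto_const])
  moreover have "simple_function M (\<lambda>x. c *\<^sub>C s i x)" for i by (rule simple_function_compose1[OF s(1)])
  ultimately have "strongly_measurable M (\<lambda>x. c *\<^sub>C f x)" 
    unfolding strongly_measurable_def by (intro exI[of _ "\<lambda>i x. c *\<^sub>C s i x"]) simp
  then show ?thesis using assms by (simp add: mem_Lp_def norm_scaleC powr_mult)
qed

lemma bounded_clinear_Lp_add:
  assumes "bounded_clinear_Lp p M L" "mem_Lp p M f" "mem_Lp p M g"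
  shows "L (\<lambda>x. f x + g x) = L f + L g"
  using assms by (simp add: bounded_clinear_Lp_def)

lemma bounded_clinear_Lp_scaleC:
  assumes "bounded_clinear_Lp p M L" "mem_Lp p M f"
  shows "L (\<lambda>x. c *\<^sub>C f x) = c *\<^sub>C L f"
  using assms by (simp add: bounded_clinear_Lp_def)

lemma bounded_clinear_Lp_diff:
  assumes "bounded_clinear_Lp p M L" "mem_Lp p M f" "mem_Lp p M g"
  shows "L (\<lambda>x. f x - g x) = L f - L g"
  using bounded_clinear_Lp_add[OF assms(1,2) mem_Lp_scaleC[OF assms(3), of "-1"]]
    bounded_clinear_Lp_scaleC[OF assms(1,3), of "-1"]
  by (simp add: scaleC.minus_left)

lemma bounded_clinear_Lp_bound:
  assumes "bounded_clinear_Lp p M L"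
  obtains K where "0 \<le> K" "\<And>f. mem_Lp p M f \<Longrightarrow> norm (L f) \<le> K * Lp_norm p M f"
proof -
  obtain C where C: "\<forall>f. mem_Lp p M f \<longrightarrow> norm (L f) \<le> C * Lp_norm p M f"
    using assms by (auto simp: bounded_clinear_Lp_def)
  have "norm (L f) \<le> \<bar>C\<bar> * Lp_norm p M f" if "mem_Lp p M f" for f
    using C that mult_right_mono[of C "\<bar>C\<bar>" "Lp_norm p M f"] by fastforce
  then show thesis by (intro that[of "\<bar>C\<bar>"]) auto
qed

text \<open>
  Linearity holds only on \<open>L\<^sup>p\<close>; continuity of the summands ensures membership.
\<close>

lemma bounded_clinear_Lp_sum:
  fixes L :: "(real \<Rightarrow> 'a::complex_banach) \<Rightarrow> 'b::complex_banach"
  assumes L: "bounded_clinear_Lp p (lebesgue_on {a..b}) L" and p: "1 \<le> p" and "finite I"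
    and f: "\<And>i. i \<in> I \<Longrightarrow> continuous_on UNIV (f i)"
  shows "L (\<lambda>x. \<Sum>i\<in>I. f i x) = (\<Sum>i\<in>I. L (f i))"
  using \<open>finite I\<close> f
proof (induction I)
  case empty
  have "L (\<lambda>x. 0 *\<^sub>C 0) = 0 *\<^sub>C L (\<lambda>x. 0)"
    by (rule bounded_clinear_Lp_scaleC[OF L mem_Lp_continuous[OF continuous_on_const p]])
  then show ?case by (simp add: scaleC.zero_left)
next
  case (insert i I)
  have "L (\<lambda>x. f i x + (\<Sum>i\<in>I. f i x)) = L (f i) + L (\<lambda>x. \<Sum>i\<in>I. f i x)"
    by (intro bounded_clinear_Lp_add[OF L] mem_Lp_continuous p continuous_on_sum insert.prems) auto
  then show ?case using insert by simp
qed

text \<open>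
  On each frequency, translating by \<open>t\<close> is multiplication by \<open>cis (of_int k * t)\<close>, which commutes with \<open>L\<close>.
\<close>

lemma history_trig_poly:
  fixes L :: "(real \<Rightarrow> 'a::complex_banach) \<Rightarrow> 'a"
  assumes L: "bounded_clinear_Lp p (lebesgue_on {a..b}) L" and p: "1 \<le> p" and F: "finite F"
  shows "L (\<lambda>\<theta>. trig_poly F c (t + \<theta>)) = trig_poly F (\<lambda>k. delay_symbol L k (c k)) t"
proof -
  have cont: "continuous_on UNIV (\<lambda>\<theta>. cis (of_int k * \<theta>) *\<^sub>C c k)" for k
    by (intro scaleC.continuous_on continuous_intros)
  have "L (\<lambda>\<theta>. trig_poly F c (t + \<theta>)) = L (\<lambda>\<theta>. \<Sum>k\<in>F. cis (of_int k * t) *\<^sub>C (cis (of_int k * \<theta>) *\<^sub>C c k))"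
    by (simp add: trig_poly_def scaleC_scaleC cis_mult distrib_left)
  also have "\<dots> = (\<Sum>k\<in>F. L (\<lambda>\<theta>. cis (of_int k * t) *\<^sub>C (cis (of_int k * \<theta>) *\<^sub>C c k)))"
    by (intro bounded_clinear_Lp_sum[OF L p F] scaleC.continuous_on continuous_intros)
  also have "\<dots> = (\<Sum>k\<in>F. cis (of_int k * t) *\<^sub>C delay_symbol L k (c k))"
    by (simp add: bounded_clinear_Lp_scaleC[OF L mem_Lp_continuous[OF cont p]] delay_symbol_def)
  finally show ?thesis by (simp add: trig_poly_def)
qed

text \<open>
  The history covers the circle \<open>N\<close> times.
\<close>

lemma history_norm:
  fixes g :: "real \<Rightarrow> 'a::complex_banach"
  assumes p: "1 \<le> p" and g: "continuous_on UNIV g" "\<And>t. g (t + 2 * pi) = g t"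
  shows "Lp_norm p (history_measure N) (\<lambda>\<theta>. g (t + \<theta>)) = real N powr (1 / p) * torus_norm p g"
proof -
  have "integrable torus (\<lambda>t. norm (g t) powr p)"
    by (rule continuous_integrable_powr_Icc[OF continuous_on_subset[OF g(1)] p]) simp
  then have "(LINT \<theta>|history_measure N. norm (g (t + \<theta>)) powr p) = real N * (LINT t|torus. norm (g t) powr p)"
    by (intro lebesgue_integral_history(2)[of "\<lambda>t. norm (g t) powr p"]) (simp_all add: g(2))
  then show ?thesis by (simp add: Lp_norm_def powr_mult integral_nonneg_AE)
qed

lemma torus_norm_bounded:
  assumes "1 \<le> p" "continuous_on {0..2 * pi} g" "\<And>t. norm (g t) \<le> B"
  shows "torus_norm p g \<le> (2 * pi) powr (1 / p) * B"
proof -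
  have B: "0 \<le> B" using assms(3)[of 0] norm_ge_zero order_trans by blast
  have "torus_norm p g \<le> torus_norm p (\<lambda>_. B)"
    by (rule torus_norm_mono[OF assms(1,2)]) (use assms(3) B in auto)
  also have "torus_norm p (\<lambda>_. B) = (2 * pi) powr (1 / p) * B"
    using B assms(1) by (simp add: Lp_norm_def powr_mult powr_powr measure_restrict_space)
  finally show ?thesis .
qed

lemma integral_trig_poly:
  fixes c :: "int \<Rightarrow> 'a::complex_banach"
  assumes F: "finite F"
  shows "((\<lambda>t. cis (- (of_int k * t)) *\<^sub>C trig_poly F c t) has_integral (2 * pi) *\<^sub>R (if k \<in> F then c k else 0)) {0..2 * pi}"
proof -
  have cis: "((\<lambda>t. cis (of_int m * t)) has_integral (if m = 0 then 2 * pi else 0)) {0..2 * pi}" for m :: int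
  proof (cases "m = 0")
    case True
    have "((\<lambda>t. 1 :: complex) has_integral of_real (2 * pi)) {0..2 * pi}"
      using has_integral_const_real[of "1::complex" 0 "2 * pi"] unfolding scaleR_conv_of_real by simp
    moreover have "(\<lambda>t. cis (of_int m * t)) = (\<lambda>t. 1)" using True by (simp add: fun_eq_iff)
    ultimately show ?thesis using True by (simp only: if_True refl)
  next
    case False
    have "((\<lambda>t. 1 / (\<i> * of_int m) * cis (of_int m * t)) has_vector_derivative cis (of_int m * t)) (at t within {0..2 * pi})" for t
    proof -
      have "1 / (\<i> * of_int m) * (\<i> * of_real (of_int m) * z) = z" for z using False by (simp add: field_simps)
      then show ?thesis
        using has_vector_derivative_at_within[OF has_vector_derivative_mult_right[OF has_vector_derivative_cis[of "of_int m" t], of "1 / (\<i> * of_int m)"]]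
        by (simp only:)
    qed
    then have "((\<lambda>t. cis (of_int m * t)) has_integral
      1 / (\<i> * of_int m) * cis (of_int m * (2 * pi)) - 1 / (\<i> * of_int m) * cis (of_int m * 0)) {0..2 * pi}"
      by (intro fundamental_theorem_of_calculus) auto
    moreover have "cis (of_int m * (2 * pi)) = cis (of_int m * 0)"
      using cis_periodic[of m 0] by (simp only: add_0_left)
    ultimately show ?thesis using False by (simp only: diff_self if_False of_real_0)
  qed
  have "((\<lambda>t. \<Sum>l\<in>F. cis (of_int (l - k) * t) *\<^sub>C c l) has_integral
     (\<Sum>l\<in>F. (if l - k = 0 then 2 * pi else 0) *\<^sub>C c l)) {0..2 * pi}"
  proof (rule has_integral_sum[OF F])
    fix l
    show "((\<lambda>t. cis (of_int (l - k) * t) *\<^sub>C c l) has_integral (if l - k = 0 then 2 * pi else 0) *\<^sub>C c l) {0..2 * pi}"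
      using has_integral_linear[OF cis[of "l - k"] scaleC.bounded_linear_left[of "c l"]] by (simp add: o_def)
  qed
  moreover have "(\<lambda>t. \<Sum>l\<in>F. cis (of_int (l - k) * t) *\<^sub>C c l) = (\<lambda>t. cis (- (of_int k * t)) *\<^sub>C trig_poly F c t)"
    by (rule ext) (simp add: trig_poly_def scaleC.sum_right scaleC_scaleC cis_mult left_diff_distrib)
  moreover have "(\<Sum>l\<in>F. (if l - k = 0 then 2 * pi else 0) *\<^sub>C c l) = (2 * pi) *\<^sub>R (if k \<in> F then c k else 0)"
  proof -
    have "(\<Sum>l\<in>F. (if l - k = 0 then 2 * pi else 0) *\<^sub>C c l) = (\<Sum>l\<in>F. if l = k then (2 * pi) *\<^sub>R c k else 0)"
      by (intro sum.cong refl) (simp add: scaleR_scaleC scaleC.zero_left)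
    then show ?thesis using F by simp
  qed
  ultimately show ?thesis by simp
qed

context periodic_Lp_series
begin

text \<open>
  The error of the partial sums is uniform in \<open>t\<close>, since the \<open>L\<^sup>p\<close> norm of the tail over the history does not depend
  on \<open>t\<close>.
\<close>

lemma history_operator:
  assumes L: "bounded_clinear_Lp p (history_measure N) L"
  shows "\<exists>K\<ge>0. \<forall>t J. norm (L (\<lambda>\<theta>. total (t + \<theta>)) - (\<Sum>j<J. L (\<lambda>\<theta>. P j (t + \<theta>)))) \<le> K * tail_norm J"
proof -
  obtain K where K: "0 \<le> K" "\<And>f. mem_Lp p (history_measure N) f \<Longrightarrow> norm (L f) \<le> K * Lp_norm p (history_measure N) f"
    using bounded_clinear_Lp_bound[OF L] by blast
  have "norm (L (\<lambda>\<theta>. total (t + \<theta>)) - (\<Sum>j<J. L (\<lambda>\<theta>. P j (t + \<theta>)))) \<le> K * real N powr (1 / p) * tail_norm J" for t J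
  proof -
    let ?S = "\<lambda>\<theta>. \<Sum>j<J. P j (t + \<theta>)"
    let ?d = "\<lambda>\<theta>. total (t + \<theta>) - ?S \<theta>"
    have Pc: "continuous_on UNIV (\<lambda>\<theta>. P j (t + \<theta>))" for j
      by (intro continuous_on_compose2[OF cont] continuous_intros) auto
    have S: "mem_Lp p (history_measure N) ?S"
      by (intro mem_Lp_continuous continuous_on_sum Pc p)
    have ae: "AE \<theta> in history_measure N. norm (?d \<theta>) \<le> tail J (t + \<theta>)"
      by (rule AE_lebesgue_on_shift[OF negligible_exceptional]) (use norm_total_minus_partial in auto)
    have sm: "strongly_measurable (history_measure N) ?d"
      using history_mem_Lp[of N t] S by (intro strongly_measurable_diff) (auto simp: mem_Lp_def)
    have dm: "(\<lambda>\<theta>. norm (?d \<theta>) powr p) \<in> borel_measurable (history_measure N)"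
      using strongly_measurable_norm[OF sm] by simp
    have le: "AE \<theta> in history_measure N. norm (?d \<theta>) powr p \<le> tail J (t + \<theta>) powr p"
      using ae by eventually_elim (use p in \<open>auto intro: powr_mono2\<close>)
    have di: "integrable (history_measure N) (\<lambda>\<theta>. norm (?d \<theta>) powr p)"
      by (rule Bochner_Integration.integrable_bound[OF history_tail(1)[of N J t] dm]) (use le in simp)
    have "(LINT \<theta>|history_measure N. norm (?d \<theta>) powr p) \<le> (LINT \<theta>|history_measure N. tail J (t + \<theta>) powr p)"
      by (rule integral_mono_AE[OF di history_tail(1) le])
    also have "\<dots> \<le> real N * tail_norm J powr p" by (rule history_tail(2))
    also have "\<dots> = (real N powr (1 / p) * tail_norm J) powr p"
      using p tail_norm_nonneg[of J] by (simp add: powr_mult powr_powr)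
    finally have "Lp_norm p (history_measure N) ?d \<le> real N powr (1 / p) * tail_norm J"
      using p tail_norm_nonneg[of J] by (subst Lp_norm_le_iff) auto
    moreover have "norm (L ?d) \<le> K * Lp_norm p (history_measure N) ?d"
      by (rule K(2)) (use sm di in \<open>simp add: mem_Lp_def\<close>)
    ultimately have "norm (L ?d) \<le> K * (real N powr (1 / p) * tail_norm J)"
      using K(1) by (meson mult_left_mono order_trans)
    moreover have "L ?d = L (\<lambda>\<theta>. total (t + \<theta>)) - (\<Sum>j<J. L (\<lambda>\<theta>. P j (t + \<theta>)))"
      using bounded_clinear_Lp_diff[OF L history_mem_Lp[of N t] S]
        bounded_clinear_Lp_sum[OF L p, of "{..<J}" "\<lambda>j \<theta>. P j (t + \<theta>)"] Pc by simp
    ultimately show ?thesis by (simp add: mult.assoc)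
  qed
  then show ?thesis using K(1) by (intro exI[of _ "K * real N powr (1 / p)"]) simp
qed

lemma history_operator_sums:
  assumes L: "bounded_clinear_Lp p (history_measure N) L"
  shows "(\<lambda>j. L (\<lambda>\<theta>. P j (t + \<theta>))) sums L (\<lambda>\<theta>. total (t + \<theta>))"
proof -
  obtain K where "\<And>t J. norm (L (\<lambda>\<theta>. total (t + \<theta>)) - (\<Sum>j<J. L (\<lambda>\<theta>. P j (t + \<theta>)))) \<le> K * tail_norm J"
    using history_operator[OF L] by blast
  then have "(\<lambda>J. (\<Sum>j<J. L (\<lambda>\<theta>. P j (t + \<theta>))) - L (\<lambda>\<theta>. total (t + \<theta>))) \<longlonglongrightarrow> 0"
    by (intro Lim_null_comparison[OF _ tendsto_mult_right_zero[OF tail_norm_tendsto_0]] always_eventually allI)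
      (simp add: norm_minus_commute)
  then show ?thesis unfolding sums_def by (rule LIM_zero_cancel)
qed

lemma total_represents:
  "represents total (function_distribution total)" "function_distribution total \<in> distributions"
  by (rule function_distribution[OF total_periodic total_mem_L1];
      use has_integral_total[OF continuous_on_test] in \<open>blast intro: has_integral_integrable\<close>)+

lemma fourier_coeff_total:
  assumes P: "\<And>j. P j = trig_poly (F j) (c j)" "\<And>j. finite (F j)"
  shows "(\<lambda>j. if k \<in> F j then c j k else 0) sums fourier_coeff (function_distribution total) k"
proof -
  have cis: "(\<lambda>t. cis (- (of_int k * t))) \<in> test_functions"
    using test_functions_cis[of "- k"] by simp
  obtain I where I: "((\<lambda>t. cis (- (of_int k * t)) *\<^sub>C total t) has_integral I) {0..2 * pi}"
    "(\<lambda>j. integral {0..2 * pi} (\<lambda>t. cis (- (of_int k * t)) *\<^sub>C P j t)) sums I"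
    using has_integral_total[OF continuous_on_test[OF cis]] by blast
  have "function_distribution total (\<lambda>t. cis (- (of_int k * t))) = I"
    using cis integral_unique[OF I(1)] by (simp add: function_distribution_def)
  then have eq: "fourier_coeff (function_distribution total) k = (1 / (2 * pi)) *\<^sub>R I" by (simp add: fourier_coeff_def)
  have "integral {0..2 * pi} (\<lambda>t. cis (- (of_int k * t)) *\<^sub>C P j t) = (2 * pi) *\<^sub>R (if k \<in> F j then c j k else 0)" for j
    unfolding P(1) by (rule integral_unique[OF integral_trig_poly[OF P(2)]])
  with sums_scaleR_right[OF I(2), of "1 / (2 * pi)"] show ?thesis unfolding eq by simp
qed

end

section \<open>Dyadic blocks\<close>

lemma bounded_clinear_trig_poly:
  assumes "bounded_clinear T" "finite F"
  shows "T (trig_poly F c t) = trig_poly F (\<lambda>k. T (c k)) t"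
  using assms by (simp add: trig_poly_def bounded_clinear_def linear_sum bounded_linear.linear)

definition spectrum :: "(nat \<Rightarrow> real \<Rightarrow> complex) \<Rightarrow> nat \<Rightarrow> int set" where
  "spectrum \<phi> j = {k. \<phi> j (of_int k) \<noteq> 0}"

lemma besov_block_eq:
  "besov_block \<phi> u j = trig_poly (spectrum \<phi> j) (\<lambda>k. \<phi> j (of_int k) *\<^sub>C fourier_coeff u k)"
  by (rule ext) (simp add: besov_block_def trig_poly_def spectrum_def)

lemma spectrum_bounds:
  assumes "dyadic_resolution \<phi>" "k \<in> spectrum \<phi> j"
  shows "\<bar>k\<bar> \<le> 2 ^ (j + 1)" and "j \<ge> 1 \<Longrightarrow> 2 ^ (j - 1) \<le> \<bar>k\<bar>"
proof -
  have "of_int k \<in> closure {x. \<phi> j x \<noteq> 0}"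
    using assms(2) closure_subset[of "{x. \<phi> j x \<noteq> 0}"] by (auto simp: spectrum_def)
  then have cl: "of_int k \<in> closure (dyadic_set j)"
    using assms(1) by (auto simp: dyadic_resolution_def)
  have closed: "closed {t. \<bar>t\<bar> \<le> (a::real)}" "closed {t. a \<le> \<bar>t\<bar>}" for a :: real
    by (intro closed_Collect_le continuous_intros)+
  have "dyadic_set j \<subseteq> {t. \<bar>t\<bar> \<le> 2 ^ (j + 1)}" by (auto simp: dyadic_set_def)
  from closure_minimal[OF this closed(1)] cl have "\<bar>real_of_int k\<bar> \<le> 2 ^ (j + 1)" by blast
  then have "real_of_int \<bar>k\<bar> \<le> real_of_int (2 ^ (j + 1))" by simp
  then show "\<bar>k\<bar> \<le> 2 ^ (j + 1)" by (simp only: of_int_le_iff)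
  show "2 ^ (j - 1) \<le> \<bar>k\<bar>" if "j \<ge> 1"
  proof -
    have "dyadic_set j \<subseteq> {t. 2 ^ (j - 1) \<le> \<bar>t\<bar>}" using that by (auto simp: dyadic_set_def)
    from closure_minimal[OF this closed(2)] cl have "2 ^ (j - 1) \<le> \<bar>real_of_int k\<bar>" by blast
    then have "real_of_int (2 ^ (j - 1)) \<le> real_of_int \<bar>k\<bar>" by simp
    then show ?thesis by (simp only: of_int_le_iff)
  qed
qed

lemma finite_spectrum: 
  assumes "dyadic_resolution \<phi>"
  shows "finite (spectrum \<phi> j)"
proof (rule finite_subset)
  show "spectrum \<phi> j \<subseteq> {- (2 ^ (j + 1))..2 ^ (j + 1)}"
    using spectrum_bounds(1)[OF assms] by (auto simp: abs_le_iff) (metis minus_le_iff)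
qed simp

text \<open>
  Positive smoothness makes the norms of the blocks decay geometrically.
\<close>

lemma besov_blocks_summable:
  assumes "0 < s" "1 \<le> q" "u \<in> besov \<phi> s p q"
  shows "summable (\<lambda>j. torus_norm p (besov_block \<phi> u j))"
proof -
  let ?N = "\<lambda>j. torus_norm p (besov_block \<phi> u j)"
  have "summable (\<lambda>j. 2 powr (s * real j * q) * ?N j powr q)"
    using assms(3) by (simp add: besov_def)
  then have "Bseq (\<lambda>j. 2 powr (s * real j * q) * ?N j powr q)"
    by (intro convergent_imp_Bseq convergentI[OF summable_LIMSEQ_zero])
  then obtain B where B: "B > 0" "\<And>j. norm (2 powr (s * real j * q) * ?N j powr q) \<le> B"
    by (auto simp: Bseq_def)
  have "?N j \<le> B powr (1 / q) * (2 powr (- s)) ^ j" for j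
  proof -
    have "(2 powr (s * real j) * ?N j) powr q \<le> B"
      using B(2)[of j] by (simp add: powr_mult powr_powr)
    then have "((2 powr (s * real j) * ?N j) powr q) powr (1 / q) \<le> B powr (1 / q)"
      using assms(2) by (intro powr_mono2) auto
    then have "2 powr (s * real j) * ?N j \<le> B powr (1 / q)"
      using assms(2) by (simp add: powr_powr)
    then have "2 powr (- (s * real j)) * (2 powr (s * real j) * ?N j) \<le> 2 powr (- (s * real j)) * B powr (1 / q)"
      by (intro mult_left_mono) auto
    moreover have "2 powr (- (s * real j)) * (2 powr (s * real j) * ?N j) = ?N j"
      by (simp add: mult.assoc[symmetric] powr_add[symmetric])
    moreover have "2 powr (- (s * real j)) = (2 powr (- s)) ^ j"
      by (simp add: powr_realpow[symmetric] powr_powr)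
    ultimately show ?thesis by (metis mult.commute)
  qed
  moreover have "summable (\<lambda>j. B powr (1 / q) * (2 powr (- s)) ^ j)"
    using assms(1) by (intro summable_mult summable_geometric) (simp add: powr_less_one)
  ultimately show ?thesis
    by - (rule summable_comparison_test'[of "\<lambda>j. B powr (1 / q) * (2 powr (- s)) ^ j" 0, OF _]; simp)
qed

lemma besov_series:
  assumes "1 \<le> p" "0 < s" "1 \<le> q" "u \<in> besov \<phi> s p q"
  shows "periodic_Lp_series p (besov_block \<phi> u)"
  by unfold_locales
    (use assms besov_blocks_summable in \<open>auto simp: besov_block_eq intro: continuous_on_trig_poly\<close>)

lemma sums_resolution:
  assumes "dyadic_resolution \<phi>"
  shows "(\<lambda>j. if k \<in> spectrum \<phi> j then \<phi> j (of_int k) *\<^sub>C x else 0) sums x"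
proof -
  have "(\<lambda>j. \<phi> j (of_int k) *\<^sub>C x) sums (1 *\<^sub>C x)"
    using assms by (intro bounded_linear.sums[OF scaleC.bounded_linear_left]) (simp add: dyadic_resolution_def)
  moreover have "(\<lambda>j. \<phi> j (of_int k) *\<^sub>C x) = (\<lambda>j. if k \<in> spectrum \<phi> j then \<phi> j (of_int k) *\<^sub>C x else 0)"
    by (auto simp: spectrum_def scaleC.zero_left fun_eq_iff)
  ultimately show ?thesis by simp
qed

text \<open>
  A resolution of the identity adds the coefficients of the blocks up to those of \<open>u\<close>.
\<close>

lemma besov_represented_by_series:
  assumes "1 \<le> p" "0 < s" "1 \<le> q" "dyadic_resolution \<phi>" and u: "u \<in> besov \<phi> s p q"
  shows "represents (periodic_Lp_series.total (besov_block \<phi> u)) u"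
proof -
  interpret u: periodic_Lp_series p "besov_block \<phi> u" by (rule besov_series[OF assms(1-3) u])
  have "function_distribution u.total = u"
  proof (rule distributions_eq_iff_fourier_coeff[OF u.total_represents(2)])
    show "u \<in> distributions" using u by (simp add: besov_def)
    show "fourier_coeff (function_distribution u.total) k = fourier_coeff u k" for k
      by (rule sums_unique2[OF u.fourier_coeff_total[OF besov_block_eq finite_spectrum[OF assms(4)]] sums_resolution[OF assms(4)]])
  qed
  with u.total_represents(1) show ?thesis by simp
qed

section \<open>The characteristic operators\<close>

locale delay_equation =
  fixes p q s :: real and n N :: nat
    and \<phi> :: "nat \<Rightarrow> real \<Rightarrow> complex"
    and D :: "'a::complex_banach set" and A :: "'a \<Rightarrow> 'a"
    and L :: "(real \<Rightarrow> 'a) \<Rightarrow> 'a"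
  assumes p: "1 \<le> p" and q: "1 \<le> q" and s: "s > 0" and n: "n \<ge> 1"
    and \<phi>: "dyadic_resolution \<phi>"
    and A_linear: "clinear_on D A" and A_closed: "closed_operator D A" and A_bounded: "bounded_operator D A"
    and L: "bounded_clinear_Lp p (history_measure N) L"
    and M_bounded: "M_bounded (delay_symbol L)"
    and bij: "\<And>k. bij_betw (char_operator n A L k) D UNIV"
    and inv_clinear: "\<And>k. bounded_clinear (inv_into D (char_operator n A L k))"
    and inv_bdd: "bdd_above (range (\<lambda>k::int.
           onorm (\<lambda>x. (\<i> * of_int k) ^ n *\<^sub>C inv_into D (char_operator n A L k) x)))"
begin

abbreviation resolvent :: "int \<Rightarrow> 'a \<Rightarrow> 'a" where
  "resolvent k \<equiv> inv_into D (char_operator n A L k)"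

abbreviation Lk :: "int \<Rightarrow> 'a \<Rightarrow> 'a" where
  "Lk \<equiv> delay_symbol L"

abbreviation symbol :: "int \<Rightarrow> complex" where
  "symbol k \<equiv> \<Sum>j=1..n. (\<i> * of_int k) ^ j"

lemma char_resolvent: "char_operator n A L k (resolvent k y) = y" "resolvent k y \<in> D"
  using bij[of k] by (auto simp: bij_betw_def f_inv_into_f inv_into_into)

lemma Lk_bound: obtains K where "0 \<le> K" "\<And>k x. norm (Lk k x) \<le> K * norm x"
proof -
  obtain K where K: "\<And>k. onorm (Lk k) \<le> K"
    using M_bounded by (auto simp: M_bounded_def bdd_above_def)
  have lin: "bounded_linear (Lk k)" for k using M_bounded by (auto simp: M_bounded_def bounded_clinear_def)
  have "norm (Lk k x) \<le> K * norm x" for k x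
    by (rule order_trans[OF onorm[OF lin] mult_right_mono[OF K]]) simp
  moreover have "0 \<le> K" using onorm_pos_le[OF lin] K order_trans by blast
  ultimately show thesis using that by blast
qed

lemma resolvent_bound: obtains K where "0 \<le> K" "\<And>k x. \<bar>of_int k\<bar> ^ n * norm (resolvent k x) \<le> K * norm x"
proof -
  obtain K where K: "\<And>k. onorm (\<lambda>x. (\<i> * of_int k) ^ n *\<^sub>C resolvent k x) \<le> K"
    using inv_bdd by (auto simp: bdd_above_def)
  have lin: "bounded_linear (\<lambda>x. (\<i> * of_int k) ^ n *\<^sub>C resolvent k x)" for k
    using inv_clinear[of k] by (intro bounded_linear_compose[OF scaleC.bounded_linear_right]) (simp add: bounded_clinear_def)
  have "\<bar>of_int k\<bar> ^ n * norm (resolvent k x) \<le> K * norm x" for k x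
  proof -
    have "\<bar>of_int k\<bar> ^ n * norm (resolvent k x) = norm ((\<i> * of_int k) ^ n *\<^sub>C resolvent k x)"
      by (simp add: norm_scaleC norm_power norm_mult)
    also have "\<dots> \<le> K * norm x"
      by (rule order_trans[OF onorm[OF lin] mult_right_mono[OF K]]) simp
    finally show ?thesis .
  qed
  moreover have "0 \<le> K" using onorm_pos_le[OF lin] K order_trans by blast
  ultimately show thesis using that by blast
qed

lemma D_diff: "x \<in> D \<Longrightarrow> y \<in> D \<Longrightarrow> x - y \<in> D \<and> A (x - y) = A x - A y"
proof -
  assume xy: "x \<in> D" "y \<in> D"
  have "(-1) *\<^sub>C y \<in> D" "A ((-1) *\<^sub>C y) = (-1) *\<^sub>C A y" using A_linear xy by (auto simp: clinear_on_def)
  then have "x + (-1) *\<^sub>C y \<in> D" "A (x + (-1) *\<^sub>C y) = A x + (-1) *\<^sub>C A y"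
    using A_linear xy unfolding clinear_on_def by metis+
  then show ?thesis by (simp add: scaleC.minus_left)
qed

lemma A_bound: obtains K where "0 \<le> K" "\<And>x. x \<in> D \<Longrightarrow> norm (A x) \<le> K * norm x"
proof -
  obtain C where C: "\<forall>x\<in>D. norm (A x) \<le> C * norm x" using A_bounded by (auto simp: bounded_operator_def)
  have "norm (A x) \<le> \<bar>C\<bar> * norm x" if "x \<in> D" for x
    using C that mult_right_mono[of C "\<bar>C\<bar>" "norm x"] by fastforce
  then show thesis by (intro that[of "\<bar>C\<bar>"]) auto
qed

text \<open>
  The graph of \<open>A\<close> is closed, and by boundedness convergence in \<open>D\<close> entails convergence of the images.
\<close>

lemma closed_D: "closed D"
  unfolding closed_sequential_limits
proof (intro allI impI, elim conjE)
  fix x l assume x: "\<forall>m. x m \<in> D" and lim: "x \<longlonglongrightarrow> l"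
  obtain K where K: "0 \<le> K" "\<And>x. x \<in> D \<Longrightarrow> norm (A x) \<le> K * norm x" using A_bound by blast
  have "Cauchy (\<lambda>m. A (x m))"
  proof (rule metric_CauchyI)
    fix e :: real assume e: "e > 0"
    then have "e / (K + 1) > 0" using K(1) by simp
    with LIMSEQ_imp_Cauchy[OF lim] obtain M where M: "\<And>i j. i \<ge> M \<Longrightarrow> j \<ge> M \<Longrightarrow> dist (x i) (x j) < e / (K + 1)"
      unfolding Cauchy_def by blast
    have "dist (A (x i)) (A (x j)) < e" if "i \<ge> M" "j \<ge> M" for i j
    proof -
      have "dist (A (x i)) (A (x j)) = norm (A (x i - x j))" using D_diff[of "x i" "x j"] x by (simp add: dist_norm)
      also have "\<dots> \<le> K * norm (x i - x j)" using K(2) D_diff x by blast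
      also have "\<dots> \<le> K * (e / (K + 1))"
        using M[OF that] K(1) by (intro mult_left_mono) (auto simp: dist_norm)
      also have "\<dots> < e" using e K(1) by (simp add: field_simps)
      finally show ?thesis .
    qed
    then show "\<exists>M. \<forall>i\<ge>M. \<forall>j\<ge>M. dist (A (x i)) (A (x j)) < e" by blast
  qed
  then obtain z where "(\<lambda>m. A (x m)) \<longlonglongrightarrow> z" using Cauchy_convergent_iff convergent_def by blast
  with lim have conv: "(\<lambda>m. (x m, A (x m))) \<longlonglongrightarrow> (l, z)" by (rule tendsto_Pair)
  have "(x m, A (x m)) \<in> (\<lambda>x. (x, A x)) ` D" for m using x by blast
  from closed_sequentially[OF A_closed[unfolded closed_operator_def] this conv]
  have "(l, z) \<in> (\<lambda>x. (x, A x)) ` D" .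
  then show "l \<in> D" by auto
qed

text \<open>
  A vector \<open>y\<close> outside the closed subspace \<open>D\<close> has positive distance from it. But \<open>y\<close> is nearly the multiple
  \<open>symbol k\<close> of \<open>resolvent k y\<close>, an element of \<open>D\<close>, when \<open>k\<close> is large.
\<close>

lemma D_UNIV: "D = UNIV"
proof (rule ccontr)
  assume "D \<noteq> UNIV"
  then obtain y where y: "y \<notin> D" by blast
  have "0 \<in> D" using A_linear by (simp add: clinear_on_def)
  then have d: "infdist y D > 0"
    using y in_closed_iff_infdist_zero[OF closed_D, of y] infdist_nonneg[of y D] by (auto simp: less_le)
  obtain KA where KA: "0 \<le> KA" "\<And>x. x \<in> D \<Longrightarrow> norm (A x) \<le> KA * norm x" using A_bound by blast
  obtain KL where KL: "0 \<le> KL" "\<And>k x. norm (Lk k x) \<le> KL * norm x" using Lk_bound by blast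
  obtain KR where KR: "0 \<le> KR" "\<And>k x. \<bar>of_int k\<bar> ^ n * norm (resolvent k x) \<le> KR * norm x" using resolvent_bound by blast
  \<comment> \<open>If \<open>x = R\<^sub>k y\<close> then \<open>b\<^sub>k x - y = A x + L\<^sub>k x\<close>. The left hand side has norm at least \<open>infdist y D\<close>, while the
    right hand side is \<open>O(\<bar>k\<bar>\<^sup>-\<^sup>n)\<close>.\<close>
  obtain m where m: "(KA + KL) * (KR * norm y) < real m * infdist y D"
    using reals_Archimedean3[OF d] by blast
  define k where "k = int (Suc m)"
  define x where "x = resolvent k y"
  have x: "x \<in> D" and y_eq: "y = symbol k *\<^sub>C x - A x - Lk k x"
    using char_resolvent[of k y] by (auto simp: x_def char_operator_def)
  have "symbol k *\<^sub>C x \<in> D" using A_linear x by (auto simp: clinear_on_def)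
  then have "infdist y D \<le> dist y (symbol k *\<^sub>C x)" by (rule infdist_le)
  also have "\<dots> = norm (A x + Lk k x)"
  proof -
    have "symbol k *\<^sub>C x - y = A x + Lk k x" by (subst y_eq) simp
    then show ?thesis by (metis dist_norm dist_commute)
  qed
  also have "\<dots> \<le> (KA + KL) * norm x"
    using norm_triangle_ineq[of "A x" "Lk k x"] KA(2)[OF x] KL(2)[of k x] by (simp add: distrib_right)
  finally have "real m * infdist y D \<le> real m * ((KA + KL) * norm x)" by (rule mult_left_mono) simp
  also have "\<dots> = (KA + KL) * (real m * norm x)" by simp
  also have "\<dots> \<le> (KA + KL) * (KR * norm y)"
  proof (intro mult_left_mono)
    have "real m \<le> \<bar>of_int k\<bar> ^ 1" by (simp add: k_def)
    also have "\<dots> \<le> \<bar>of_int k\<bar> ^ n" using n by (intro power_increasing) (auto simp: k_def)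
    finally have "real m * norm x \<le> \<bar>of_int k\<bar> ^ n * norm x" by (intro mult_right_mono) auto
    also have "\<dots> \<le> KR * norm y" unfolding x_def by (rule KR(2))
    finally show "real m * norm x \<le> KR * norm y" .
  qed (use KA(1) KL(1) in simp)
  finally show False using m by simp
qed

lemma A_bounded_clinear: "bounded_clinear A"
proof -
  obtain K where K: "0 \<le> K" "\<And>x. norm (A x) \<le> K * norm x" using A_bound D_UNIV by (metis UNIV_I)
  have add: "A (x + y) = A x + A y" for x y using A_linear D_UNIV by (auto simp: clinear_on_def)
  have sc: "A (c *\<^sub>C x) = c *\<^sub>C A x" for c x using A_linear D_UNIV by (auto simp: clinear_on_def)
  have "bounded_linear A"
    by (rule bounded_linear_intro[where K = K]) (use K(2) add sc in \<open>simp_all add: scaleR_scaleC mult.commute\<close>)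
  with sc show ?thesis by (simp add: bounded_clinear_def)
qed

lemma resolvent_unique: "char_operator n A L k x = y \<Longrightarrow> x = resolvent k y"
  using bij[of k] D_UNIV by (metis UNIV_I bij_betw_inv_into_left)

lemma Lk_clinear: "bounded_clinear (Lk k)"
  using M_bounded by (simp add: M_bounded_def)

end

section \<open>The estimate on a dyadic block\<close>

lemma torus_norm_sum:
  fixes f :: "'i \<Rightarrow> real \<Rightarrow> 'b::real_normed_vector"
  assumes p: "1 \<le> p" and "finite I" "\<And>i. i \<in> I \<Longrightarrow> continuous_on {0..2 * pi} (f i)"
  shows "torus_norm p (\<lambda>t. \<Sum>i\<in>I. f i t) \<le> (\<Sum>i\<in>I. torus_norm p (f i))"
proof -
  have m: "(\<lambda>t. norm (f i t)) \<in> borel_measurable torus" "integrable torus (\<lambda>t. norm (f i t) powr p)" if "i \<in> I" for i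
    using continuous_measurable_on_Icc[OF assms(3)[OF that]] continuous_integrable_powr_Icc[OF assms(3)[OF that] p] by auto
  have "torus_norm p (\<lambda>t. \<Sum>i\<in>I. f i t) \<le> torus_norm p (\<lambda>t. \<Sum>i\<in>I. norm (f i t))"
    by (rule torus_norm_mono[OF p])
      (auto intro!: continuous_on_sum continuous_on_norm assms(3) norm_sum simp: abs_of_nonneg sum_nonneg)
  then show ?thesis using Lp_norm_sum[OF p m \<open>finite I\<close>] by fastforce
qed

context delay_equation
begin

definition solution_coeff :: "((real \<Rightarrow> complex) \<Rightarrow> 'a) \<Rightarrow> nat \<Rightarrow> int \<Rightarrow> 'a" where
  "solution_coeff f j k = \<phi> j (of_int k) *\<^sub>C resolvent k (fourier_coeff f k)"

text \<open>
  The \<open>l\<close>-th derivative of the \<open>j\<close>-th block of the prospective solution.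
\<close>

definition solution_block :: "((real \<Rightarrow> complex) \<Rightarrow> 'a) \<Rightarrow> nat \<Rightarrow> nat \<Rightarrow> real \<Rightarrow> 'a" where
  "solution_block f l j = trig_poly (spectrum \<phi> j) (\<lambda>k. (\<i> * of_int k) ^ l *\<^sub>C solution_coeff f j k)"

lemma continuous_solution_block: "continuous_on T (solution_block f l j)"
  unfolding solution_block_def by (rule continuous_on_trig_poly)

lemma solution_block_periodic: "solution_block f l j (t + 2 * pi) = solution_block f l j t"
  unfolding solution_block_def by (rule trig_poly_periodic)

lemma solution_block_0: "solution_block f 0 j = trig_poly (spectrum \<phi> j) (solution_coeff f j)"
  by (simp add: solution_block_def)

lemma solution_coeff_equation: "symbol k *\<^sub>C solution_coeff f j k = A (solution_coeff f j k) + Lk k (solution_coeff f j k) + \<phi> j (of_int k) *\<^sub>C fourier_coeff f k"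
proof -
  let ?r = "resolvent k (fourier_coeff f k)" and ?z = "\<phi> j (of_int k)"
  have "symbol k *\<^sub>C ?r - A ?r - Lk k ?r = fourier_coeff f k"
    using char_resolvent(1)[of k "fourier_coeff f k"] by (simp add: char_operator_def)
  then have "?z *\<^sub>C (symbol k *\<^sub>C ?r - A ?r - Lk k ?r) = ?z *\<^sub>C fourier_coeff f k" by simp
  moreover have "A (?z *\<^sub>C ?r) = ?z *\<^sub>C A ?r" "Lk k (?z *\<^sub>C ?r) = ?z *\<^sub>C Lk k ?r"
    using A_bounded_clinear Lk_clinear[of k] by (simp_all add: bounded_clinear_def)
  moreover have "?z *\<^sub>C symbol k *\<^sub>C ?r = symbol k *\<^sub>C ?z *\<^sub>C ?r" by (simp only: scaleC_scaleC mult.commute)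
  ultimately show ?thesis
    by (simp only: solution_coeff_def scaleC.diff_right) (simp add: algebra_simps)
qed

lemma solution_block_equation:
  "(\<Sum>l=1..n. solution_block f l j t) = A (solution_block f 0 j t) + L (\<lambda>\<theta>. solution_block f 0 j (t + \<theta>)) + besov_block \<phi> f j t"
proof -
  note fin = finite_spectrum[OF \<phi>, of j]
  have "(\<Sum>l=1..n. solution_block f l j t) = trig_poly (spectrum \<phi> j) (\<lambda>k. \<Sum>l=1..n. (\<i> * of_int k) ^ l *\<^sub>C solution_coeff f j k) t"
    unfolding solution_block_def trig_poly_sum ..
  also have "\<dots> = trig_poly (spectrum \<phi> j) (\<lambda>k. A (solution_coeff f j k) + Lk k (solution_coeff f j k) + \<phi> j (of_int k) *\<^sub>C fourier_coeff f k) t"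
    by (rule trig_poly_cong) (simp only: scaleC.sum_left[symmetric] solution_coeff_equation)
  finally show ?thesis
    unfolding trig_poly_add solution_block_0 besov_block_eq history_trig_poly[OF L p fin]
      bounded_clinear_trig_poly[OF A_bounded_clinear fin] .
qed

text \<open>
  The constant does not depend on the block: \<open>A\<close> acts pointwise, and the delay operator is bounded from \<open>L\<^sup>p\<close> to the
  bounded functions.
\<close>

lemma lower_order_bound:
  obtains K where "0 \<le> K" "\<And>j f. torus_norm p (\<lambda>t. A (solution_block f 0 j t) + L (\<lambda>\<theta>. solution_block f 0 j (t + \<theta>))) \<le> K * torus_norm p (solution_block f 0 j)"
proof -
  obtain KA where KA: "0 \<le> KA" "\<And>x. norm (A x) \<le> KA * norm x" using A_bound D_UNIV by (metis UNIV_I)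
  obtain KL where KL: "0 \<le> KL" "\<And>g. mem_Lp p (history_measure N) g \<Longrightarrow> norm (L g) \<le> KL * Lp_norm p (history_measure N) g"
    using bounded_clinear_Lp_bound[OF L] by blast
  define KL' where "KL' = (2 * pi) powr (1 / p) * (KL * real N powr (1 / p))"
  have "torus_norm p (\<lambda>t. A (solution_block f 0 j t) + L (\<lambda>\<theta>. solution_block f 0 j (t + \<theta>))) \<le> (KA + KL') * torus_norm p (solution_block f 0 j)" for f j
  proof -
    note fin = finite_spectrum[OF \<phi>, of j]
    let ?x = "solution_block f 0 j"
    let ?Lx = "\<lambda>t. L (\<lambda>\<theta>. ?x (t + \<theta>))"
    have cA: "continuous_on {0..2 * pi} (\<lambda>t. A (?x t))"
      unfolding solution_block_0 bounded_clinear_trig_poly[OF A_bounded_clinear fin] by (rule continuous_on_trig_poly)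
    have cL: "continuous_on {0..2 * pi} ?Lx"
      unfolding solution_block_0 history_trig_poly[OF L p fin] by (rule continuous_on_trig_poly)
    have "torus_norm p (\<lambda>t. A (?x t)) \<le> torus_norm p (\<lambda>t. KA *\<^sub>R ?x t)"
      by (rule torus_norm_mono[OF p cA]) (use KA in \<open>auto intro!: continuous_intros continuous_solution_block\<close>)
    also have "\<dots> = KA * torus_norm p ?x" by (rule torus_norm_scale[OF _ KA(1) p]) (use KA(1) in simp)
    finally have 1: "torus_norm p (\<lambda>t. A (?x t)) \<le> KA * torus_norm p ?x" .
    have "norm (?Lx t) \<le> KL * (real N powr (1 / p) * torus_norm p ?x)" for t
    proof -
      have "continuous_on UNIV (\<lambda>\<theta>. ?x (t + \<theta>))"
        by (intro continuous_on_compose2[OF continuous_solution_block[of UNIV]] continuous_intros) auto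
      from KL(2)[OF mem_Lp_continuous[OF this p]]
      show ?thesis by (simp add: history_norm[OF p continuous_solution_block solution_block_periodic])
    qed
    then have "torus_norm p ?Lx \<le> (2 * pi) powr (1 / p) * (KL * (real N powr (1 / p) * torus_norm p ?x))"
      by (rule torus_norm_bounded[OF p cL])
    then have 2: "torus_norm p ?Lx \<le> KL' * torus_norm p ?x" by (simp add: KL'_def mult.assoc)
    have "torus_norm p (\<lambda>t. A (?x t) + ?Lx t) \<le> torus_norm p (\<lambda>t. A (?x t)) + torus_norm p ?Lx"
      by (rule torus_norm_triangle[OF p cA cL])
    then show ?thesis using 1 2 by (simp add: distrib_right)
  qed
  moreover have "0 \<le> KA + KL'" using KA(1) KL(1) by (simp add: KL'_def)
  ultimately show thesis using that by blast
qed

text \<open>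
  The equation of the block expresses its highest derivative by \<open>f\<close> and by terms which are, up to a fixed
  constant, at most \<open>12 / 2 ^ j\<close> times as large as that derivative. For large \<open>j\<close> they amount to at most half of
  it and are absorbed.
\<close>

lemma solution_block_estimate:
  obtains j0 where "\<And>f j l. j \<ge> j0 \<Longrightarrow> l \<le> n \<Longrightarrow>
    torus_norm p (solution_block f l j) \<le> 2 * (12 / 2 ^ j) ^ (n - l) * torus_norm p (besov_block \<phi> f j)"
proof -
  obtain K where K: "0 \<le> K" "\<And>j f. torus_norm p (\<lambda>t. A (solution_block f 0 j t) + L (\<lambda>\<theta>. solution_block f 0 j (t + \<theta>))) \<le> K * torus_norm p (solution_block f 0 j)"
    by (rule lower_order_bound) (rule that)
  have "(\<lambda>j. 12 / 2 ^ j * (K + real n + 1) :: real) \<longlonglongrightarrow> 0"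
  proof -
    have "(\<lambda>j. 12 / 2 ^ j * (K + real n + 1)) = (\<lambda>j. 12 * (K + real n + 1) * (1 / 2) ^ j)"
      by (simp add: power_one_over fun_eq_iff)
    moreover have "(\<lambda>j. 12 * (K + real n + 1) * (1 / 2) ^ j) \<longlonglongrightarrow> 0"
      by (intro tendsto_mult_right_zero LIMSEQ_realpow_zero) auto
    ultimately show ?thesis by (simp only:)
  qed
  then have "eventually (\<lambda>j. 12 / 2 ^ j * (K + real n + 1) < 1 / 2) sequentially"
    by (rule order_tendstoD) simp
  then obtain j0 where j0: "\<And>j. j \<ge> j0 \<Longrightarrow> 12 / 2 ^ j * (K + real n + 1) < 1 / 2"
    by (auto simp: eventually_sequentially)
  have "torus_norm p (solution_block f l j) \<le> 2 * (12 / 2 ^ j) ^ (n - l) * torus_norm p (besov_block \<phi> f j)"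
    if j: "j \<ge> Suc j0" and l: "l \<le> n" for f j l
  proof -
    define \<epsilon> :: real where "\<epsilon> = 12 / 2 ^ j"
    have \<epsilon>K: "\<epsilon> * (K + real n + 1) < 1 / 2" unfolding \<epsilon>_def using j by (intro j0) simp
    have \<epsilon>: "0 < \<epsilon>" by (simp add: \<epsilon>_def)
    have "\<epsilon> * 1 \<le> \<epsilon> * (K + real n + 1)" using K(1) \<epsilon> by (intro mult_left_mono) auto
    then have \<epsilon>1: "\<epsilon> \<le> 1" using \<epsilon>K by linarith
    let ?X = "\<lambda>l. torus_norm p (solution_block f l j)"
    \<comment> \<open>As \<open>j \<ge> 1\<close>, the block lives on the frequencies \<open>M \<le> \<bar>k\<bar> \<le> 4 M\<close> with \<open>M = 2\<^sup>j\<^sup>-\<^sup>1\<close>, and \<open>6 / M = \<epsilon>\<close>.\<close>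
    have anti: "?X l \<le> \<epsilon> ^ (n - l) * ?X n" if "l \<le> n" for l
    proof -
      have "4 * 2 ^ (j - 1) = (2 :: int) ^ (j + 1)" using j by (cases j) auto
      then have freq: "2 ^ (j - 1) \<le> \<bar>k\<bar> \<and> \<bar>k\<bar> \<le> 4 * 2 ^ (j - 1)" if "k \<in> spectrum \<phi> j" for k
        using spectrum_bounds[OF \<phi> that] j by simp
      have "6 / of_int (2 ^ (j - 1)) = \<epsilon>" using j by (cases j) (auto simp: \<epsilon>_def)
      then show ?thesis
        using torus_norm_antiderivative[OF p, of "2 ^ (j - 1)" "spectrum \<phi> j" l "solution_coeff f j" "n - l"]
          finite_spectrum[OF \<phi>] freq that by (simp add: solution_block_def)
    qed
    have low: "?X l \<le> \<epsilon> * ?X n" if "l < n" for l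
    proof -
      have "\<epsilon> ^ (n - l) \<le> \<epsilon> ^ 1" using \<epsilon> \<epsilon>1 that by (intro power_decreasing) auto
      then have "\<epsilon> ^ (n - l) * ?X n \<le> \<epsilon> * ?X n" by (intro mult_right_mono) auto
      then show ?thesis using anti[of l] that by simp
    qed
    let ?low = "\<lambda>t. A (solution_block f 0 j t) + L (\<lambda>\<theta>. solution_block f 0 j (t + \<theta>))"
    have split: "solution_block f n j t = ?low t + (besov_block \<phi> f j t + (\<Sum>l=1..<n. - solution_block f l j t))" for t
    proof -
      have "{1..n} = insert n {1..<n}" using n by auto
      then have "(\<Sum>l=1..n. solution_block f l j t) = solution_block f n j t + (\<Sum>l=1..<n. solution_block f l j t)" by simp
      then show ?thesis using solution_block_equation[of f j t] by (simp add: sum_negf algebra_simps)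
    qed
    have cs: "continuous_on {0..2 * pi} (\<lambda>t. \<Sum>l=1..<n. - solution_block f l j t)"
      by (intro continuous_on_sum continuous_on_minus continuous_solution_block)
    have cb: "continuous_on {0..2 * pi} (besov_block \<phi> f j)"
      unfolding besov_block_eq by (rule continuous_on_trig_poly)
    have clow: "continuous_on {0..2 * pi} ?low"
      unfolding solution_block_0 bounded_clinear_trig_poly[OF A_bounded_clinear finite_spectrum[OF \<phi>]]
        history_trig_poly[OF L p finite_spectrum[OF \<phi>]]
      by (intro continuous_on_add continuous_on_trig_poly)
    have "?X n = torus_norm p (\<lambda>t. ?low t + (besov_block \<phi> f j t + (\<Sum>l=1..<n. - solution_block f l j t)))"
      by (simp only: split[symmetric])
    also have "\<dots> \<le> torus_norm p ?low + torus_norm p (\<lambda>t. besov_block \<phi> f j t + (\<Sum>l=1..<n. - solution_block f l j t))"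
      by (rule torus_norm_triangle[OF p clow continuous_on_add[OF cb cs]])
    also have "torus_norm p (\<lambda>t. besov_block \<phi> f j t + (\<Sum>l=1..<n. - solution_block f l j t))
       \<le> torus_norm p (besov_block \<phi> f j) + torus_norm p (\<lambda>t. \<Sum>l=1..<n. - solution_block f l j t)"
      by (rule torus_norm_triangle[OF p cb cs])
    also have "torus_norm p (\<lambda>t. \<Sum>l=1..<n. - solution_block f l j t) \<le> (\<Sum>l=1..<n. torus_norm p (\<lambda>t. - solution_block f l j t))"
      by (rule torus_norm_sum[OF p]) (auto intro: continuous_on_minus continuous_solution_block)
    also have "\<dots> = (\<Sum>l=1..<n. ?X l)" by (simp add: Lp_norm_def)
    also have "\<dots> \<le> (\<Sum>l=1..<n. \<epsilon> * ?X n)" by (intro sum_mono low) simp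
    also have "\<dots> \<le> real n * (\<epsilon> * ?X n)"
      using \<epsilon> by (simp add: mult_right_mono)
    also have "torus_norm p ?low \<le> K * (\<epsilon> * ?X n)"
      by (rule order_trans[OF K(2) mult_left_mono[OF low K(1)]]) (use n in simp)
    finally have "?X n \<le> torus_norm p (besov_block \<phi> f j) + \<epsilon> * (K + real n) * ?X n"
      by (simp add: algebra_simps)
    moreover have "\<epsilon> * (K + real n) * ?X n \<le> 1 / 2 * ?X n"
      using \<epsilon>K \<epsilon> by (intro mult_right_mono) (auto simp: algebra_simps)
    ultimately have "?X n \<le> 2 * torus_norm p (besov_block \<phi> f j)" by linarith
    then have "\<epsilon> ^ (n - l) * ?X n \<le> \<epsilon> ^ (n - l) * (2 * torus_norm p (besov_block \<phi> f j))"
      using \<epsilon> by (intro mult_left_mono) auto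
    from order_trans[OF anti[OF l] this] show ?thesis unfolding \<epsilon>_def by (simp only: mult_ac)
  qed
  then show thesis by (rule that)
qed

lemma solution_block_series:
  assumes f: "f \<in> besov \<phi> s p q" and l: "l \<le> n"
  shows "periodic_Lp_series p (solution_block f l)"
proof
  obtain j0 where j0: "\<And>f j l. j \<ge> j0 \<Longrightarrow> l \<le> n \<Longrightarrow>
    torus_norm p (solution_block f l j) \<le> 2 * (12 / 2 ^ j) ^ (n - l) * torus_norm p (besov_block \<phi> f j)"
    by (rule solution_block_estimate) (rule that)
  show "summable (\<lambda>j. torus_norm p (solution_block f l j))"
  proof (rule summable_comparison_test')
    show "summable (\<lambda>j. 2 * 12 ^ (n - l) * torus_norm p (besov_block \<phi> f j))"
      by (rule summable_mult[OF besov_blocks_summable[OF s q f]])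
    fix j assume "j \<ge> j0"
    have "(12 / 2 ^ j :: real) ^ (n - l) \<le> 12 ^ (n - l)"
      by (intro power_mono) (auto simp: divide_le_eq)
    then have "2 * (12 / 2 ^ j) ^ (n - l) * torus_norm p (besov_block \<phi> f j) \<le> 2 * 12 ^ (n - l) * torus_norm p (besov_block \<phi> f j)"
      by (intro mult_right_mono) auto
    with j0[OF \<open>j \<ge> j0\<close> l, of f] show "norm (torus_norm p (solution_block f l j)) \<le> 2 * 12 ^ (n - l) * torus_norm p (besov_block \<phi> f j)"
      by simp
  qed
qed (simp_all add: p continuous_solution_block solution_block_periodic)

text \<open>
  The factor \<open>(12 / 2 ^ j) ^ n\<close> compensates the weights of \<open>l \<le> n\<close> further derivatives. Finitely many blocks do not matter for
  summability.
\<close>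

lemma solution_block_besov:
  assumes f: "f \<in> besov \<phi> s p q" and l: "l \<le> n" and x: "x \<in> distributions" "besov_block \<phi> x = solution_block f 0"
  shows "x \<in> besov \<phi> (s + real l) p q"
proof -
  obtain j0 where j0: "\<And>f j l. j \<ge> j0 \<Longrightarrow> l \<le> n \<Longrightarrow>
    torus_norm p (solution_block f l j) \<le> 2 * (12 / 2 ^ j) ^ (n - l) * torus_norm p (besov_block \<phi> f j)"
    by (rule solution_block_estimate) (rule that)
  let ?F = "\<lambda>j. torus_norm p (besov_block \<phi> f j)" and ?X = "\<lambda>j. torus_norm p (solution_block f 0 j)"
  have "summable (\<lambda>j. 2 powr ((s + real l) * real j * q) * ?X j powr q)"
  proof (rule summable_comparison_test')
    show "summable (\<lambda>j. (2 * 12 ^ n) powr q * (2 powr (s * real j * q) * ?F j powr q))"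
      using f by (intro summable_mult) (simp add: besov_def)
    fix j assume j: "j \<ge> j0"
    have "2 powr (real l * real j) * ?X j \<le> 2 powr (real l * real j) * (2 * (12 / 2 ^ j) ^ n * ?F j)"
      using j0[OF j, of 0 f] by (intro mult_left_mono) auto
    also have "\<dots> = (2 powr (real l * real j) / 2 powr (real n * real j)) * (2 * 12 ^ n * ?F j)"
      by (simp add: power_divide powr_realpow[symmetric] powr_powr mult.commute[of "real n"])
    also have "\<dots> \<le> 1 * (2 * 12 ^ n * ?F j)"
      using l by (intro mult_right_mono) (auto intro!: mult_right_mono)
    finally have "(2 powr (real l * real j) * ?X j) powr q \<le> (2 * 12 ^ n * ?F j) powr q"
      using q by (intro powr_mono2) auto
    then have "2 powr (real l * real j * q) * ?X j powr q \<le> (2 * 12 ^ n) powr q * ?F j powr q"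
      by (simp add: powr_mult powr_powr)
    then have "2 powr (s * real j * q) * (2 powr (real l * real j * q) * ?X j powr q)
       \<le> 2 powr (s * real j * q) * ((2 * 12 ^ n) powr q * ?F j powr q)"
      by (rule mult_left_mono) simp
    moreover have "2 powr ((s + real l) * real j * q) = 2 powr (s * real j * q) * 2 powr (real l * real j * q)"
      by (simp add: powr_add[symmetric] algebra_simps)
    ultimately show "norm (2 powr ((s + real l) * real j * q) * ?X j powr q)
       \<le> (2 * 12 ^ n) powr q * (2 powr (s * real j * q) * ?F j powr q)"
      by (simp add: mult_ac)
  qed
  then show ?thesis using x by (simp add: besov_def)
qed

end

section \<open>Existence and uniqueness of the solution\<close>

lemma represents_fourier_coeff:
  assumes "represents g u"
  shows "((\<lambda>t. cis (- (of_int k * t)) *\<^sub>C g t) has_integral (2 * pi) *\<^sub>R fourier_coeff u k) {0..2 * pi}"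
  using representsD[OF assms test_functions_cis[of "- k"]] by (simp add: fourier_coeff_def)

context periodic_Lp_series
begin

text \<open>
  The partial sums converge uniformly, and for each of them the coefficient is given by \<open>history_trig_poly\<close>.
\<close>

lemma history_fourier_coeff:
  assumes L: "bounded_clinear_Lp p (history_measure N) L"
    and P: "\<And>j. P j = trig_poly (F j) (c j)" "\<And>j. finite (F j)"
    and T: "bounded_linear (delay_symbol L k)"
    and c: "(\<lambda>j. if k \<in> F j then c j k else 0) sums x"
  shows "((\<lambda>t. cis (- (of_int k * t)) *\<^sub>C L (\<lambda>\<theta>. total (t + \<theta>))) has_integral (2 * pi) *\<^sub>R delay_symbol L k x) {0..2 * pi}"
proof -
  obtain K where K: "0 \<le> K" "\<And>t J. norm (L (\<lambda>\<theta>. total (t + \<theta>)) - (\<Sum>j<J. L (\<lambda>\<theta>. P j (t + \<theta>)))) \<le> K * tail_norm J"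
    using history_operator[OF L] by (elim exE conjE) (rule that; blast)
  let ?e = "\<lambda>t. cis (- (of_int k * t))"
  let ?a = "\<lambda>j. if k \<in> F j then delay_symbol L k (c j k) else 0"
  have Lj: "((\<lambda>t. ?e t *\<^sub>C L (\<lambda>\<theta>. P j (t + \<theta>))) has_integral (2 * pi) *\<^sub>R ?a j) {0..2 * pi}" for j
    unfolding P(1) history_trig_poly[OF L p P(2)] by (rule integral_trig_poly[OF P(2)])
  have g: "((\<lambda>t. ?e t *\<^sub>C (\<Sum>j<J. L (\<lambda>\<theta>. P j (t + \<theta>)))) has_integral (\<Sum>j<J. (2 * pi) *\<^sub>R ?a j)) {0..2 * pi}" for J
    unfolding scaleC.sum_right by (intro has_integral_sum Lj) simp
  have h: "((\<lambda>t. K * tail_norm J) has_integral 2 * pi * (K * tail_norm J)) {0..2 * pi}" for J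
    using has_integral_const_real[of "K * tail_norm J" 0 "2 * pi"] by simp
  have H: "(\<lambda>J. 2 * pi * (K * tail_norm J)) \<longlonglongrightarrow> 0"
    by (intro tendsto_mult_right_zero tail_norm_tendsto_0)
  have le: "norm (?e t *\<^sub>C L (\<lambda>\<theta>. total (t + \<theta>)) - ?e t *\<^sub>C (\<Sum>j<J. L (\<lambda>\<theta>. P j (t + \<theta>)))) \<le> K * tail_norm J" for J t
    using K(2)[of t J] by (simp add: scaleC.diff_right[symmetric] norm_scaleC)
  obtain I where I: "((\<lambda>t. ?e t *\<^sub>C L (\<lambda>\<theta>. total (t + \<theta>))) has_integral I) {0..2 * pi}"
    "(\<lambda>J. \<Sum>j<J. (2 * pi) *\<^sub>R ?a j) \<longlonglongrightarrow> I"
    using has_integral_limit_dominated[OF g h H le] by (elim exE conjE) (rule that)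
  have "(\<lambda>j. delay_symbol L k (if k \<in> F j then c j k else 0)) sums delay_symbol L k x"
    by (rule bounded_linear.sums[OF T c])
  moreover have "(\<lambda>j. delay_symbol L k (if k \<in> F j then c j k else 0)) = ?a"
    using linear_0[OF bounded_linear.linear[OF T]] by auto
  ultimately have "(\<lambda>j. (2 * pi) *\<^sub>R ?a j) sums ((2 * pi) *\<^sub>R delay_symbol L k x)"
    by (intro sums_scaleR_right) simp
  then have "I = (2 * pi) *\<^sub>R delay_symbol L k x"
    using I(2) LIMSEQ_unique unfolding sums_def by blast
  with I(1) show ?thesis by simp
qed

text \<open>
  The norm bound makes \<open>L\<close> insensitive to null sets, and by periodicity the set where the two functions differ is null
  on the whole line.
\<close>

lemma history_AE_eq:
  assumes L: "bounded_clinear_Lp p (history_measure N) L"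
    and per: "\<And>t. y (t + 2 * pi) = y t" and eq: "AE t in torus. y t = total t"
  shows "L (\<lambda>\<theta>. y (t + \<theta>)) = L (\<lambda>\<theta>. total (t + \<theta>))"
proof -
  let ?Z = "{t. y t \<noteq> total t}"
  have "negligible ?Z"
  proof (rule negligible_periodic)
    have "negligible {t \<in> {0..2 * pi}. \<not> y t = total t}"
      using eq by (subst (asm) AE_lebesgue_on_iff_negligible) auto
    then show "negligible (?Z \<inter> {0..2 * pi})" by (rule negligible_subset) auto
  qed (simp add: per total_periodic)
  then have ae: "AE \<theta> in history_measure N. y (t + \<theta>) = total (t + \<theta>)"
    by (rule AE_lebesgue_on_shift) auto
  note tot = history_mem_Lp[of N t]
  have sm: "strongly_measurable (history_measure N) (\<lambda>\<theta>. y (t + \<theta>))"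
    by (rule strongly_measurable_AE_cong[of _ "\<lambda>\<theta>. total (t + \<theta>)"])
      (use tot ae in \<open>auto simp: mem_Lp_def\<close>)
  have "integrable (history_measure N) (\<lambda>\<theta>. norm (y (t + \<theta>)) powr p)"
  proof (rule integrable_cong_AE_imp)
    show "integrable (history_measure N) (\<lambda>\<theta>. norm (total (t + \<theta>)) powr p)" using tot by (simp add: mem_Lp_def)
    show "(\<lambda>\<theta>. norm (y (t + \<theta>)) powr p) \<in> borel_measurable (history_measure N)"
      using strongly_measurable_norm[OF sm] by simp
    show "AE \<theta> in history_measure N. norm (total (t + \<theta>)) powr p = norm (y (t + \<theta>)) powr p"
      using ae by eventually_elim simp
  qed
  with sm have ym: "mem_Lp p (history_measure N) (\<lambda>\<theta>. y (t + \<theta>))" by (simp add: mem_Lp_def)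
  let ?d = "\<lambda>\<theta>. y (t + \<theta>) - total (t + \<theta>)"
  have smd: "strongly_measurable (history_measure N) ?d"
    using strongly_measurable_diff[OF sm] tot by (simp add: mem_Lp_def)
  have zero: "AE \<theta> in history_measure N. norm (?d \<theta>) powr p = 0"
    using ae by eventually_elim simp
  have dm: "(\<lambda>\<theta>. norm (?d \<theta>) powr p) \<in> borel_measurable (history_measure N)"
    using strongly_measurable_norm[OF smd] by simp
  have di: "integrable (history_measure N) (\<lambda>\<theta>. norm (?d \<theta>) powr p)"
    by (rule integrable_cong_AE_imp[OF integrable_zero dm]) (use zero in \<open>eventually_elim; simp\<close>)
  have "(LINT \<theta>|history_measure N. norm (?d \<theta>) powr p) = 0"
    using zero by (rule integral_eq_zero_AE)
  then have "Lp_norm p (history_measure N) ?d = 0" by (simp add: Lp_norm_def)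
  moreover have dmem: "mem_Lp p (history_measure N) ?d" using smd di by (simp add: mem_Lp_def)
  obtain K where "\<And>f. mem_Lp p (history_measure N) f \<Longrightarrow> norm (L f) \<le> K * Lp_norm p (history_measure N) f"
    by (rule bounded_clinear_Lp_bound[OF L]) (rule that)
  from this[OF dmem] have "norm (L ?d) \<le> K * Lp_norm p (history_measure N) ?d" .
  ultimately have "L ?d = 0" by simp
  then show ?thesis using bounded_clinear_Lp_diff[OF L ym tot] by simp
qed

end

context delay_equation
begin

text \<open>
  The delay term of a solution is that of the sum of its blocks, so on the mode \<open>k\<close> it is \<open>Lk k\<close> applied to the
  coefficient of \<open>x\<close>, and the mode satisfies the characteristic equation.
\<close>

lemma solution_fourier_coeff:
  assumes sol: "strong_solution \<phi> s p q n D A L f x"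
  shows "fourier_coeff x k = resolvent k (fourier_coeff f k)"
proof -
  have x: "x \<in> besov \<phi> s p q" and xd: "x \<in> distributions"
    using sol by (auto simp: strong_solution_def besov_def)
  obtain y g where y': "\<forall>j\<le>n. represents (y j) (distr_deriv j x)" and g: "represents g f"
    and eq: "AE t in torus. y 0 t \<in> D \<and> (\<Sum>j=1..n. y j t) = A (y 0 t) + L (\<lambda>\<theta>. y 0 (t + \<theta>)) + g t"
    using sol unfolding strong_solution_def by (elim exE conjE) (rule that)
  have y: "represents (y j) (distr_deriv j x)" if "j \<le> n" for j using y' that by blast
  interpret x: periodic_Lp_series p "besov_block \<phi> x" by (rule besov_series[OF p s q x])
  have "distr_deriv 0 x = x"
    by (rule distributions_eq_iff_fourier_coeff[OF distr_deriv_distribution[OF xd] xd])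
      (simp add: fourier_coeff_distr_deriv[OF xd])
  then have y0: "represents (y 0) x" using y[of 0] by simp
  have per: "y 0 (t + 2 * pi) = y 0 t" for t using y0 by (simp add: represents_def)
  have "AE t in torus. y 0 t = x.total t"
    by (rule represents_unique[OF y0 besov_represented_by_series[OF p s q \<phi> x]])
  then have hist: "L (\<lambda>\<theta>. y 0 (t + \<theta>)) = L (\<lambda>\<theta>. x.total (t + \<theta>))" for t
    by (rule x.history_AE_eq[where y = "y 0", OF L per])
  let ?e = "\<lambda>t. cis (- (of_int k * t))"
  let ?x = "fourier_coeff x k"
  have A: "bounded_linear A" using A_bounded_clinear by (simp add: bounded_clinear_def)
  \<comment> \<open>The equation is multiplied by \<open>?e\<close> and integrated over a period.\<close>
  have lhs: "((\<lambda>t. ?e t *\<^sub>C (\<Sum>j=1..n. y j t)) has_integral (\<Sum>j=1..n. (2 * pi) *\<^sub>R ((\<i> * of_int k) ^ j *\<^sub>C ?x))) {0..2 * pi}"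
    unfolding scaleC.sum_right
  proof (rule has_integral_sum)
    fix j assume "j \<in> {1..n}"
    then show "((\<lambda>t. ?e t *\<^sub>C y j t) has_integral (2 * pi) *\<^sub>R ((\<i> * of_int k) ^ j *\<^sub>C ?x)) {0..2 * pi}"
      using represents_fourier_coeff[OF y[of j], of k] by (simp add: fourier_coeff_distr_deriv[OF xd])
  qed simp
  have "((\<lambda>t. A (?e t *\<^sub>C y 0 t)) has_integral A ((2 * pi) *\<^sub>R ?x)) {0..2 * pi}"
    using has_integral_linear[OF represents_fourier_coeff[OF y0] A, of k] by (simp add: o_def)
  then have 1: "((\<lambda>t. ?e t *\<^sub>C A (y 0 t)) has_integral (2 * pi) *\<^sub>R A ?x) {0..2 * pi}"
    using A_bounded_clinear linear_scale[OF bounded_linear.linear[OF A]] by (simp add: bounded_clinear_def)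
  have 2: "((\<lambda>t. ?e t *\<^sub>C L (\<lambda>\<theta>. y 0 (t + \<theta>))) has_integral (2 * pi) *\<^sub>R Lk k ?x) {0..2 * pi}"
    unfolding hist
    by (rule x.history_fourier_coeff[OF L besov_block_eq finite_spectrum[OF \<phi>] _ sums_resolution[OF \<phi>]])
      (use Lk_clinear in \<open>simp add: bounded_clinear_def\<close>)
  have 3: "((\<lambda>t. ?e t *\<^sub>C g t) has_integral (2 * pi) *\<^sub>R fourier_coeff f k) {0..2 * pi}"
    by (rule represents_fourier_coeff[OF g])
  have rhs: "((\<lambda>t. ?e t *\<^sub>C (A (y 0 t) + L (\<lambda>\<theta>. y 0 (t + \<theta>)) + g t)) has_integral
     (2 * pi) *\<^sub>R A ?x + (2 * pi) *\<^sub>R Lk k ?x + (2 * pi) *\<^sub>R fourier_coeff f k) {0..2 * pi}"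
    using has_integral_add[OF has_integral_add[OF 1 2] 3] by (simp add: scaleC_add_right)
  define Z where "Z = {t \<in> {0..2 * pi}. \<not> (y 0 t \<in> D \<and> (\<Sum>j=1..n. y j t) = A (y 0 t) + L (\<lambda>\<theta>. y 0 (t + \<theta>)) + g t)}"
  have "negligible Z"
    using eq unfolding Z_def by (subst (asm) AE_lebesgue_on_iff_negligible) auto
  then have "((\<lambda>t. ?e t *\<^sub>C (\<Sum>j=1..n. y j t)) has_integral
     (2 * pi) *\<^sub>R A ?x + (2 * pi) *\<^sub>R Lk k ?x + (2 * pi) *\<^sub>R fourier_coeff f k) {0..2 * pi}"
    by (rule has_integral_spike[OF _ _ rhs]) (auto simp: Z_def)
  from has_integral_unique[OF lhs this]
  have "(2 * pi) *\<^sub>R (symbol k *\<^sub>C ?x) = (2 * pi) *\<^sub>R (A ?x + Lk k ?x + fourier_coeff f k)"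
    by (simp only: scaleR_sum_right[symmetric] scaleC.sum_left scaleR_add_right)
  then have "symbol k *\<^sub>C ?x = A ?x + Lk k ?x + fourier_coeff f k"
    unfolding scaleR_left_imp_eq by simp
  then have "char_operator n A L k ?x = fourier_coeff f k" by (simp only: char_operator_def) simp
  then show ?thesis by (rule resolvent_unique)
qed

lemma solution_unique:
  assumes "strong_solution \<phi> s p q n D A L f x" "strong_solution \<phi> s p q n D A L f x'"
  shows "x = x'"
  by (rule distributions_eq_iff_fourier_coeff)
    (use assms solution_fourier_coeff[OF assms(1)] solution_fourier_coeff[OF assms(2)] in
      \<open>simp_all add: strong_solution_def besov_def\<close>)

text \<open>
  The derivatives are represented by the sums of the differentiated blocks, as the coefficients show; the
  equation holds wherever all the series converge.
\<close>

lemma solution_exists: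
  assumes f: "f \<in> besov \<phi> s p q"
  shows "\<exists>x. strong_solution \<phi> s p q n D A L f x"
proof -
  note fin = finite_spectrum[OF \<phi>]
  note ser = solution_block_series[OF f]
  define Y where "Y l = periodic_Lp_series.total (solution_block f l)" for l
  interpret F: periodic_Lp_series p "besov_block \<phi> f" by (rule besov_series[OF p s q f])
  have solution_coeff_sums: "(\<lambda>j. if k \<in> spectrum \<phi> j then (\<i> * of_int k) ^ l *\<^sub>C solution_coeff f j k else 0)
      sums ((\<i> * of_int k) ^ l *\<^sub>C resolvent k (fourier_coeff f k))" for k l
  proof -
    have "(\<lambda>j. (\<i> * of_int k) ^ l *\<^sub>C (if k \<in> spectrum \<phi> j then \<phi> j (of_int k) *\<^sub>C resolvent k (fourier_coeff f k) else 0))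
       sums ((\<i> * of_int k) ^ l *\<^sub>C resolvent k (fourier_coeff f k))"
      by (rule bounded_linear.sums[OF scaleC.bounded_linear_right sums_resolution[OF \<phi>]])
    moreover have "(\<lambda>j. (\<i> * of_int k) ^ l *\<^sub>C (if k \<in> spectrum \<phi> j then \<phi> j (of_int k) *\<^sub>C resolvent k (fourier_coeff f k) else 0))
      = (\<lambda>j. if k \<in> spectrum \<phi> j then (\<i> * of_int k) ^ l *\<^sub>C solution_coeff f j k else 0)"
      by (auto simp: solution_coeff_def scaleC.zero_right fun_eq_iff)
    ultimately show ?thesis by (simp only:)
  qed
  have Yd: "represents (Y l) (function_distribution (Y l))" "function_distribution (Y l) \<in> distributions" if "l \<le> n" for l
    unfolding Y_def by (rule periodic_Lp_series.total_represents[OF ser[OF that]])+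
  have Yc: "fourier_coeff (function_distribution (Y l)) k = (\<i> * of_int k) ^ l *\<^sub>C resolvent k (fourier_coeff f k)"
    if "l \<le> n" for l k
    unfolding Y_def
    by (rule sums_unique2[OF periodic_Lp_series.fourier_coeff_total[OF ser[OF that] solution_block_def fin] solution_coeff_sums])
  define x where "x = function_distribution (Y 0)"
  have xd: "x \<in> distributions" unfolding x_def by (rule Yd) simp
  have xc: "fourier_coeff x k = resolvent k (fourier_coeff f k)" for k
    using Yc[of 0 k] by (simp add: x_def)
  have deriv: "distr_deriv l x = function_distribution (Y l)" if "l \<le> n" for l
    by (rule distributions_eq_iff_fourier_coeff[OF distr_deriv_distribution[OF xd] Yd(2)[OF that]])
      (simp add: fourier_coeff_distr_deriv[OF xd] xc Yc[OF that])
  have "besov_block \<phi> x = solution_block f 0"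
    by (rule ext) (simp add: besov_block_eq solution_block_0 solution_coeff_def[abs_def] xc)
  then have besov: "x \<in> besov \<phi> (s + real l) p q" if "l \<le> n" for l
    by (rule solution_block_besov[OF f that xd])
  have "negligible (F.exceptional \<union> (\<Union>l\<le>n. periodic_Lp_series.exceptional (solution_block f l)))"
    using periodic_Lp_series.negligible_exceptional[OF ser] F.negligible_exceptional
    by (intro negligible_Un negligible_Union) auto
  then have "AE t in torus. (\<Sum>l=1..n. Y l (0 + t)) = A (Y 0 (0 + t)) + L (\<lambda>\<theta>. Y 0 (0 + t + \<theta>)) + F.total (0 + t)"
  proof (rule AE_lebesgue_on_shift)
    fix t assume t: "t \<notin> F.exceptional \<union> (\<Union>l\<le>n. periodic_Lp_series.exceptional (solution_block f l))"
    have Ys: "(\<lambda>j. solution_block f l j t) sums Y l t" if "l \<le> n" for l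
      unfolding Y_def using t that by (intro periodic_Lp_series.sums_total[OF ser[OF that]]) auto
    have lhs: "(\<lambda>j. \<Sum>l=1..n. solution_block f l j t) sums (\<Sum>l=1..n. Y l t)"
      by (rule sums_sum) (simp add: Ys)
    have "(\<lambda>j. A (solution_block f 0 j t)) sums A (Y 0 t)"
      using A_bounded_clinear by (intro bounded_linear.sums[OF _ Ys]) (auto simp: bounded_clinear_def)
    moreover have "(\<lambda>j. L (\<lambda>\<theta>. solution_block f 0 j (t + \<theta>))) sums L (\<lambda>\<theta>. Y 0 (t + \<theta>))"
      unfolding Y_def by (rule periodic_Lp_series.history_operator_sums[OF ser L]) simp
    moreover have "(\<lambda>j. besov_block \<phi> f j t) sums F.total t"
      using t by (intro F.sums_total) auto
    ultimately have "(\<lambda>j. A (solution_block f 0 j t) + L (\<lambda>\<theta>. solution_block f 0 j (t + \<theta>)) + besov_block \<phi> f j t)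
       sums (A (Y 0 t) + L (\<lambda>\<theta>. Y 0 (t + \<theta>)) + F.total t)"
      by (intro sums_add)
    then show "(\<Sum>l=1..n. Y l t) = A (Y 0 t) + L (\<lambda>\<theta>. Y 0 (t + \<theta>)) + F.total t"
      using lhs sums_unique2 unfolding solution_block_equation by blast
  qed simp
  then have ae: "AE t in torus. Y 0 t \<in> D \<and> (\<Sum>l=1..n. Y l t) = A (Y 0 t) + L (\<lambda>\<theta>. Y 0 (t + \<theta>)) + F.total t"
    by (simp add: D_UNIV)
  have "strong_solution \<phi> s p q n D A L f x"
    unfolding strong_solution_def
  proof (intro conjI exI[of _ Y] exI[of _ F.total] ballI allI impI ae)
    show "x \<in> besov \<phi> s p q" using besov[of 0] by simp
    show "x \<in> besov \<phi> (s + real j) p q" if "j \<in> {1..n}" for j using besov[of j] that by simp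
    show "represents (Y j) (distr_deriv j x)" if "j \<le> n" for j using Yd(1)[OF that] deriv[OF that] by simp
    show "represents F.total f" by (rule besov_represented_by_series[OF p s q \<phi> f])
  qed
  then show ?thesis by blast
qed

end

theorem theorem3p2:
  fixes p q s r :: real and n N :: nat
    and \<phi> :: "nat \<Rightarrow> real \<Rightarrow> complex"
    and D :: "'a::complex_banach set" and A :: "'a \<Rightarrow> 'a"
    and L :: "(real \<Rightarrow> 'a) \<Rightarrow> 'a"
  assumes "1 \<le> p" and "1 \<le> q" and "s > 0" and "n \<ge> 1"
    and "dyadic_resolution \<phi>"
    and "1 < r" and "r \<le> 2" and "fourier_type TYPE('a) r"
    and "clinear_on D A" and "closed_operator D A" and "bounded_operator D A"
    and "N \<ge> 1"
    and "bounded_clinear_Lp p (lebesgue_on {- (2 * pi * real N)..0}) L"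
    and "M_bounded (delay_symbol L)"
    and "\<And>k. bij_betw (char_operator n A L k) D UNIV"
    and "\<And>k. bounded_clinear (inv_into D (char_operator n A L k))"
    and "bdd_above (range (\<lambda>k::int.
           onorm (\<lambda>x. (\<i> * of_int k) ^ n *\<^sub>C inv_into D (char_operator n A L k) x)))"
  shows "\<forall>f \<in> besov \<phi> s p q. \<exists>!x. strong_solution \<phi> s p q n D A L f x"
proof -
  interpret delay_equation p q s n N \<phi> D A L
    by unfold_locales (use assms in auto)
  show ?thesis using solution_exists solution_unique by (auto intro!: ex_ex1I)
qed

end
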